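(* Let $\mathcal I=\mathbb R_+=[0,\infty)$, $x_0=0$, $x_n-x_{n-1}=d_n=1/n$, and $\alpha_n=-4n-2$, $n\in\mathbb N$; $X=\{x_n\}_{n=1}^\infty$. (i) The Hamiltonian $$\mathrm H_{X,\alpha,0}=-\frac{\mathrm d^2}{\mathrm dx^2}-\sum_{n=1}^\infty(4n+2)\,\delta(x-x_n)$$ is self-adjoint. (ii) Let $a_0>0$ be such that $a_0\dfrac{\cosh a_0}{\sinh a_0}=2$, and let $q_{a_0}(x)=a_0^2\sum_{n=1}^\infty n^2\chi_{(x_{n-1},x_n)}(x)$. Then the Hamiltonian $$\mathrm H_{X,\alpha,q_{a_0}}=-\frac{\mathrm d^2}{\mathrm dx^2}+a_0^2\sum_{n=1}^\infty n^2\chi_{(x_{n-1},x_n)}(x)-\sum_{n=1}^\infty(4n+2)\,\delta(x-x_n)$$ is symmetric with $\mathrm n_\pm(\mathrm H_{X,\alpha,q_{a_0}})=1$.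
   Context: For a real potential $q\in L^2_{loc}[0,\infty)$ and $\alpha=\{\alpha_n\}\subset\mathbb R$, the operator $\mathrm H_{X,\alpha,q}$ associated with the formal expression $-\frac{\mathrm d^2}{\mathrm dx^2}+q(x)+\sum_n\alpha_n\delta(x-x_n)$ is the closure in $L^2(\mathcal I)$ of the symmetric operator $-\frac{\mathrm d^2}{\mathrm dx^2}+q(x)$ with domain $$\{f\in W^{2,2}_{\mathrm{comp}}(\mathcal I\setminus X): f'(0)=0,\ f(x_n+)=f(x_n-),\ f'(x_n+)-f'(x_n-)=\alpha_nf(x_n),\ n\in\mathbb N\},$$ where $W^{2,2}(\mathcal I\setminus X)=\{f\in L^2(\mathcal I): f,f'\in AC_{loc}(\mathcal I\setminus X),\ f''\in L^2(\mathcal I)\}$ and $W^{2,2}_{\mathrm{comp}}(\mathcal I\setminus X)$ is the set of its elements with compact support in $\mathcal I=[0,\infty)$. $\chi_{(c,d)}$ is the indicator function of $(c,d)$. $\mathrm n_\pm(T)=\dim\ker(T^*\mp\mathrm i)$ are the deficiency indices. *)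

theory Defs
  imports "HOL-Analysis.Analysis" "HOL-Library.Extended_Nat"
begin

section \<open>The complex Hilbert space $L^2[0,\infty)$\<close>

abbreviation leb_I :: "real measure" where
  "leb_I \<equiv> lebesgue_on {0..}"

definition sq_int :: "(real \<Rightarrow> complex) \<Rightarrow> bool" where
  "sq_int f \<longleftrightarrow> f \<in> borel_measurable leb_I \<and> integrable leb_I (\<lambda>x. (cmod (f x))\<^sup>2)"

definition l2_eq :: "(real \<Rightarrow> complex) \<Rightarrow> (real \<Rightarrow> complex) \<Rightarrow> bool" where
  "l2_eq f g \<longleftrightarrow> sq_int f \<and> sq_int g \<and> (AE x in leb_I. f x = g x)"

lemma sq_int_zero: "sq_int (\<lambda>x. 0)"
  by (simp add: sq_int_def)

lemma sq_int_scale: "sq_int f \<Longrightarrow> sq_int (\<lambda>x. c * f x)"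
  by (auto simp: sq_int_def norm_mult power_mult_distrib)

lemma sq_int_mult_cnj:
  assumes "sq_int f" "sq_int g"
  shows "integrable leb_I (\<lambda>x. f x * cnj (g x))"
proof (rule Bochner_Integration.integrable_bound)
  show "integrable leb_I (\<lambda>x. (cmod (f x))\<^sup>2 + (cmod (g x))\<^sup>2)"
    using assms by (auto simp: sq_int_def)
  have [measurable]: "f \<in> borel_measurable leb_I" "g \<in> borel_measurable leb_I"
    using assms by (auto simp: sq_int_def)
  have "(\<lambda>x. cnj (g x)) \<in> borel_measurable leb_I"
    by (rule borel_measurable_continuous_on[of cnj, OF continuous_on_cnj[OF continuous_on_id]]) measurable
  then show "(\<lambda>x. f x * cnj (g x)) \<in> borel_measurable leb_I"
    by measurable
  have "a * b \<le> a\<^sup>2 + b\<^sup>2" if "a \<ge> 0" "b \<ge> 0" for a b :: real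
    using sum_squares_bound[of a b] mult_nonneg_nonneg[OF that] by linarith
  then show "AE x in leb_I. norm (f x * cnj (g x)) \<le> norm ((cmod (f x))\<^sup>2 + (cmod (g x))\<^sup>2)"
    by (simp add: norm_mult)
qed

lemma sq_int_add:
  assumes "sq_int f" "sq_int g"
  shows "sq_int (\<lambda>x. f x + g x)"
  unfolding sq_int_def
proof
  have [measurable]: "f \<in> borel_measurable leb_I" "g \<in> borel_measurable leb_I"
    using assms by (auto simp: sq_int_def)
  show m: "(\<lambda>x. f x + g x) \<in> borel_measurable leb_I" by measurable
  show "integrable leb_I (\<lambda>x. (cmod (f x + g x))\<^sup>2)"
  proof (rule Bochner_Integration.integrable_bound)
    show "integrable leb_I (\<lambda>x. 2 * (cmod (f x))\<^sup>2 + 2 * (cmod (g x))\<^sup>2)"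
      using assms by (auto simp: sq_int_def)
    show "(\<lambda>x. (cmod (f x + g x))\<^sup>2) \<in> borel_measurable leb_I" by measurable
    have "(cmod (a + b))\<^sup>2 \<le> 2 * (cmod a)\<^sup>2 + 2 * (cmod b)\<^sup>2" for a b
    proof -
      have "(cmod (a + b))\<^sup>2 \<le> (cmod a + cmod b)\<^sup>2"
        by (simp add: norm_triangle_ineq power_mono)
      then show ?thesis
        using sum_squares_bound[of "cmod a" "cmod b"] by (simp add: power2_sum)
    qed
    then show "AE x in leb_I. norm ((cmod (f x + g x))\<^sup>2)
        \<le> norm (2 * (cmod (f x))\<^sup>2 + 2 * (cmod (g x))\<^sup>2)"
      by simp
  qed
qed

lemma sq_int_uminus: "sq_int f \<Longrightarrow> sq_int (\<lambda>x. - f x)"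
  using sq_int_scale[of f "-1"] by simp

quotient_type l2 = "real \<Rightarrow> complex" / partial: l2_eq
proof (rule part_equivpI)
  show "\<exists>f. l2_eq f f" using sq_int_zero by (auto simp: l2_eq_def)
  show "symp l2_eq" by (rule sympI) (auto simp: l2_eq_def)
  show "transp l2_eq" by (rule transpI) (auto simp: l2_eq_def elim: AE_mp)
qed

lift_definition cinner :: "l2 \<Rightarrow> l2 \<Rightarrow> complex"
  is "\<lambda>f g. \<integral>x. f x * cnj (g x) \<partial>leb_I"
  apply (rule integral_cong_AE)
    apply (auto simp: l2_eq_def intro!: borel_measurable_integrable sq_int_mult_cnj)
  done

lift_definition cscale :: "complex \<Rightarrow> l2 \<Rightarrow> l2" is "\<lambda>c f x. c * f x"
  by (auto simp: l2_eq_def sq_int_scale)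

instantiation l2 :: real_inner
begin

lift_definition zero_l2 :: l2 is "\<lambda>x. 0"
  by (auto simp: l2_eq_def sq_int_zero)

lift_definition plus_l2 :: "l2 \<Rightarrow> l2 \<Rightarrow> l2" is "\<lambda>f g x. f x + g x"
  by (auto simp: l2_eq_def sq_int_add)

lift_definition uminus_l2 :: "l2 \<Rightarrow> l2" is "\<lambda>f x. - f x"
  by (auto simp: l2_eq_def sq_int_uminus)

definition minus_l2 :: "l2 \<Rightarrow> l2 \<Rightarrow> l2" where
  "minus_l2 F G = F + (- G)"

definition scaleR_l2 :: "real \<Rightarrow> l2 \<Rightarrow> l2" where
  "scaleR_l2 r F = cscale (of_real r) F"

definition inner_l2 :: "l2 \<Rightarrow> l2 \<Rightarrow> real" where
  "inner_l2 F G = Re (cinner F G)"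

definition norm_l2 :: "l2 \<Rightarrow> real" where
  "norm_l2 F = sqrt (inner F F)"

definition sgn_l2 :: "l2 \<Rightarrow> l2" where
  "sgn_l2 F = scaleR (inverse (norm F)) F"

definition dist_l2 :: "l2 \<Rightarrow> l2 \<Rightarrow> real" where
  "dist_l2 F G = norm (F - G)"

definition uniformity_l2 :: "(l2 \<times> l2) filter" where
  "uniformity_l2 = (INF e\<in>{0<..}. principal {(F, G). dist F G < e})"

definition open_l2 :: "l2 set \<Rightarrow> bool" where
  "open_l2 U \<longleftrightarrow> (\<forall>F\<in>U. \<forall>\<^sub>F (F', G) in uniformity. F' = F \<longrightarrow> G \<in> U)"

instance
proof
  fix F G K :: l2 and r s :: real
  show "F + G + K = F + (G + K)"
    by transfer (auto simp: l2_eq_def sq_int_add algebra_simps)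
  show "F + G = G + F"
    by transfer (auto simp: l2_eq_def sq_int_add algebra_simps)
  show "0 + F = F"
    by transfer (auto simp: l2_eq_def)
  show "- F + F = 0"
    by transfer (auto simp: l2_eq_def sq_int_zero)
  show "F - G = F + - G"
    by (simp add: minus_l2_def)
  show "r *\<^sub>R (F + G) = r *\<^sub>R F + r *\<^sub>R G"
    unfolding scaleR_l2_def
    by transfer (auto simp: l2_eq_def sq_int_add sq_int_scale distrib_left distrib_right)
  show "(r + s) *\<^sub>R F = r *\<^sub>R F + s *\<^sub>R F"
    unfolding scaleR_l2_def
    by transfer (auto simp: l2_eq_def sq_int_add sq_int_scale distrib_left distrib_right)
  show "r *\<^sub>R s *\<^sub>R F = (r * s) *\<^sub>R F"
    unfolding scaleR_l2_def
    by transfer (auto simp: l2_eq_def sq_int_scale mult.assoc)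
  show "1 *\<^sub>R F = F"
    unfolding scaleR_l2_def
    by transfer (auto simp: l2_eq_def)
  show "sgn F = inverse (norm F) *\<^sub>R F"
    by (simp add: sgn_l2_def)
  show "dist F G = norm (F - G)"
    by (simp add: dist_l2_def)
  show "uniformity = (INF e\<in>{0<..}. principal {(F::l2, G). dist F G < e})"
    by (simp add: uniformity_l2_def)
  show "open U \<longleftrightarrow> (\<forall>F\<in>U. \<forall>\<^sub>F (F', G) in uniformity. F' = F \<longrightarrow> G \<in> U)" for U :: "l2 set"
    by (simp add: open_l2_def)
  show "inner F G = inner G F"
    unfolding inner_l2_def
  proof transfer
    fix f g :: "real \<Rightarrow> complex"
    assume "l2_eq f f" "l2_eq g g"
    then have i: "integrable leb_I (\<lambda>x. f x * cnj (g x))" "integrable leb_I (\<lambda>x. g x * cnj (f x))"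
      by (auto simp: l2_eq_def sq_int_mult_cnj)
    have "Re (\<integral>x. f x * cnj (g x) \<partial>leb_I) = (\<integral>x. Re (f x * cnj (g x)) \<partial>leb_I)"
      by (rule integral_Re[OF i(1), symmetric])
    also have "\<dots> = (\<integral>x. Re (g x * cnj (f x)) \<partial>leb_I)"
      by (simp add: mult.commute)
    also have "\<dots> = Re (\<integral>x. g x * cnj (f x) \<partial>leb_I)"
      by (rule integral_Re[OF i(2)])
    finally show "Re (\<integral>x. f x * cnj (g x) \<partial>leb_I) = Re (\<integral>x. g x * cnj (f x) \<partial>leb_I)" .
  qed
  show "inner (F + G) K = inner F K + inner G K"
    unfolding inner_l2_def
    by transfer (simp add: l2_eq_def sq_int_mult_cnj distrib_right)
  show "inner (r *\<^sub>R F) G = r * inner F G"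
    unfolding inner_l2_def scaleR_l2_def
    by transfer (simp add: l2_eq_def sq_int_mult_cnj mult.assoc)
  have nrm: "Re (\<integral>x. f x * cnj (f x) \<partial>leb_I) = (\<integral>x. (cmod (f x))\<^sup>2 \<partial>leb_I)" for f
    unfolding complex_norm_square[symmetric] by (simp flip: of_real_power)
  show "0 \<le> inner F F"
    unfolding inner_l2_def by transfer (simp add: nrm)
  show "inner F F = 0 \<longleftrightarrow> F = 0"
    unfolding inner_l2_def
  proof transfer
    fix f :: "real \<Rightarrow> complex"
    assume "l2_eq f f"
    then have f: "sq_int f" by (simp add: l2_eq_def)
    have "(\<integral>x. (cmod (f x))\<^sup>2 \<partial>leb_I) = 0 \<longleftrightarrow> (AE x in leb_I. (cmod (f x))\<^sup>2 = 0)"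
      by (rule integral_nonneg_eq_0_iff_AE) (use f in \<open>auto simp: sq_int_def\<close>)
    then show "Re (\<integral>x. f x * cnj (f x) \<partial>leb_I) = 0 \<longleftrightarrow> l2_eq f (\<lambda>x. 0)"
      by (simp add: nrm l2_eq_def f sq_int_zero)
  qed
  show "norm F = sqrt (inner F F)"
    by (simp add: norm_l2_def)
qed

end

interpretation cl2: vector_space cscale
proof
  fix a b :: complex and F G :: l2
  show "cscale a (F + G) = cscale a F + cscale a G"
    by transfer (auto simp: l2_eq_def sq_int_add sq_int_scale distrib_left distrib_right)
  show "cscale (a + b) F = cscale a F + cscale b F"
    by transfer (auto simp: l2_eq_def sq_int_add sq_int_scale distrib_left distrib_right)
  show "cscale a (cscale b F) = cscale (a * b) F"
    by transfer (auto simp: l2_eq_def sq_int_scale mult.assoc)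
  show "cscale 1 F = F"
    by transfer (auto simp: l2_eq_def)
qed

text \<open>The class of a square integrable function; the value \<open>0\<close> on other functions is a dummy.\<close>

definition l2_of :: "(real \<Rightarrow> complex) \<Rightarrow> l2" where
  "l2_of f = (if sq_int f then abs_l2 f else 0)"


section \<open>Unbounded operators in $L^2[0,\infty)$\<close>

text \<open>
  An unbounded operator is represented by its graph, a set of pairs $(u, Tu)$. The closure of an
  operator is then the topological closure of the graph in $L^2 \times L^2$.
\<close>

definition linear_operator :: "(l2 \<times> l2) set \<Rightarrow> bool" where
  "linear_operator T \<longleftrightarrow> (0, 0) \<in> T
     \<and> (\<forall>u v u' v'. (u, v) \<in> T \<longrightarrow> (u', v') \<in> T \<longrightarrow> (u + u', v + v') \<in> T)
     \<and> (\<forall>c u v. (u, v) \<in> T \<longrightarrow> (cscale c u, cscale c v) \<in> T)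
     \<and> single_valued T"

definition densely_defined :: "(l2 \<times> l2) set \<Rightarrow> bool" where
  "densely_defined T \<longleftrightarrow> closure (Domain T) = UNIV"

definition adjoint_op :: "(l2 \<times> l2) set \<Rightarrow> (l2 \<times> l2) set" where
  "adjoint_op T = {(u, v). \<forall>(f, g)\<in>T. cinner g u = cinner f v}"

definition symmetric_op :: "(l2 \<times> l2) set \<Rightarrow> bool" where
  "symmetric_op T \<longleftrightarrow> linear_operator T \<and> densely_defined T \<and> T \<subseteq> adjoint_op T"

definition self_adjoint_op :: "(l2 \<times> l2) set \<Rightarrow> bool" where
  "self_adjoint_op T \<longleftrightarrow> linear_operator T \<and> densely_defined T \<and> adjoint_op T = T"

text \<open>
  \<open>cl2.dim\<close> alone would assign the value \<open>0\<close> to an infinite-dimensional space.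
\<close>

definition cdimension :: "l2 set \<Rightarrow> enat" where
  "cdimension V = (if \<exists>B. finite B \<and> B \<subseteq> V \<and> V \<subseteq> cl2.span B then enat (cl2.dim V) else \<infinity>)"

text \<open>$\dim\ker(T^* - z)$; thus $\mathrm n_\pm(T)$ is the case $z = \pm\mathrm i$.\<close>

definition deficiency_index :: "(l2 \<times> l2) set \<Rightarrow> complex \<Rightarrow> enat" where
  "deficiency_index T z = cdimension {u. (u, cscale z u) \<in> adjoint_op T}"


section \<open>Schroedinger operators with point interactions on $[0,\infty)$\<close>

definition abs_continuous_on :: "real \<Rightarrow> real \<Rightarrow> (real \<Rightarrow> complex) \<Rightarrow> bool" where
  "abs_continuous_on a b f \<longleftrightarrow> (\<forall>\<epsilon>>0. \<exists>\<delta>>0. \<forall>D. D division_of \<Union>D \<longrightarrow> \<Union>D \<subseteq> {a..b} \<longrightarrow>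
      (\<Sum>K\<in>D. Sup K - Inf K) < \<delta> \<longrightarrow> (\<Sum>K\<in>D. cmod (f (Sup K) - f (Inf K))) < \<epsilon>)"

definition AC_loc :: "real set \<Rightarrow> (real \<Rightarrow> complex) \<Rightarrow> bool" where
  "AC_loc S f \<longleftrightarrow> (\<forall>a b. a \<le> b \<longrightarrow> {a..b} \<subseteq> S \<longrightarrow> abs_continuous_on a b f)"

text \<open>
  \<open>W22 X f f1 f2\<close> says that \<open>f\<close> belongs to $W^{2,2}([0,\infty) \setminus X)$ with first
  derivative \<open>f1\<close> and second derivative \<open>f2\<close>. Since \<open>f1\<close> is continuous, \<open>f\<close> is differentiable at every point off \<open>X\<close>
  (from the right at \<open>0\<close>), while \<open>f1\<close> is differentiable only almost everywhere.
\<close>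

definition W22 :: "real set \<Rightarrow> (real \<Rightarrow> complex) \<Rightarrow> (real \<Rightarrow> complex) \<Rightarrow> (real \<Rightarrow> complex) \<Rightarrow> bool" where
  "W22 X f f1 f2 \<longleftrightarrow> sq_int f \<and> AC_loc ({0..} - X) f \<and> AC_loc ({0..} - X) f1
     \<and> (\<forall>t\<in>{0..} - X. (f has_vector_derivative f1 t) (at t within {0..}))
     \<and> (AE t in leb_I. (f1 has_vector_derivative f2 t) (at t within {0..}))
     \<and> sq_int f2"

definition W22_comp ::
  "real set \<Rightarrow> (real \<Rightarrow> complex) \<Rightarrow> (real \<Rightarrow> complex) \<Rightarrow> (real \<Rightarrow> complex) \<Rightarrow> bool" where
  "W22_comp X f f1 f2 \<longleftrightarrow> W22 X f f1 f2 \<and> compact (closure {t \<in> {0..} - X. f t \<noteq> 0})"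

text \<open>
  The sequences \<open>x\<close> and \<open>\<alpha>\<close> are used at indices $n \ge 1$ only. The potential \<open>q\<close> is meant to be
  locally square integrable on $[0,\infty)$, so that $-f'' + qf$ is square integrable for all
  admissible \<open>f\<close>.
\<close>

definition H_min :: "(nat \<Rightarrow> real) \<Rightarrow> (nat \<Rightarrow> real) \<Rightarrow> (real \<Rightarrow> real) \<Rightarrow> (l2 \<times> l2) set" where
  "H_min x \<alpha> q = {(l2_of f, l2_of (\<lambda>t. - f2 t + complex_of_real (q t) * f t)) | f f1 f2.
     W22_comp (x ` {1..}) f f1 f2 \<and> f1 0 = 0 \<and>
     (\<forall>n\<ge>1. \<exists>v p m.
        (f \<longlongrightarrow> v) (at_right (x n)) \<and> (f \<longlongrightarrow> v) (at_left (x n)) \<and>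
        (f1 \<longlongrightarrow> p) (at_right (x n)) \<and> (f1 \<longlongrightarrow> m) (at_left (x n)) \<and>
        p - m = complex_of_real (\<alpha> n) * v)}"

definition Hamiltonian :: "(nat \<Rightarrow> real) \<Rightarrow> (nat \<Rightarrow> real) \<Rightarrow> (real \<Rightarrow> real) \<Rightarrow> (l2 \<times> l2) set" where
  "Hamiltonian x \<alpha> q = closure (H_min x \<alpha> q)"

definition q_step :: "(nat \<Rightarrow> real) \<Rightarrow> real \<Rightarrow> real \<Rightarrow> real" where
  "q_step x a t = a\<^sup>2 * (\<Sum>n. (real (Suc n))\<^sup>2 * indicat_real {x n<..<x (Suc n)} t)"

end

theory Submission
  imports Defs "HOL-Real_Asymp.Real_Asymp"
begin

text \<open>
  Write $y_n = f(x_n)$. If $-f'' = h$ on each segment, the interface conditions become a three-term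
  recursion for the $y_n$ with error terms controlled by $h$. For $q = 0$ its main part is
  $(n + 1)(y_{n+1} + y_n) + n (y_n + y_{n-1}) = 0$, so $(-1)^n y_n$ behaves as for the free Laplacian:
  with weights $1/n$, both this sequence and its derivative are square summable whenever $f$ and $h$
  are square integrable. The Wronskian of two elements of the domain of the adjoint at $x_n$ is
  therefore summable against $1/n$; since it converges and $\sum 1/n$ diverges, its limit is $0$, and the
  adjoint is symmetric.

  For $q = q_{a_0}$ the condition $a_0 \coth a_0 = 2$ removes $y_n$ from the recursion, whose main part is now
  $(n + 1) y_{n+1} + n y_{n-1} = 0$. Its solutions decay like $n^{-1/2}$, and for
  $-f'' + q f = \pm \mathrm i f$ fast enough for $|y_n|^2 / n$ to be summable. As $|f|^2$ is convex on each segment,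
  the solution with $f'(0) = 0$ lies in $L^2$, and it spans the kernel of $T^* \mp \mathrm i$.

  In both cases the adjoint of the minimal operator is computed by writing functions as $A \theta + B \varphi$,
  where $\theta$ and $\varphi$ are the piecewise linear solutions at energy $0$ with Wronskian $1$: then $A$ and
  $B$ are indefinite integrals and Green's formula has no contributions from the points $x_n$.
\<close>

section \<open>Absolutely continuous functions and indefinite integrals\<close>

text \<open>Both effects have one origin. Expressing the one-sided derivatives at \<open>x n\<close>
  through neighbouring values gives y_n the coefficient -(2n+1) if q = 0, and -(2n+1) a coth a for
  the step potential. Moving the jump term over, the coupling -4n-2 turns the first into +(2n+1), a
  mere sign alternation of the free recursion, and cancels the second exactly when a coth a = 2.
  Energy 0 is used for the fundamental system even when q is not 0: the term q f is put into the
  source, so one Green formula and one uniqueness statement serve both potentials. An element of the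
  adjoint is at first only an L^2 class without derivatives; hence everything is phrased through
  integrals over intervals, and the class is identified by testing. A symmetric adjoint lies in the
  second adjoint, and the second adjoint lies in the closure by orthogonal projection in the graph
  space. This is why completeness of \<open>l2\<close> is proved. Density of the domain is deduced
  from single-valuedness of the adjoint, not from approximation.\<close>

lemma abs_continuous_on_imp_has_integral:
  fixes f g :: "real \<Rightarrow> complex"
  assumes ab: "a \<le> b" and ac: "abs_continuous_on a b f" and E: "negligible E"
    and der: "\<And>t. t \<in> {a..b} - E \<Longrightarrow> (f has_vector_derivative g t) (at t within {a..b})"
  shows "(g has_integral f b - f a) {a..b}"
proof -
  \<comment> \<open>On \<open>E\<close> the value of \<open>g\<close> is arbitrary. With
    \<open>g0\<close> zero there, a tag in \<open>E\<close> contributes only an increment of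
    \<open>f\<close>, which absolute continuity controls; tags off \<open>E\<close> are handled by
    differentiability.\<close>
  define g0 where "g0 t = (if t \<in> E then 0 else g t)" for t
  have "(g0 has_integral f b - f a) {a..b}"
    unfolding has_integral_real
  proof (intro allI impI)
    fix e :: real assume e: "e > 0"
    \<comment> \<open>Half of \<open>e\<close> is spread over the length; the \<open>+ 1\<close>
      keeps the denominator positive for \<open>a = b\<close>.\<close>
    define e1 where "e1 = e / (2 * (b - a + 1))"
    have e1: "e1 > 0" "e1 * (b - a) < e / 2"
      using e ab by (auto simp: e1_def field_simps)
    obtain \<delta> where \<delta>: "\<delta> > 0" and ac': "\<And>D. D division_of \<Union>D \<Longrightarrow> \<Union>D \<subseteq> {a..b} \<Longrightarrow>
        (\<Sum>K\<in>D. Sup K - Inf K) < \<delta> \<Longrightarrow> (\<Sum>K\<in>D. cmod (f (Sup K) - f (Inf K))) < e / 2"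
      using ac e unfolding abs_continuous_on_def by (meson half_gt_zero)
    \<comment> \<open>The gauge will keep every interval tagged in \<open>E\<close> inside this open
      set, whose measure is below the \<open>\<delta>\<close> of absolute continuity.\<close>
    obtain T where T: "open T" "E \<subseteq> T" "(T - E) \<in> lmeasurable" "emeasure lebesgue (T - E) < ennreal \<delta>"
      using sets_lebesgue_outer_open[OF negligible_imp_sets[OF E] \<delta>] by blast
    have TE: "T \<in> lmeasurable" "measure lebesgue T < \<delta>"
    proof -
      have "T = (T - E) \<union> E" using T by auto
      then show "T \<in> lmeasurable" using T(3) negligible_imp_measurable[OF E]
        using fmeasurable.Un[of "T - E" lebesgue E] by simp
      have "measure lebesgue T = measure lebesgue (T - E)"
        by (rule measure_negligible_symdiff[OF T(3)]) (use T(2) in \<open>auto intro: negligible_subset[OF E]\<close>)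
      also have "\<dots> < \<delta>" using T(3,4) by (simp add: emeasure_eq_measure2 \<delta> ennreal_less_iff)
      finally show "measure lebesgue T < \<delta>" .
    qed
    have "\<forall>x. \<exists>d>0. (x \<in> {a..b} - E \<longrightarrow>
         (\<forall>y\<in>{a..b}. norm (y-x) < d \<longrightarrow> norm (f y - f x - (y-x) *\<^sub>R g x) \<le> e1 * norm (y-x)))
       \<and> (x \<in> E \<longrightarrow> ball x d \<subseteq> T)"
    proof
      fix x
      show "\<exists>d>0. (x \<in> {a..b} - E \<longrightarrow>
         (\<forall>y\<in>{a..b}. norm (y-x) < d \<longrightarrow> norm (f y - f x - (y-x) *\<^sub>R g x) \<le> e1 * norm (y-x)))
       \<and> (x \<in> E \<longrightarrow> ball x d \<subseteq> T)"
      proof (cases "x \<in> E")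
        case True
        then show ?thesis using T(1,2) by (meson DiffE open_contains_ball subsetD)
      next
        case False
        have "\<exists>d>0. x \<in> {a..b} - E \<longrightarrow>
         (\<forall>y\<in>{a..b}. norm (y-x) < d \<longrightarrow> norm (f y - f x - (y-x) *\<^sub>R g x) \<le> e1 * norm (y-x))"
          using der[of x] e1(1)
          unfolding has_vector_derivative_def has_derivative_within_alt by (metis zero_less_one)
        then show ?thesis using False by blast
      qed
    qed
    then obtain d where d: "\<And>x. 0 < d x"
      "\<And>x y. \<lbrakk>x \<in> {a..b} - E; y \<in> {a..b}; norm (y-x) < d x\<rbrakk>
                        \<Longrightarrow> norm (f y - f x - (y-x) *\<^sub>R g x) \<le> e1 * norm (y-x)"
      "\<And>x. x \<in> E \<Longrightarrow> ball x (d x) \<subseteq> T"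
      by metis
    show "\<exists>\<gamma>. gauge \<gamma> \<and> (\<forall>p. p tagged_division_of {a..b} \<and> \<gamma> fine p \<longrightarrow>
           norm ((\<Sum>(x, k)\<in>p. measure lborel k *\<^sub>R g0 x) - (f b - f a)) < e)"
    proof (rule exI, safe)
      show "gauge (\<lambda>x. ball x (d x))"
        using d(1) gauge_ball_dependent by blast
    next
      fix p assume ptag: "p tagged_division_of {a..b}" and finep: "(\<lambda>x. ball x (d x)) fine p"
      define p1 where "p1 = {(x, K) \<in> p. x \<in> E}"
      define p2 where "p2 = {(x, K) \<in> p. x \<notin> E}"
      have fp: "finite p" using ptag by blast
      have p12: "p = p1 \<union> p2" "p1 \<inter> p2 = {}" "finite p1" "finite p2"
        using fp by (auto simp: p1_def p2_def intro: finite_subset)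
      have ba: "b - a = (\<Sum>(x,K)\<in>p. Sup K - Inf K)" "f b - f a = (\<Sum>(x,K)\<in>p. f(Sup K) - f(Inf K))"
        using additive_tagged_division_1[where f= "\<lambda>x. x"] additive_tagged_division_1[where f= f]
              ab ptag by auto
      have K: "\<exists>u v. K = cbox u v \<and> u \<le> v \<and> x \<in> K \<and> K \<subseteq> {a..b} \<and> u \<in> {a..b} \<and> v \<in> {a..b}" if xK: "(x, K) \<in> p" for x K
      proof -
        obtain u v where uv: "K = cbox u v" using tagged_division_ofD(4)[OF ptag xK] by blast
        moreover have "x \<in> K" "K \<subseteq> {a..b}" using tagged_division_ofD(2,3)[OF ptag xK] by auto
        ultimately show ?thesis by (intro exI[of _ u] exI[of _ v]) auto
      qed
      have 2: "norm (\<Sum>(x, K) \<in> p2. (measure lborel K *\<^sub>R g0 x) - (f (Sup K) - f (Inf K))) \<le> e1 * (b - a)"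
      proof -
        have "norm (\<Sum>(x, K) \<in> p2. (measure lborel K *\<^sub>R g0 x) - (f (Sup K) - f (Inf K)))
          \<le> (\<Sum>n\<in>p2. e1 * (case n of (x, k) \<Rightarrow> Sup k - Inf k))"
        proof (rule sum_norm_le,safe)
          fix x K
          assume xK': "(x, K) \<in> p2"
          then have xK: "(x, K) \<in> p" and xE: "x \<notin> E" by (auto simp: p2_def)
          then obtain u v where k: "K = cbox u v" and xin: "x \<in> K" and kab: "K \<subseteq> {a..b}" and "u \<le> v"
            using K by blast
          have ball: "\<forall>y\<in>K. y \<in> ball x (d x)"
            using finep \<open>(x, K) \<in> p\<close> by blast
          have "u \<in> K" "v \<in> K"
            by (simp_all add: \<open>u \<le> v\<close> k)
          have "norm ((v - u) *\<^sub>R g x - (f v - f u)) = norm (f u - f x - (u - x) *\<^sub>R g x - (f v - f x - (v - x) *\<^sub>R g x))"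
            by (auto simp: algebra_simps)
          also have "\<dots> \<le> norm (f u - f x - (u - x) *\<^sub>R g x) + norm (f v - f x - (v - x) *\<^sub>R g x)"
            by (rule norm_triangle_ineq4)
          also have "\<dots> \<le> e1 * norm (u - x) + e1 * norm (v - x)"
          proof (rule add_mono)
            show "norm (f u - f x - (u - x) *\<^sub>R g x) \<le> e1 * norm (u - x)"
              by (rule d(2)) (use \<open>u \<in> K\<close> ball xin kab xE in \<open>auto simp: dist_real_def\<close>)
            show "norm (f v - f x - (v - x) *\<^sub>R g x) \<le> e1 * norm (v - x)"
              by (rule d(2)) (use \<open>v \<in> K\<close> ball xin kab xE in \<open>auto simp: dist_real_def\<close>)
          qed
          also have "\<dots> \<le> e1 * (Sup K - Inf K)"
            using xin by (auto simp: k interval_bounds_real[OF \<open>u \<le> v\<close>] field_simps)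
          finally show "norm (measure lborel K *\<^sub>R g0 x - (f (Sup K) - f (Inf K))) \<le> e1 * (Sup K - Inf K)"
            using \<open>u \<le> v\<close> xE by (simp add: k g0_def)
        qed
        also have "\<dots> = e1 * (\<Sum>(x,K)\<in>p2. Sup K - Inf K)"
          by (simp add: sum_distrib_left)
        also have "\<dots> \<le> e1 * (\<Sum>(x,K)\<in>p. Sup K - Inf K)"
        proof (intro mult_left_mono sum_mono2)
          fix n assume n: "n \<in> p - p2"
          then obtain u v where "snd n = cbox u v" "u \<le> v" using K[of "fst n" "snd n"] by auto
          then show "0 \<le> (case n of (x, K) \<Rightarrow> Sup K - Inf K)" by (simp add: split_def)
        qed (use e1 fp p12 in auto)
        finally show ?thesis by (simp flip: ba)
      qed
      have 1: "norm (\<Sum>(x, K) \<in> p1. (measure lborel K *\<^sub>R g0 x) - (f (Sup K) - f (Inf K))) < e / 2"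
      proof -
        define D where "D = snd ` p1"
        have p1p: "p1 tagged_partial_division_of {a..b}"
          using tagged_partial_division_subset[of p "{a..b}" p1] ptag p12(1)
          unfolding tagged_division_of_def by blast
        then have D: "D division_of \<Union>D"
          unfolding D_def by (rule partial_division_of_tagged_division)
        have Dab: "\<Union>D \<subseteq> {a..b}" using p1p using tagged_partial_division_ofD(3)[OF p1p] by (force simp: D_def)
        have DT: "\<Union>D \<subseteq> T" 
        proof -
          have "K \<subseteq> T" if "(x, K) \<in> p" "x \<in> E" for x K
            using fineD[OF finep that(1)] d(3)[OF that(2)] by blast
          then show ?thesis unfolding D_def p1_def by force
        qed
        have lenK: "Sup K - Inf K = measure lborel K" if KD: "K \<in> D" for K
        proof -
          obtain x where "(x, K) \<in> p" using KD by (auto simp: D_def p1_def)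
          from K[OF this] show ?thesis by auto
        qed
        have "(\<Sum>K\<in>D. Sup K - Inf K) = (\<Sum>K\<in>D. measure lebesgue K)"
        proof (rule sum.cong)
          fix K assume KD: "K \<in> D"
          then obtain u v where "K = cbox u v" using division_ofD(4)[OF D] by blast
          then have "measure lebesgue K = measure lborel K" by (simp add: measure_completion)
          then show "Sup K - Inf K = measure lebesgue K" using lenK[OF KD] by simp
        qed simp
        also have "\<dots> = measure lebesgue (\<Union>D)"
        proof (rule measure_negligible_finite_Union[symmetric])
          show "finite D" using D by blast
          show "K \<in> lmeasurable" if "K \<in> D" for K
            using division_ofD(4)[OF D that] by auto
          show "pairwise (\<lambda>S T. negligible (S \<inter> T)) D"
          proof (rule pairwiseI)
            fix K L assume KL: "K \<in> D" "L \<in> D" "K \<noteq> L"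
            have "convex K" "convex L"
              using division_ofD(4)[OF D KL(1)] division_ofD(4)[OF D KL(2)] by auto
            then show "negligible (K \<inter> L)"
              using division_ofD(5)[OF D KL] by (simp add: negligible_convex_interior convex_Int)
          qed
        qed
        also have "\<dots> \<le> measure lebesgue T"
          by (rule measure_mono_fmeasurable[OF DT _ TE(1)]) (use lmeasurable_division[OF D] in auto)
        also have "\<dots> < \<delta>" by (rule TE)
        finally have small: "(\<Sum>K\<in>D. cmod (f (Sup K) - f (Inf K))) < e / 2"
          by (rule ac'[OF D Dab])
        have "norm (\<Sum>(x, K) \<in> p1. (measure lborel K *\<^sub>R g0 x) - (f (Sup K) - f (Inf K)))
          \<le> (\<Sum>n \<in> p1. cmod (f (Sup (snd n)) - f (Inf (snd n))))"
          by (rule sum_norm_le) (auto simp: p1_def g0_def norm_minus_commute)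
        also have "\<dots> = (\<Sum>K\<in>D. cmod (f (Sup K) - f (Inf K)))"
          unfolding D_def
        proof (subst sum.reindex_nontrivial)
          \<comment> \<open>Two tags can share an interval only if it is degenerate, and then its
            increment is 0; so passing from tagged pairs to intervals loses nothing.\<close>
          fix n m assume nm: "n \<in> p1" "m \<in> p1" "n \<noteq> m" "snd n = snd m"
          obtain x y K' where n: "n = (x, K')" and m: "m = (y, K')" using nm(4) by (metis prod.collapse)
          have "interior K' \<inter> interior K' = {}"
            using tagged_partial_division_ofD(5)[OF p1p, of x K' y K'] nm n m by auto
          moreover obtain u v where "K' = cbox u v" "u \<le> v" using K[of x K'] nm(1) n by (auto simp: p1_def)
          ultimately show "cmod (f (Sup (snd n)) - f (Inf (snd n))) = 0"
            using n by (auto simp: box_real)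
        qed (use p12 in auto)
        finally show ?thesis using small by linarith
      qed
      have "norm ((\<Sum>(x, K)\<in>p. measure lborel K *\<^sub>R g0 x) - (f b - f a)) =
          norm ((\<Sum>(x, K) \<in> p1. (measure lborel K *\<^sub>R g0 x) - (f (Sup K) - f (Inf K))) + 
            (\<Sum>(x, K) \<in> p2. (measure lborel K *\<^sub>R g0 x) - (f (Sup K) - f (Inf K))))"
        unfolding ba(2) sum_subtractf[symmetric] sum.union_disjoint[OF p12(3,4,2), symmetric] p12(1)[symmetric]
        by (simp add: split_def sum_subtractf)
      also have "\<dots> \<le> norm (\<Sum>(x, K) \<in> p1. (measure lborel K *\<^sub>R g0 x) - (f (Sup K) - f (Inf K))) +
        norm (\<Sum>(x, K) \<in> p2. (measure lborel K *\<^sub>R g0 x) - (f (Sup K) - f (Inf K)))"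
        by (rule norm_triangle_ineq)
      finally show "norm ((\<Sum>(x, K)\<in>p. measure lborel K *\<^sub>R g0 x) - (f b - f a)) < e"
        using 1 2 e1(2) by linarith
    qed
  qed
  then show ?thesis
    by (rule has_integral_spike[OF E, rotated]) (auto simp: g0_def)
qed

lemma absolutely_integrable_iff_integrable_lebesgue_on:
  "S \<in> sets lebesgue \<Longrightarrow> f absolutely_integrable_on S \<longleftrightarrow> integrable (lebesgue_on S) f"
  by (simp add: set_integrable_def integrable_restrict_space)

text \<open>Henstock's lemma bounds the total deviation of the Riemann summands from the integrals
  over their intervals. All these integrals vanish, so the bound concerns the Riemann sums of
  \<open>norm (f t)\<close>, which therefore has integral 0.\<close>

lemma AE_zero_if_interval_integrals_zero:
  fixes f :: "real \<Rightarrow> complex"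
  assumes f: "f absolutely_integrable_on {a..b}"
    and zero: "\<And>s t. a \<le> s \<Longrightarrow> s \<le> t \<Longrightarrow> t \<le> b \<Longrightarrow> integral {s..t} f = 0"
  shows "AE t in lebesgue_on {a..b}. f t = 0"
proof -
  have int: "f integrable_on cbox a b"
    using f by (simp add: absolutely_integrable_on_def)
  have "((\<lambda>t. norm (f t)) has_integral 0) (cbox a b)"
    unfolding has_integral
  proof (intro allI impI)
    fix e :: real assume e: "e > 0"
    obtain \<gamma> where \<gamma>: "gauge \<gamma>"
      and H: "\<And>p. \<lbrakk>p tagged_partial_division_of (cbox a b); \<gamma> fine p\<rbrakk> \<Longrightarrow>
             sum (\<lambda>(x,k). norm(measure lborel k *\<^sub>R f x - integral k f)) p < e"
      by (rule Henstock_lemma[OF int e]) (rule that)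
    show "\<exists>\<gamma>. gauge \<gamma> \<and> (\<forall>p. p tagged_division_of cbox a b \<and> \<gamma> fine p \<longrightarrow>
      norm ((\<Sum>(x, k)\<in>p. measure lborel k *\<^sub>R norm (f x)) - 0) < e)"
    proof (intro exI conjI allI impI)
      fix p assume p: "p tagged_division_of cbox a b \<and> \<gamma> fine p"
      then have "sum (\<lambda>(x,k). norm(measure lborel k *\<^sub>R f x - integral k f)) p < e"
        by (intro H) (auto simp: tagged_division_of_def)
      moreover have "sum (\<lambda>(x,k). norm(measure lborel k *\<^sub>R f x - integral k f)) p
          = (\<Sum>(x, k)\<in>p. measure lborel k *\<^sub>R norm (f x))"
      proof (rule sum.cong, safe)
        fix x k assume xk: "(x, k) \<in> p"
        from p have p': "p tagged_division_of cbox a b" by blast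
        obtain u v where k: "k = cbox u v" using tagged_division_ofD(4)[OF p' xk] by blast
        with tagged_division_ofD(2,3)[OF p' xk] have "a \<le> u" "u \<le> v" "v \<le> b" by auto
        then have "integral k f = 0" using zero k by simp
        then show "norm (measure lborel k *\<^sub>R f x - integral k f) = measure lborel k *\<^sub>R norm (f x)"
          by simp
      qed
      moreover have "0 \<le> (\<Sum>(x, k)\<in>p. measure lborel k *\<^sub>R norm (f x))"
        unfolding split_def by (rule sum_nonneg) simp
      ultimately show "norm ((\<Sum>(x, k)\<in>p. measure lborel k *\<^sub>R norm (f x)) - 0) < e"
        by simp
    qed (use \<gamma> in auto)
  qed
  then have 0: "integral {a..b} (\<lambda>t. norm (f t)) = 0" by (simp add: integral_unique)
  have n: "integrable (lebesgue_on {a..b}) (\<lambda>t. norm (f t))"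
    using absolutely_integrable_norm[OF f]
    by (simp add: absolutely_integrable_iff_integrable_lebesgue_on o_def)
  have "integral\<^sup>L (lebesgue_on {a..b}) (\<lambda>t. norm (f t)) = 0"
    using lebesgue_integral_eq_integral[OF n] 0 by simp
  then show ?thesis
    using integral_nonneg_eq_0_iff_AE[OF n] by simp
qed

lemma continuous_on_indefinite_integral:
  fixes f F :: "real \<Rightarrow> 'a::euclidean_space"
  assumes f: "f absolutely_integrable_on {a..b}"
    and F: "\<And>t. a \<le> t \<Longrightarrow> t \<le> b \<Longrightarrow> F t = F a + integral {a..t} f"
  shows "continuous_on {a..b} F"
proof -
  have "continuous_on {a..b} (\<lambda>t. F a + integral {a..t} f)"
    using f by (intro continuous_intros indefinite_integral_continuous_1) (simp add: absolutely_integrable_on_def)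
  then show ?thesis by (rule continuous_on_eq) (rule F[symmetric]; simp)
qed

lemma absolutely_integrable_mult_continuous:
  fixes f g :: "real \<Rightarrow> complex"
  assumes f: "f absolutely_integrable_on {a..b}" and g: "continuous_on {a..b} g"
  shows "(\<lambda>t. f t * g t) absolutely_integrable_on {a..b}" "(\<lambda>t. g t * f t) absolutely_integrable_on {a..b}"
proof -
  have "(\<lambda>t. (*) (g t) (f t)) absolutely_integrable_on {a..b}"
  proof (rule absolutely_integrable_bounded_measurable_product[OF bilinear_times])
    show "g \<in> borel_measurable (lebesgue_on {a..b})"
      by (rule continuous_imp_measurable_on_sets_lebesgue[OF g]) simp
    show "bounded (g ` {a..b})"
      using g by (intro compact_imp_bounded compact_continuous_image) auto
  qed (use f in auto)
  then show "(\<lambda>t. g t * f t) absolutely_integrable_on {a..b}" by simp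
  then show "(\<lambda>t. f t * g t) absolutely_integrable_on {a..b}" by (simp add: mult.commute)
qed

text \<open>Over an equidistant subdivision the right-hand sides telescope to
  \<open>e * (m b - m a)\<close>, for every \<open>e\<close>. This plays the part of a zero
  derivative for functions known only through integrals.\<close>

lemma eq_if_increments_dominated:
  fixes H :: "real \<Rightarrow> 'a::real_normed_vector" and m :: "real \<Rightarrow> real"
  assumes ab: "a \<le> b"
    and H: "\<And>e. e > 0 \<Longrightarrow> \<exists>d>0. \<forall>s t. a \<le> s \<longrightarrow> s \<le> t \<longrightarrow> t \<le> b \<longrightarrow> t - s < d \<longrightarrow>
      norm (H t - H s) \<le> e * (m t - m s)"
  shows "H b = H a"
proof -
  have le: "norm (H b - H a) \<le> e * (m b - m a)" if e: "e > 0" for e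
  proof -
    obtain d where d: "d > 0" "\<And>s t. a \<le> s \<Longrightarrow> s \<le> t \<Longrightarrow> t \<le> b \<Longrightarrow> t - s < d \<Longrightarrow>
      norm (H t - H s) \<le> e * (m t - m s)"
      using H[OF e] by auto
    obtain n where n: "(b - a) / d < real n" using reals_Archimedean2 by blast
    have n0: "real n > 0" using n ab d(1) by (meson divide_nonneg_pos diff_ge_0_iff_ge order_le_less_trans)
    define p where "p i = a + real i * ((b - a) / real n)" for i :: nat
    have step: "p (Suc i) = p i + (b - a) / n" for i
      using n0 by (simp add: p_def field_simps)
    have small: "(b - a) / n < d" using n n0 d(1) by (simp add: field_simps)
    have pn: "p n = b" using n0 by (simp add: p_def)
    have "norm (H (p i) - H a) \<le> e * (m (p i) - m a)" if "i \<le> n" for i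
      using that
    proof (induction i)
      case 0 then show ?case by (simp add: p_def)
    next
      case (Suc i)
      have "a \<le> p i" using ab by (simp add: p_def)
      moreover have "p i \<le> p (Suc i)" using ab by (simp add: step)
      moreover have "p (Suc i) \<le> b"
      proof -
        have "real (Suc i) * ((b - a) / real n) \<le> real n * ((b - a) / real n)"
          by (rule mult_right_mono) (use Suc.prems ab in auto)
        then have "p (Suc i) \<le> p n" unfolding p_def by (rule add_left_mono)
        then show ?thesis unfolding pn .
      qed
      ultimately have "norm (H (p (Suc i)) - H (p i)) \<le> e * (m (p (Suc i)) - m (p i))"
        using d(2) small step by simp
      moreover have "norm (H (p (Suc i)) - H a) \<le> norm (H (p (Suc i)) - H (p i)) + norm (H (p i) - H a)"
        using norm_triangle_ineq[of "H (p (Suc i)) - H (p i)" "H (p i) - H a"] by simp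
      ultimately show ?case using Suc by (simp add: algebra_simps)
    qed
    from this[of n] show ?thesis by (simp add: pn)
  qed
  have "norm (H b - H a) \<le> 0"
  proof (rule field_le_epsilon)
    fix e :: real assume e: "e > 0"
    have "norm (H b - H a) \<le> e / (\<bar>m b - m a\<bar> + 1) * (m b - m a)"
      using le[of "e / (\<bar>m b - m a\<bar> + 1)"] e by simp
    also have "\<dots> \<le> e / (\<bar>m b - m a\<bar> + 1) * (\<bar>m b - m a\<bar> + 1)"
      using e by (intro mult_left_mono) auto
    finally show "norm (H b - H a) \<le> 0 + e" by simp
  qed
  then show ?thesis by simp
qed

text \<open>For merely integrable densities there is no pointwise product rule to start from.
  Instead, \<open>F * G\<close> minus the integral has increments bounded by the moduli of
  continuity of \<open>F\<close> and \<open>G\<close> times the integral of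
  \<open>norm f + norm g\<close>, and \<open>eq_if_increments_dominated\<close> applies.\<close>

lemma integral_product_rule:
  fixes f g F G :: "real \<Rightarrow> complex"
  assumes ab: "a \<le> b" and f: "f absolutely_integrable_on {a..b}" and g: "g absolutely_integrable_on {a..b}"
    and F: "\<And>t. a \<le> t \<Longrightarrow> t \<le> b \<Longrightarrow> F t = F a + integral {a..t} f"
    and G: "\<And>t. a \<le> t \<Longrightarrow> t \<le> b \<Longrightarrow> G t = G a + integral {a..t} g"
  shows "(\<lambda>t. f t * G t + F t * g t) absolutely_integrable_on {a..b}"
    and "integral {a..b} (\<lambda>t. f t * G t + F t * g t) = F b * G b - F a * G a"
proof -
  have cF: "continuous_on {a..b} F" by (rule continuous_on_indefinite_integral[OF f F])
  have cG: "continuous_on {a..b} G" by (rule continuous_on_indefinite_integral[OF g G])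
  show ai: "(\<lambda>t. f t * G t + F t * g t) absolutely_integrable_on {a..b}"
    by (rule set_integral_add[OF absolutely_integrable_mult_continuous(1)[OF f cG]
        absolutely_integrable_mult_continuous(2)[OF g cF]])
  define k where "k t = f t * G t + F t * g t" for t
  define mm where "mm t = norm (f t) + norm (g t)" for t
  have sub: "u integrable_on {s..t}" if "u absolutely_integrable_on {a..b}" "a \<le> s" "t \<le> b"
    for s t and u :: "real \<Rightarrow> 'a::euclidean_space"
    using absolutely_integrable_on_subinterval[OF that(1), of s t] that
    unfolding absolutely_integrable_on_def by auto
  have mi: "mm absolutely_integrable_on {a..b}"
    unfolding mm_def using set_integral_add(1)[OF absolutely_integrable_norm[OF f] absolutely_integrable_norm[OF g]]
    by (simp add: o_def)
  have ki: "k absolutely_integrable_on {a..b}" using ai by (simp add: k_def[abs_def])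
  have diff: "integral {a..t} u - integral {a..s} u = integral {s..t} u"
    if "u absolutely_integrable_on {a..b}" "a \<le> s" "s \<le> t" "t \<le> b" 
    for s t and u :: "real \<Rightarrow> 'a::euclidean_space"
    using Henstock_Kurzweil_Integration.integral_combine[OF that(2,3) sub[OF that(1) order_refl that(4)]]
    by (simp add: algebra_simps)
  define H where "H t = F t * G t - integral {a..t} k" for t
  have "H b = H a"
  proof (rule eq_if_increments_dominated[OF ab, where m = "\<lambda>t. integral {a..t} mm"])
    fix e :: real assume e: "e > 0"
    have "uniformly_continuous_on {a..b} F" "uniformly_continuous_on {a..b} G"
      using cF cG by (auto intro: compact_uniformly_continuous)
    then obtain d1 d2 where d: "d1 > 0" "d2 > 0"
      and d1: "\<And>s t. s \<in> {a..b} \<Longrightarrow> t \<in> {a..b} \<Longrightarrow> dist t s < d1 \<Longrightarrow> dist (F t) (F s) < e"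
      and d2: "\<And>s t. s \<in> {a..b} \<Longrightarrow> t \<in> {a..b} \<Longrightarrow> dist t s < d2 \<Longrightarrow> dist (G t) (G s) < e"
      using e unfolding uniformly_continuous_on_def by metis
    show "\<exists>d>0. \<forall>s t. a \<le> s \<longrightarrow> s \<le> t \<longrightarrow> t \<le> b \<longrightarrow> t - s < d \<longrightarrow>
      norm (H t - H s) \<le> e * (integral {a..t} mm - integral {a..s} mm)"
    proof (intro exI[of _ "min d1 d2"] conjI allI impI)
      fix s t assume st: "a \<le> s" "s \<le> t" "t \<le> b" "t - s < min d1 d2"
      have Fd: "F t - F s = integral {s..t} f" 
      proof -
        have "F t = F a + integral {a..t} f" "F s = F a + integral {a..s} f"
          by (rule F; use st in linarith)+
        then show ?thesis using diff[OF f st(1-3)] by (metis add_diff_cancel_left)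
      qed
      have Gd: "G t - G s = integral {s..t} g" 
      proof -
        have "G t = G a + integral {a..t} g" "G s = G a + integral {a..s} g"
          by (rule G; use st in linarith)+
        then show ?thesis using diff[OF g st(1-3)] by (metis add_diff_cancel_left)
      qed
      \<comment> \<open>\<open>G\<close> is frozen at the left end and \<open>F\<close> at the right
        end, so the increment of the product splits without a second-order term.\<close>
      have "H t - H s = (F t - F s) * G s + F t * (G t - G s) - integral {s..t} k"
        unfolding diff[OF ki st(1-3), symmetric] H_def by algebra
      moreover have "(F t - F s) * G s + F t * (G t - G s) - integral {s..t} k
          = integral {s..t} (\<lambda>r. f r * G s + F t * g r - k r)"
        unfolding Fd Gd
        by (rule integral_unique[OF has_integral_diff[OF has_integral_add[OF
          has_integral_mult_left[OF integrable_integral[OF sub[OF f st(1,3)]]]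
          has_integral_mult_right[OF integrable_integral[OF sub[OF g st(1,3)]]]]
          integrable_integral[OF sub[OF ki st(1,3)]]], symmetric])
      moreover have "norm (integral {s..t} (\<lambda>r. f r * G s + F t * g r - k r)) \<le> integral {s..t} (\<lambda>r. e * mm r)"
      proof (rule integral_norm_bound_integral)
        show "(\<lambda>r. f r * G s + F t * g r - k r) integrable_on {s..t}"
          by (rule integrable_diff[OF integrable_add[OF integrable_on_mult_left[OF sub[OF f st(1,3)]]
            integrable_on_mult_right[OF sub[OF g st(1,3)]]] sub[OF ki st(1,3)]])
        show "(\<lambda>r. e * mm r) integrable_on {s..t}"
          by (rule integrable_on_mult_right[OF sub[OF mi st(1,3)]])
        fix r assume r: "r \<in> {s..t}"
        have eq: "f r * G s + F t * g r - k r = f r * (G s - G r) + (F t - F r) * g r"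
          unfolding k_def by algebra
        have "norm (f r * G s + F t * g r - k r) \<le> norm (f r) * norm (G s - G r) + norm (F t - F r) * norm (g r)"
          unfolding eq using norm_triangle_ineq[of "f r * (G s - G r)" "(F t - F r) * g r"] unfolding norm_mult .
        also have "\<dots> \<le> norm (f r) * e + e * norm (g r)"
        proof (rule add_mono[OF mult_left_mono mult_right_mono])
          show "norm (G s - G r) \<le> e"
            using d2[of r s] st r by (simp add: dist_norm)
          show "norm (F t - F r) \<le> e"
            using d1[of r t] st r by (simp add: dist_norm)
        qed auto
        finally show "norm (f r * G s + F t * g r - k r) \<le> e * mm r" by (simp add: mm_def algebra_simps)
      qed
      moreover have "integral {s..t} (\<lambda>r. e * mm r) = e * (integral {a..t} mm - integral {a..s} mm)"
        unfolding diff[OF mi st(1-3)] by (rule integral_mult_right)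
      ultimately show "norm (H t - H s) \<le> e * (integral {a..t} mm - integral {a..s} mm)" by metis
    qed (use d in auto)
  qed
  then show "integral {a..b} (\<lambda>t. f t * G t + F t * g t) = F b * G b - F a * G a"
    by (simp add: H_def k_def[abs_def] algebra_simps)
qed

section \<open>Orthogonal complements and completeness of $L^2$\<close>

text \<open>\<open>z\<close> is the difference of \<open>x\<close> and its nearest point in
  \<open>S\<close>. Only the real inner product occurs; complex orthogonality comes later from
  stability of the subspaces under \<open>cscale\<close>.\<close>

lemma orthogonal_to_closed_subspace:
  fixes S :: "'a::{real_inner, complete_space} set"
  assumes S: "subspace S" "closed S" and x: "x \<notin> S"
  obtains z where "\<And>s. s \<in> S \<Longrightarrow> inner z s = 0" "inner z x \<noteq> 0"
proof -
  define D where "D = (\<lambda>s. (norm (x - s))\<^sup>2) ` S"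
  define d where "d = Inf D"
  have ne: "D \<noteq> {}" using subspace_0[OF S(1)] by (auto simp: D_def)
  have bb: "bdd_below D" by (rule bdd_belowI[of _ 0]) (auto simp: D_def)
  have lower: "d \<le> (norm (x - s))\<^sup>2" if "s \<in> S" for s
    unfolding d_def by (rule cInf_lower[OF _ bb]) (use that in \<open>auto simp: D_def\<close>)
  have "\<exists>s\<in>S. (norm (x - s))\<^sup>2 < d + 1 / real (Suc n)" for n
    using cInf_lessD[OF ne, of "d + 1 / real (Suc n)"] by (auto simp: D_def d_def)
  then obtain a where a: "\<And>n. a n \<in> S" "\<And>n. (norm (x - a n))\<^sup>2 < d + 1 / real (Suc n)" by metis
  have par: "(norm (a n - a m))\<^sup>2 \<le> 2 / real (Suc n) + 2 / real (Suc m)" for n m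
  proof -
    \<comment> \<open>Parallelogram law: the midpoint lies in \<open>S\<close>, so its squared
      distance to \<open>x\<close> is at least the infimum \<open>d\<close>. This makes the
      minimising sequence Cauchy.\<close>
    have mid: "(1/2) *\<^sub>R (a n + a m) \<in> S" using S(1) a(1) by (intro subspace_scale subspace_add)
    have "(norm (a n - a m))\<^sup>2 = 2 * (norm (x - a n))\<^sup>2 + 2 * (norm (x - a m))\<^sup>2
        - 4 * (norm (x - (1/2) *\<^sub>R (a n + a m)))\<^sup>2"
      unfolding power2_norm_eq_inner by (simp add: inner_simps inner_commute algebra_simps)
    then show ?thesis using a(2)[of n] a(2)[of m] lower[OF mid] by linarith
  qed
  have "Cauchy a"
  proof (rule metric_CauchyI)
    fix e :: real assume e: "e > 0"
    obtain N where N: "4 / e\<^sup>2 < real N" using reals_Archimedean2 by blast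
    have N0: "real N > 0" using N e by (meson divide_nonneg_nonneg order_le_less_trans zero_le_numeral zero_le_power2)
    have "dist (a m) (a n) < e" if "m \<ge> N" "n \<ge> N" for m n
    proof -
      have "2 / real (Suc k) < e\<^sup>2 / 2" if "k \<ge> N" for k
      proof -
        have "2 / real (Suc k) \<le> 2 / real N" using that N0 by (intro divide_left_mono) auto
        also have "\<dots> < e\<^sup>2 / 2" using N N0 e by (simp add: field_simps)
        finally show ?thesis .
      qed
      from this[OF that(1)] this[OF that(2)] have "(norm (a m - a n))\<^sup>2 < e\<^sup>2"
        using par[of m n] by linarith
      then show ?thesis using e by (simp add: dist_norm power2_less_imp_less)
    qed
    then show "\<exists>M. \<forall>m\<ge>M. \<forall>n\<ge>M. dist (a m) (a n) < e" by blast
  qed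
  then obtain l where l: "a \<longlonglongrightarrow> l" using Cauchy_convergent convergent_def by blast
  have lS: "l \<in> S" using closed_sequentially[OF S(2)] a(1) l by blast
  have "(\<lambda>n. (norm (x - a n))\<^sup>2) \<longlonglongrightarrow> (norm (x - l))\<^sup>2" using l by (intro tendsto_intros)
  moreover have "(\<lambda>n. d + 1 / real (Suc n)) \<longlonglongrightarrow> d + 0"
    by (intro tendsto_add tendsto_const LIMSEQ_inverse_real_of_nat[unfolded inverse_eq_divide])
  ultimately have le: "(norm (x - l))\<^sup>2 \<le> d"
    by (intro LIMSEQ_le[of _ _ "\<lambda>n. d + 1 / real (Suc n)"]) (use a(2) less_imp_le in auto)
  define z where "z = x - l"
  have orth: "inner z s = 0" if s: "s \<in> S" for s
  proof (rule ccontr)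
    assume ne: "inner z s \<noteq> 0"
    then have s0: "inner s s > 0" by auto
    \<comment> \<open>The coefficient that minimises the norm of \<open>z - t *\<^sub>R s\<close>;
      minimality of \<open>l\<close> then forces it to be 0.\<close>
    define t where "t = inner z s / inner s s"
    have "l + t *\<^sub>R s \<in> S" using S(1) lS s by (intro subspace_add subspace_scale)
    from lower[OF this] le have "(norm z)\<^sup>2 \<le> (norm (z - t *\<^sub>R s))\<^sup>2"
      unfolding z_def diff_diff_eq[symmetric] by (metis diff_diff_eq order_trans)
    then have "2 * t * inner z s \<le> t\<^sup>2 * inner s s"
      unfolding power2_norm_eq_inner by (simp add: inner_simps inner_commute algebra_simps power2_eq_square)
    also have "\<dots> = t * inner z s" using s0 by (simp add: t_def power2_eq_square)
    finally have "t * inner z s \<le> 0" by simp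
    moreover have "t * inner z s > 0" using s0 ne by (simp add: t_def power2_eq_square[symmetric])
    ultimately show False by simp
  qed
  have "inner z x = inner z z" using orth[OF lS] by (simp add: z_def inner_simps)
  moreover have "z \<noteq> 0" using x lS by (auto simp: z_def)
  ultimately show thesis using that[of z] orth by simp
qed

section \<open>Representatives of L^2 classes and the completeness of L^2\<close>

lemma ex_l2_of: obtains f where "sq_int f" "F = l2_of f"
proof -
  obtain f where "l2_eq f f" "F = abs_l2 f"
    by (metis Quotient_abs_rep Quotient_l2 Quotient_rep_reflp)
  then show thesis using that by (auto simp: l2_of_def l2_eq_def)
qed

lemma l2_of_eq_iff:
  assumes "sq_int f" "sq_int g"
  shows "l2_of f = l2_of g \<longleftrightarrow> (AE t in leb_I. f t = g t)"
  using assms Quotient_rel[OF Quotient_l2, of f g] by (auto simp: l2_of_def l2_eq_def)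

lemma cinner_l2_of:
  assumes "sq_int f" "sq_int g"
  shows "cinner (l2_of f) (l2_of g) = (\<integral>t. f t * cnj (g t) \<partial>leb_I)"
  using assms by (simp add: l2_of_def cinner.abs_eq l2_eq_def)

lemma l2_of_add: "sq_int f \<Longrightarrow> sq_int g \<Longrightarrow> l2_of f + l2_of g = l2_of (\<lambda>t. f t + g t)"
  by (simp add: l2_of_def plus_l2.abs_eq l2_eq_def sq_int_add)

lemma l2_of_uminus: "sq_int f \<Longrightarrow> - l2_of f = l2_of (\<lambda>t. - f t)"
  by (simp add: l2_of_def uminus_l2.abs_eq l2_eq_def sq_int_uminus)

lemma sq_int_diff: "sq_int f \<Longrightarrow> sq_int g \<Longrightarrow> sq_int (\<lambda>t. f t - g t)"
  using sq_int_add[OF _ sq_int_uminus] by fastforce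

lemma l2_of_diff: "sq_int f \<Longrightarrow> sq_int g \<Longrightarrow> l2_of f - l2_of g = l2_of (\<lambda>t. f t - g t)"
  by (simp add: minus_l2_def l2_of_uminus l2_of_add sq_int_uminus)

lemma cscale_l2_of: "sq_int f \<Longrightarrow> cscale c (l2_of f) = l2_of (\<lambda>t. c * f t)"
  by (simp add: l2_of_def cscale.abs_eq l2_eq_def sq_int_scale)

lemma zero_l2_of: "0 = l2_of (\<lambda>t. 0)"
  by (simp add: l2_of_def zero_l2_def sq_int_zero)

lemma norm_l2_of:
  assumes f: "sq_int f"
  shows "(norm (l2_of f))\<^sup>2 = (\<integral>t. (cmod (f t))\<^sup>2 \<partial>leb_I)"
proof -
  have "(norm (l2_of f))\<^sup>2 = Re (\<integral>t. f t * cnj (f t) \<partial>leb_I)"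
    by (simp add: power2_norm_eq_inner inner_l2_def cinner_l2_of f)
  also have "\<dots> = (\<integral>t. (cmod (f t))\<^sup>2 \<partial>leb_I)"
    unfolding complex_norm_square[symmetric] by (simp flip: of_real_power)
  finally show ?thesis .
qed

lemma nn_integral_eq_norm_l2_of:
  assumes f: "sq_int f"
  shows "(\<integral>\<^sup>+t. ennreal ((cmod (f t))\<^sup>2) \<partial>leb_I) = ennreal ((norm (l2_of f))\<^sup>2)"
  unfolding norm_l2_of[OF f] using f by (intro nn_integral_eq_integral) (auto simp: sq_int_def)

lemma sq_intI_nn_integral:
  assumes m: "f \<in> borel_measurable leb_I" and fin: "(\<integral>\<^sup>+t. ennreal ((cmod (f t))\<^sup>2) \<partial>leb_I) < \<infinity>"
  shows "sq_int f"
  unfolding sq_int_def using m fin by (auto intro!: integrableI_nonneg)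

text \<open>In integrals of squares this rate becomes \<open>(1/16) ^ k\<close>, which still beats
  the weight \<open>2 ^ k\<close> used below for pointwise convergence.\<close>

lemma Cauchy_rapid_subseq:
  fixes X :: "nat \<Rightarrow> 'a::metric_space"
  assumes "Cauchy X"
  obtains r where "strict_mono r" "\<And>k m. m \<ge> r k \<Longrightarrow> dist (X m) (X (r k)) < (1/4) ^ k"
proof -
  have "\<exists>r. strict_mono r \<and> (\<forall>k. \<forall>m\<ge>r k. dist (X m) (X (r k)) < (1/4) ^ k)"
  proof -
    have "\<exists>N. \<forall>m\<ge>N. \<forall>n\<ge>N. dist (X m) (X n) < (1/4::real) ^ k" for k
      using assms by (intro metric_CauchyD) auto
    then obtain N where N: "\<And>k m n. m \<ge> N k \<Longrightarrow> n \<ge> N k \<Longrightarrow> dist (X m) (X n) < (1/4::real) ^ k"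
      by metis
    define r where "r k = (\<Sum>i\<le>k. N i) + k" for k
    have "r k \<ge> N k" for k unfolding r_def by (simp add: member_le_sum trans_le_add1)
    moreover have "strict_mono r" by (rule strict_monoI_Suc) (simp add: r_def)
    ultimately show ?thesis using N by (meson le_trans)
  qed
  then show thesis using that by blast
qed

text \<open>The weight makes the increments at most \<open>sqrt C * (1 / sqrt 2) ^ k\<close>, a
  geometric sequence. Finiteness of a weighted sum of squares provides the hypothesis at almost
  every point.\<close>

lemma rapidly_decreasing_imp_convergent:
  fixes f :: "nat \<Rightarrow> complex"
  assumes C: "\<And>k. 2 ^ k * (cmod (f (Suc k) - f k))\<^sup>2 \<le> C"
  shows "convergent f"
proof -
  have C0: "C \<ge> 0" using C[of 0] by (metis order_trans mult_nonneg_nonneg power2_eq_square zero_le_numeral zero_le_power zero_le_square)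
  have b: "cmod (f (Suc k) - f k) \<le> sqrt C * (1 / sqrt 2) ^ k" for k
  proof -
    have "(cmod (f (Suc k) - f k))\<^sup>2 \<le> C * (1/2) ^ k"
      using C[of k] by (simp add: field_simps power_one_over)
    then have "cmod (f (Suc k) - f k) \<le> sqrt (C * (1/2) ^ k)" by (rule real_le_rsqrt)
    also have "\<dots> = sqrt C * (1 / sqrt 2) ^ k" by (simp add: real_sqrt_mult real_sqrt_power real_sqrt_divide)
    finally show ?thesis .
  qed
  have "summable (\<lambda>k. f (Suc k) - f k)"
    by (rule summable_comparison_test'[of "\<lambda>k. sqrt C * (1 / sqrt 2) ^ k" 0])
       (use b in \<open>auto intro!: summable_mult summable_geometric\<close>)
  then have "convergent (\<lambda>n. \<Sum>k<n. f (Suc k) - f k)" by (simp add: summable_iff_convergent)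
  then have "convergent (\<lambda>n. f n - f 0)" by (simp add: sum_lessThan_telescope)
  then have "convergent (\<lambda>n. (f n - f 0) + f 0)" by (intro convergent_add convergent_const)
  then show ?thesis by simp
qed

text \<open>Riesz-Fischer: a rapid subsequence converges almost everywhere, Fatou's lemma turns this
  into convergence in norm, and a Cauchy sequence follows its subsequence. Completeness is what lets
  \<open>orthogonal_to_closed_subspace\<close> act on graphs.\<close>

instance l2 :: complete_space
proof
  fix X :: "nat \<Rightarrow> l2" assume X: "Cauchy X"
  obtain r where r: "strict_mono r" "\<And>k m. m \<ge> r k \<Longrightarrow> dist (X m) (X (r k)) < (1/4) ^ k"
    by (rule Cauchy_rapid_subseq[OF X]) blast
  have "\<forall>k. \<exists>g. sq_int g \<and> X (r k) = l2_of g" using ex_l2_of by metis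
  then obtain f where f: "\<And>k. sq_int (f k)" "\<And>k. X (r k) = l2_of (f k)" by metis
  have meas[measurable]: "f k \<in> borel_measurable leb_I" for k using f(1) by (simp add: sq_int_def)
  have near: "norm (l2_of (\<lambda>t. f j t - f k t)) \<le> (1/4) ^ k" if "j \<ge> k" for j k
    using r(2)[of k "r j"] that r(1) by (simp add: strict_mono_less_eq dist_norm f l2_of_diff less_imp_le)
  have step: "(\<integral>\<^sup>+t. ennreal ((cmod (f j t - f k t))\<^sup>2) \<partial>leb_I) \<le> ennreal (((1/4) ^ k)\<^sup>2)" if "j \<ge> k" for j k
    unfolding nn_integral_eq_norm_l2_of[OF sq_int_diff[OF f(1) f(1)]]
    by (intro ennreal_leI power_mono near that) auto
  have "(\<integral>\<^sup>+t. (\<Sum>k. ennreal (2 ^ k * (cmod (f (Suc k) t - f k t))\<^sup>2)) \<partial>leb_I)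
      = (\<Sum>k. (\<integral>\<^sup>+t. ennreal (2 ^ k * (cmod (f (Suc k) t - f k t))\<^sup>2) \<partial>leb_I))"
    by (rule nn_integral_suminf) measurable
  also have "\<dots> \<le> (\<Sum>k. ennreal ((1/8) ^ k))"
  proof (rule suminf_le)
    fix k
    have "(\<integral>\<^sup>+t. ennreal (2 ^ k * (cmod (f (Suc k) t - f k t))\<^sup>2) \<partial>leb_I)
        = ennreal (2 ^ k) * (\<integral>\<^sup>+t. ennreal ((cmod (f (Suc k) t - f k t))\<^sup>2) \<partial>leb_I)"
      by (subst nn_integral_cmult[symmetric]) (auto simp: ennreal_mult)
    also have "\<dots> \<le> ennreal (2 ^ k) * ennreal (((1/4) ^ k)\<^sup>2)"
      by (intro mult_left_mono step) auto
    also have "\<dots> = ennreal ((1/8) ^ k)"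
      by (simp add: ennreal_mult[symmetric] power2_eq_square power_mult_distrib[symmetric])
    finally show "(\<integral>\<^sup>+t. ennreal (2 ^ k * (cmod (f (Suc k) t - f k t))\<^sup>2) \<partial>leb_I) \<le> ennreal ((1/8) ^ k)" .
  qed auto
  also have "\<dots> < \<infinity>"
    by (subst suminf_ennreal2) (auto intro!: summable_geometric)
  finally have "AE t in leb_I. (\<Sum>k. ennreal (2 ^ k * (cmod (f (Suc k) t - f k t))\<^sup>2)) \<noteq> \<infinity>"
    by (intro nn_integral_noteq_infinite) auto
  then have conv: "AE t in leb_I. convergent (\<lambda>k. f k t)"
  proof eventually_elim
    case (elim t)
    define F where "F k = ennreal (2 ^ k * (cmod (f (Suc k) t - f k t))\<^sup>2)" for k
    have fin: "suminf F < top" using elim unfolding F_def infinity_ennreal_def less_top .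
    have "2 ^ k * (cmod (f (Suc k) t - f k t))\<^sup>2 \<le> enn2real (suminf F)" for k
    proof -
      have "sum F {k} \<le> suminf F" by (rule sum_le_suminf) auto
      then have "F k \<le> suminf F" by simp
      then have "enn2real (F k) \<le> enn2real (suminf F)" by (rule enn2real_mono[OF _ fin])
      then show ?thesis by (simp add: F_def)
    qed
    then show ?case by (rule rapidly_decreasing_imp_convergent)
  qed
  define g where "g t = lim (\<lambda>k. f k t)" for t
  have [measurable]: "g \<in> borel_measurable leb_I"
    unfolding g_def by (rule borel_measurable_lim_metric) simp
  have lim: "AE t in leb_I. (\<lambda>k. f k t) \<longlonglongrightarrow> g t"
    using conv by eventually_elim (simp add: g_def convergent_LIMSEQ_iff)
  have fatou: "(\<integral>\<^sup>+t. ennreal ((cmod (g t - f k t))\<^sup>2) \<partial>leb_I) \<le> ennreal (((1/4) ^ k)\<^sup>2)" for k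
  proof -
    have "(\<integral>\<^sup>+t. ennreal ((cmod (g t - f k t))\<^sup>2) \<partial>leb_I)
        = (\<integral>\<^sup>+t. liminf (\<lambda>j. ennreal ((cmod (f j t - f k t))\<^sup>2)) \<partial>leb_I)"
    proof (rule nn_integral_cong_AE, use lim in eventually_elim)
      fix t assume "(\<lambda>k. f k t) \<longlonglongrightarrow> g t"
      then have "(\<lambda>j. ennreal ((cmod (f j t - f k t))\<^sup>2)) \<longlonglongrightarrow> ennreal ((cmod (g t - f k t))\<^sup>2)"
        by (intro tendsto_intros)
      then show "ennreal ((cmod (g t - f k t))\<^sup>2) = liminf (\<lambda>j. ennreal ((cmod (f j t - f k t))\<^sup>2))"
        by (rule lim_imp_Liminf[OF trivial_limit_sequentially, symmetric])
    qed
    also have "\<dots> \<le> liminf (\<lambda>j. (\<integral>\<^sup>+t. ennreal ((cmod (f j t - f k t))\<^sup>2) \<partial>leb_I))"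
      by (rule nn_integral_liminf) measurable
    also have "\<dots> \<le> ennreal (((1/4) ^ k)\<^sup>2)"
    proof -
      have "\<forall>\<^sub>F j in sequentially. (\<integral>\<^sup>+t. ennreal ((cmod (f j t - f k t))\<^sup>2) \<partial>leb_I) \<le> ennreal (((1/4) ^ k)\<^sup>2)"
        using eventually_ge_at_top[of k] by eventually_elim (rule step)
      from Liminf_mono[OF this] show ?thesis by (simp add: Liminf_const)
    qed
    finally show ?thesis .
  qed
  have sqd: "sq_int (\<lambda>t. g t - f k t)" for k
  proof (rule sq_intI_nn_integral)
    show "(\<integral>\<^sup>+t. ennreal ((cmod (g t - f k t))\<^sup>2) \<partial>leb_I) < \<infinity>"
      using le_less_trans[OF fatou[of k] ennreal_less_top] by simp
  qed measurable
  have sqg: "sq_int g" using sq_int_add[OF sqd[of 0] f(1)[of 0]] by simp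
  have "(\<lambda>k. X (r k)) \<longlonglongrightarrow> l2_of g"
  proof (rule metric_tendsto_imp_tendsto[of "\<lambda>k. (1/4) ^ k" 0 sequentially])
    show "(\<lambda>k. (1/4::real) ^ k) \<longlonglongrightarrow> 0" by (rule LIMSEQ_realpow_zero) auto
    have "dist (X (r k)) (l2_of g) \<le> (1/4) ^ k" for k
    proof -
      have "(norm (l2_of (\<lambda>t. g t - f k t)))\<^sup>2 \<le> ((1/4) ^ k)\<^sup>2"
        using fatou[of k] unfolding nn_integral_eq_norm_l2_of[OF sqd] by simp
      then have "norm (l2_of g - X (r k)) \<le> (1/4) ^ k"
        unfolding f(2) l2_of_diff[OF sqg f(1)] by (rule power2_le_imp_le) simp
      then show ?thesis by (simp add: dist_norm norm_minus_commute)
    qed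
    then show "\<forall>\<^sub>F k in sequentially. dist (X (r k)) (l2_of g) \<le> dist ((1/4::real) ^ k) 0" by simp
  qed
  then have "X \<longlonglongrightarrow> l2_of g"
    using Cauchy_converges_subseq[OF X r(1), of "l2_of g"] by (simp add: o_def)
  then show "convergent X" unfolding convergent_def by blast
qed

section \<open>Adjoints and closures\<close>

lemma subspace_closure:
  fixes S :: "'a::real_normed_vector set"
  assumes S: "subspace S"
  shows "subspace (closure S)"
  unfolding subspace_def
proof (intro conjI ballI allI)
  show "0 \<in> closure S" using subspace_0[OF S] closure_subset by blast
  fix p assume "p \<in> closure S"
  then obtain a where a: "\<And>n. a n \<in> S" "a \<longlonglongrightarrow> p" by (auto simp: closure_sequential)
  show "r *\<^sub>R p \<in> closure S" for r
    unfolding closure_sequential using a subspace_scale[OF S]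
    by (intro exI[of _ "\<lambda>n. r *\<^sub>R a n"]) (auto intro!: tendsto_intros)
  fix q assume "q \<in> closure S"
  then obtain b where b: "\<And>n. b n \<in> S" "b \<longlonglongrightarrow> q" by (auto simp: closure_sequential)
  show "p + q \<in> closure S"
    unfolding closure_sequential using a b subspace_add[OF S]
    by (intro exI[of _ "\<lambda>n. a n + b n"]) (auto intro!: tendsto_intros)
qed

text \<open>Adjoints and closures are handled before they are known to be single-valued, hence
  relations rather than \<open>linear_operator\<close>. \<open>subspace\<close> is the real notion;
  the second conjunct adds complex homogeneity.\<close>

definition complex_linear_relation :: "(l2 \<times> l2) set \<Rightarrow> bool" where
  "complex_linear_relation T \<longleftrightarrow> subspace T \<and> (\<forall>c u v. (u, v) \<in> T \<longrightarrow> (cscale c u, cscale c v) \<in> T)"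

lemma cinner_cscale_left: "cinner (cscale c F) G = c * cinner F G"
proof -
  obtain f g where "sq_int f" "F = l2_of f" "sq_int g" "G = l2_of g" using ex_l2_of by metis
  then show ?thesis by (simp add: cscale_l2_of cinner_l2_of sq_int_scale mult.assoc)
qed

lemma cinner_commute: "cinner G F = cnj (cinner F G)"
proof -
  obtain f g where "sq_int f" "F = l2_of f" "sq_int g" "G = l2_of g" using ex_l2_of by metis
  then show ?thesis by (simp add: cinner_l2_of mult.commute flip: Bochner_Integration.integral_cnj)
qed

lemma cinner_add_left: "cinner (F + F') G = cinner F G + cinner F' G"
proof -
  obtain f f' g where "sq_int f" "F = l2_of f" "sq_int f'" "F' = l2_of f'" "sq_int g" "G = l2_of g" using ex_l2_of by metis
  then show ?thesis by (simp add: l2_of_add cinner_l2_of sq_int_add sq_int_mult_cnj distrib_right)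
qed

lemma cinner_add_right: "cinner F (G + G') = cinner F G + cinner F G'"
  by (metis cinner_add_left cinner_commute complex_cnj_add)

lemma cinner_cscale_right: "cinner F (cscale c G) = cnj c * cinner F G"
  by (metis cinner_cscale_left cinner_commute complex_cnj_mult)

lemma cinner_zero_right: "cinner F 0 = 0"
  using cinner_cscale_right[of F 0 0] by simp

lemma Re_cinner: "Re (cinner F G) = inner F G"
  by (simp add: inner_l2_def)

lemma Im_cinner: "Im (cinner F G) = inner (cscale (- \<i>) F) G"
  by (simp add: inner_l2_def cinner_cscale_left del: cl2.scale_minus_left)

lemma norm_cscale: "norm (cscale c F) = cmod c * norm F"
proof -
  have "cinner (cscale c F) (cscale c F) = (c * cnj c) * cinner F F"
    by (simp only: cinner_cscale_left cinner_cscale_right mult.assoc mult.left_commute)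
  also have "c * cnj c = complex_of_real ((cmod c)\<^sup>2)"
    by (simp only: complex_norm_square)
  finally have "(norm (cscale c F))\<^sup>2 = (cmod c * norm F)\<^sup>2"
    by (simp add: power2_norm_eq_inner inner_l2_def power_mult_distrib del: of_real_power)
  then show ?thesis by simp
qed

lemma scaleR_eq_cscale: "r *\<^sub>R F = cscale (complex_of_real r) F"
  by (simp add: scaleR_l2_def)

lemma bounded_linear_cscale: "bounded_linear (cscale c)"
proof (rule bounded_linear_intro[of _ "cmod c"])
  show "cscale c (r *\<^sub>R F) = r *\<^sub>R cscale c F" for r F
    by (simp add: scaleR_eq_cscale mult.commute)
qed (auto simp: norm_cscale mult.commute cl2.scale_right_distrib)

lemma linear_relationD:
  assumes "complex_linear_relation T"
  shows "(0, 0) \<in> T" "(u, v) \<in> T \<Longrightarrow> (u', v') \<in> T \<Longrightarrow> (u + u', v + v') \<in> T"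
    "(u, v) \<in> T \<Longrightarrow> (u', v') \<in> T \<Longrightarrow> (u - u', v - v') \<in> T"
    "(u, v) \<in> T \<Longrightarrow> (cscale c u, cscale c v) \<in> T"
  using assms subspace_0[of T] subspace_add[of T "(u, v)" "(u', v')"] subspace_diff[of T "(u, v)" "(u', v')"]
  by (auto simp: complex_linear_relation_def zero_prod_def)

lemma complex_linear_relationI:
  assumes "(0, 0) \<in> T" "\<And>u v u' v'. (u, v) \<in> T \<Longrightarrow> (u', v') \<in> T \<Longrightarrow> (u + u', v + v') \<in> T"
    "\<And>c u v. (u, v) \<in> T \<Longrightarrow> (cscale c u, cscale c v) \<in> T"
  shows "complex_linear_relation T"
  using assms unfolding complex_linear_relation_def subspace_def
  by (auto simp: zero_prod_def scaleR_eq_cscale)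

lemma closure_linear_relation:
  assumes T: "complex_linear_relation T"
  shows "complex_linear_relation (closure T)"
proof -
  have "(cscale c u, cscale c v) \<in> closure T" if "(u, v) \<in> closure T" for c u v
  proof -
    have "continuous_on UNIV (\<lambda>p. (cscale c (fst p), cscale c (snd p)))"
      by (intro continuous_intros bounded_linear.continuous_on[OF bounded_linear_cscale])
    then have "(\<lambda>p. (cscale c (fst p), cscale c (snd p))) ` closure T \<subseteq> closure T"
    proof (rule image_closure_subset[OF continuous_on_subset])
      show "(\<lambda>p. (cscale c (fst p), cscale c (snd p))) ` T \<subseteq> closure T"
        using linear_relationD(4)[OF T] closure_subset by fastforce
    qed auto
    then show ?thesis using that by force
  qed
  moreover have "subspace (closure T)"
    using T by (auto simp: complex_linear_relation_def intro: subspace_closure)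
  ultimately show ?thesis by (auto simp: complex_linear_relation_def)
qed

lemma adjoint_linear_relation: "complex_linear_relation (adjoint_op T)"
proof (rule complex_linear_relationI)
  show "(0, 0) \<in> adjoint_op T"
    by (auto simp: adjoint_op_def cinner_zero_right)
  show "(u + u', v + v') \<in> adjoint_op T" if "(u, v) \<in> adjoint_op T" "(u', v') \<in> adjoint_op T" for u v u' v'
    using that by (fastforce simp: adjoint_op_def cinner_add_right)
  show "(cscale c u, cscale c v) \<in> adjoint_op T" if "(u, v) \<in> adjoint_op T" for c u v
    using that by (fastforce simp: adjoint_op_def cinner_cscale_right)
qed

text \<open>The adjoint is the orthogonal complement of the graph after the rotation of
  \<open>(u, v)\<close> to \<open>(v, - u)\<close>. Real parts suffice: the imaginary part is the
  real condition for the pair multiplied by \<open>- \<i>\<close>.\<close>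

lemma adjoint_op_iff_inner:
  assumes T: "complex_linear_relation T"
  shows "(u, v) \<in> adjoint_op T \<longleftrightarrow> (\<forall>p\<in>T. inner p (v, - u) = 0)"
proof
  assume "(u, v) \<in> adjoint_op T"
  then have "cinner (snd p) u = cinner (fst p) v" if "p \<in> T" for p
    using that by (auto simp: adjoint_op_def)
  then show "\<forall>p\<in>T. inner p (v, - u) = 0"
    by (simp add: inner_prod_def inner_minus_right) (simp flip: Re_cinner)
next
  assume *: "\<forall>p\<in>T. inner p (v, - u) = 0"
  have "cinner g u = cinner f v" if fg: "(f, g) \<in> T" for f g
  proof (rule complex_eqI)
    show "Re (cinner g u) = Re (cinner f v)"
      using *[rule_format, OF fg] by (simp add: Re_cinner inner_prod_def)
    show "Im (cinner g u) = Im (cinner f v)"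
      using *[rule_format, OF linear_relationD(4)[OF T fg, of "- \<i>"]] by (simp add: Im_cinner inner_prod_def)
  qed
  then show "(u, v) \<in> adjoint_op T" by (auto simp: adjoint_op_def)
qed

lemma adjoint_op_closure:
  assumes T: "complex_linear_relation T"
  shows "adjoint_op (closure T) = adjoint_op T"
proof -
  have "(\<forall>p\<in>closure T. inner p q = 0) \<longleftrightarrow> (\<forall>p\<in>T. inner p q = 0)" for q :: "l2 \<times> l2"
  proof
    assume *: "\<forall>p\<in>T. inner p q = 0"
    have "closed {p. inner p q = 0}" 
      by (intro closed_Collect_eq continuous_intros)
    then have "closure T \<subseteq> {p. inner p q = 0}" using * by (intro closure_minimal) auto
    then show "\<forall>p\<in>closure T. inner p q = 0" by auto
  qed (use closure_subset in auto)
  then show ?thesis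
    using adjoint_op_iff_inner[OF T] adjoint_op_iff_inner[OF closure_linear_relation[OF T]] by auto
qed

text \<open>A pair outside the closure is separated from it by some \<open>(a, b)\<close> orthogonal
  to \<open>T\<close>. Rotated to \<open>(- b, a)\<close> this lies in the adjoint, and membership
  of \<open>(u, v)\<close> in the second adjoint then says that \<open>(a, b)\<close> is orthogonal
  to \<open>(u, v)\<close>.\<close>

lemma adjoint_adjoint_subset_closure:
  assumes T: "complex_linear_relation T"
  shows "adjoint_op (adjoint_op T) \<subseteq> closure T"
proof (rule subrelI, rule ccontr)
  fix u v assume uv: "(u, v) \<in> adjoint_op (adjoint_op T)" and n: "(u, v) \<notin> closure T"
  have "subspace (closure T)" using closure_linear_relation[OF T] by (simp add: complex_linear_relation_def)
  then obtain z where z: "\<And>s. s \<in> closure T \<Longrightarrow> inner z s = 0" "inner z (u, v) \<noteq> 0"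
    using orthogonal_to_closed_subspace[OF _ closed_closure n] by metis
  obtain a b where ab: "z = (a, b)" by fastforce
  have "(- b, a) \<in> adjoint_op T"
    unfolding adjoint_op_iff_inner[OF T] using z(1) closure_subset by (auto simp: ab inner_commute)
  then have "inner (- b, a) (v, - u) = 0"
    using uv unfolding adjoint_op_iff_inner[OF adjoint_linear_relation] by blast
  then show False using z(2) by (simp add: ab inner_prod_def)
qed

text \<open>A vector \<open>z\<close> orthogonal to the domain puts the pair \<open>(0, z)\<close>
  into the adjoint.\<close>

lemma densely_defined_if_adjoint_single_valued:
  assumes T: "complex_linear_relation T" and sv: "\<And>z. (0, z) \<in> adjoint_op T \<Longrightarrow> z = 0"
  shows "densely_defined T"
  unfolding densely_defined_def
proof (rule ccontr)
  assume "closure (Domain T) \<noteq> UNIV"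
  then obtain x where x: "x \<notin> closure (Domain T)" by auto
  have sub: "subspace (Domain T)"
    unfolding subspace_def scaleR_eq_cscale
    by (blast intro: linear_relationD(1,2,4)[OF T])
  then obtain z where z: "\<And>s. s \<in> closure (Domain T) \<Longrightarrow> inner z s = 0" "inner z x \<noteq> 0"
    using orthogonal_to_closed_subspace[OF subspace_closure closed_closure x] by metis
  have "(0, z) \<in> adjoint_op T"
    unfolding adjoint_op_iff_inner[OF T]
  proof
    fix p assume "p \<in> T"
    then have "fst p \<in> closure (Domain T)" using closure_subset by (metis DomainI prod.collapse subsetD)
    then show "inner p (z, - 0) = 0" using z(1)[of "fst p"] by (simp add: inner_prod_def inner_commute)
  qed
  then have "z = 0" by (rule sv)
  with z(2) show False by simp
qed

text \<open>Reduces symmetry of the closure to facts about \<open>T\<close>: the adjoint is closed,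
  so it contains the closure of \<open>T\<close>, and single-valuedness passes from the larger
  relation to the smaller one.\<close>

lemma symmetric_op_closure:
  assumes T: "complex_linear_relation T" and sym: "T \<subseteq> adjoint_op T"
    and sv: "\<And>z. (0, z) \<in> adjoint_op T \<Longrightarrow> z = 0"
  shows "symmetric_op (closure T)"
proof -
  have cT: "complex_linear_relation (closure T)" by (rule closure_linear_relation[OF T])
  have "closed (adjoint_op T)"
  proof -
    have "closed (\<Inter>p\<in>T. {q. inner p (snd q, - fst q) = 0})"
      by (intro closed_INT ballI closed_Collect_eq continuous_intros)
    moreover have "(\<Inter>p\<in>T. {q. inner p (snd q, - fst q) = 0}) = adjoint_op T"
    proof (rule set_eqI)
      fix q :: "l2 \<times> l2"
      show "q \<in> (\<Inter>p\<in>T. {q. inner p (snd q, - fst q) = 0}) \<longleftrightarrow> q \<in> adjoint_op T"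
        using adjoint_op_iff_inner[OF T, of "fst q" "snd q"] by simp
    qed
    ultimately show ?thesis by simp
  qed
  then have sub: "closure T \<subseteq> adjoint_op T" by (rule closure_minimal[OF sym])
  have "single_valued (closure T)"
  proof (rule single_valuedI)
    fix u v v' assume "(u, v) \<in> closure T" "(u, v') \<in> closure T"
    from linear_relationD(3)[OF cT this] have "(0, v - v') \<in> adjoint_op T" using sub by auto
    then show "v = v'" using sv[of "v - v'"] by simp
  qed
  then have "linear_operator (closure T)"
    unfolding linear_operator_def
    by (intro conjI allI impI linear_relationD(1,2,4)[OF cT])
  moreover have "densely_defined (closure T)"
  proof -
    have "closure (Domain T) = UNIV"
      using densely_defined_if_adjoint_single_valued[OF T sv] unfolding densely_defined_def .
    moreover have "closure (Domain T) \<subseteq> closure (Domain (closure T))"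
      by (intro closure_mono Domain_mono closure_subset)
    ultimately show ?thesis by (auto simp: densely_defined_def)
  qed
  ultimately show ?thesis
    using sub adjoint_op_closure[OF T] by (simp add: symmetric_op_def)
qed

text \<open>Hypothesis \<open>adj\<close> says that the adjoint is contained in its own adjoint,
  which lies in the closure of \<open>T\<close> by \<open>adjoint_adjoint_subset_closure\<close>.
  Deficiency spaces do not have to be computed.\<close>

lemma self_adjoint_op_closure:
  assumes T: "complex_linear_relation T" and sym: "T \<subseteq> adjoint_op T"
    and sv: "\<And>z. (0, z) \<in> adjoint_op T \<Longrightarrow> z = 0"
    and adj: "\<And>u v u' v'. (u, v) \<in> adjoint_op T \<Longrightarrow> (u', v') \<in> adjoint_op T \<Longrightarrow> cinner v u' = cinner u v'"
  shows "self_adjoint_op (closure T)"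
proof -
  have s: "symmetric_op (closure T)" by (rule symmetric_op_closure[OF T sym sv])
  have "adjoint_op T \<subseteq> adjoint_op (adjoint_op T)"
  proof (rule subrelI)
    fix u v assume uv: "(u, v) \<in> adjoint_op T"
    have "cinner g u = cinner f v" if "(f, g) \<in> adjoint_op T" for f g by (rule adj[OF that uv])
    then show "(u, v) \<in> adjoint_op (adjoint_op T)" unfolding adjoint_op_def[of "adjoint_op T"] by blast
  qed
  then have "adjoint_op (closure T) \<subseteq> closure T"
    using adjoint_adjoint_subset_closure[OF T] adjoint_op_closure[OF T] by blast
  then show ?thesis using s unfolding symmetric_op_def self_adjoint_op_def by blast
qed

lemma cdimension_line:
  assumes V: "V = range (\<lambda>c. cscale c u)" and u: "u \<noteq> 0"
  shows "cdimension V = 1"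
proof -
  have V': "V = cl2.span {u}" by (simp add: V cl2.span_singleton)
  have "\<exists>B. finite B \<and> B \<subseteq> V \<and> V \<subseteq> cl2.span B"
    by (rule exI[of _ "{u}"]) (auto simp: V' intro: cl2.span_base)
  moreover have "cl2.dim V = 1"
  proof -
    have "cl2.independent {u}" using u by (simp add: cl2.dependent_single)
    then show ?thesis unfolding V' using cl2.dim_span_eq_card_independent[of "{u}"] by simp
  qed
  ultimately show ?thesis by (simp add: cdimension_def one_enat_def)
qed

section \<open>Solutions of $-f'' = h$ with point interactions\<close>

definition loc_int :: "(real \<Rightarrow> complex) \<Rightarrow> bool" where
  "loc_int h \<longleftrightarrow> (\<forall>T. h absolutely_integrable_on {0..T})"

lemma loc_intD: "loc_int h \<Longrightarrow> 0 \<le> a \<Longrightarrow> h absolutely_integrable_on {a..b}"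
  unfolding loc_int_def by (rule absolutely_integrable_on_subinterval[where S = "{0..b}"]) auto

lemma loc_int_mult_continuous:
  assumes "loc_int h" "continuous_on {0..} g"
  shows "loc_int (\<lambda>t. g t * h t)"
  unfolding loc_int_def
proof
  fix T
  show "(\<lambda>t. g t * h t) absolutely_integrable_on {0..T}"
    using assms(1) unfolding loc_int_def
    by (intro absolutely_integrable_mult_continuous(2) continuous_on_subset[OF assms(2)]) auto
qed

lemma integral_combine_abs:
  fixes h :: "real \<Rightarrow> complex"
  assumes "h absolutely_integrable_on {a..c}" "a \<le> b" "b \<le> c"
  shows "integral {a..c} h = integral {a..b} h + integral {b..c} h"
  using Henstock_Kurzweil_Integration.integral_combine[OF assms(2,3), of h] assms(1)
  by (simp add: absolutely_integrable_on_def)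

lemma continuous_on_atLeast_0:
  fixes f :: "real \<Rightarrow> 'a::topological_space"
  assumes "\<And>T. continuous_on {0..T} f"
  shows "continuous_on {0..} f"
  unfolding continuous_on_eq_continuous_within
proof
  fix t :: real assume t: "t \<in> {0..}"
  have "continuous (at t within {0..t + 1}) f"
    using assms[of "t + 1"] t by (simp add: continuous_on_eq_continuous_within)
  moreover have "at t within {0..t + 1} = at t within {0..}"
    by (intro at_within_nhd[of _ "{..<t + 1}"]) auto
  ultimately show "continuous (at t within {0..}) f" by (simp add: continuous_within)
qed

locale point_interactions =
  fixes x \<alpha> :: "nat \<Rightarrow> real"
  assumes x_0: "x 0 = 0" and x_strict_mono: "strict_mono x" and x_at_top: "filterlim x at_top sequentially"
begin

abbreviation X :: "real set" where "X \<equiv> x ` {1..}"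

text \<open>A grid point is assigned to the segment on its right, so every derivative built from
  \<open>idx\<close> (\<open>lin_der\<close>, \<open>V\<close>, \<open>sol'\<close>) is the
  right-hand one at \<open>x n\<close>.\<close>

definition idx :: "real \<Rightarrow> nat" where "idx t = (LEAST n. t < x (Suc n))"

lemma x_less: "i < j \<Longrightarrow> x i < x j"
  using x_strict_mono by (rule strict_monoD)

lemma x_le: "i \<le> j \<Longrightarrow> x i \<le> x j"
  using x_strict_mono by (simp add: strict_mono_less_eq)

lemma x_less_Suc: "x k < x (Suc k)"
  by (simp add: x_less)

lemma x_nonneg: "0 \<le> x k"
  using x_le[of 0 k] by (simp add: x_0)

lemma x_unbounded: "\<exists>n. t < x n"
proof -
  have "eventually (\<lambda>n. t < x n) sequentially"
    using x_at_top by (simp add: filterlim_at_top_dense)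
  from eventually_happens'[OF sequentially_bot this] show ?thesis .
qed

lemma idx_bounds:
  assumes "0 \<le> t"
  shows "x (idx t) \<le> t" "t < x (Suc (idx t))"
proof -
  obtain n where "t < x n" using x_unbounded by blast
  then have "t < x (Suc n)" using x_less_Suc[of n] by linarith
  then show "t < x (Suc (idx t))" unfolding idx_def by (rule LeastI)
  show "x (idx t) \<le> t"
  proof (cases "idx t")
    case 0 then show ?thesis using assms by (simp add: x_0)
  next
    case (Suc m)
    then have "\<not> t < x (Suc m)" unfolding idx_def by (metis lessI not_less_Least)
    then show ?thesis by (simp add: Suc)
  qed
qed

lemma idx_eq:
  assumes "x k \<le> t" "t < x (Suc k)"
  shows "idx t = k"
proof -
  have "0 \<le> t" using assms(1) x_nonneg[of k] by linarith
  note b = idx_bounds[OF this]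
  have "x k < x (Suc (idx t))" "x (idx t) < x (Suc k)" using b assms by linarith+
  then show ?thesis by (simp add: strict_mono_less[OF x_strict_mono])
qed

lemma idx_x: "idx (x k) = k"
  by (rule idx_eq) (auto simp: x_less_Suc)

lemma not_in_X: "x k < t \<Longrightarrow> t < x (Suc k) \<Longrightarrow> t \<notin> X"
  using strict_mono_less[OF x_strict_mono] by (metis imageE less_Suc_eq not_less_eq)

lemma zero_not_in_X: "0 \<notin> X"
proof
  assume "0 \<in> X"
  then obtain n where "n \<ge> 1" "x n = 0" by auto
  then show False using x_less[of 0 n] by (simp add: x_0)
qed

lemma continuous_on_atLeast_0_segments:
  fixes f :: "real \<Rightarrow> 'a::topological_space"
  assumes seg: "\<And>k. continuous_on {x k..x (Suc k)} f"
  shows "continuous_on {0..} f"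
proof (rule continuous_on_atLeast_0)
  fix T
  have upto: "continuous_on {0..x k} f" for k
  proof (induction k)
    case 0 show ?case by (simp add: x_0)
  next
    case (Suc k)
    have "{0..x (Suc k)} = {0..x k} \<union> {x k..x (Suc k)}"
      using x_nonneg[of k] x_less_Suc[of k] by auto
    then show ?case using Suc seg[of k] by (simp add: continuous_on_closed_Un)
  qed
  obtain n where "T < x n" using x_unbounded by blast
  then show "continuous_on {0..T} f" by (intro continuous_on_subset[OF upto[of n]]) auto
qed

text \<open>A point off \<open>X\<close> is interior to its segment unless it is 0, where both
  filters are one-sided from the right; hence the separate case of index 0.\<close>

lemma at_within_segment:
  assumes t: "0 \<le> t" "t \<notin> X"
  shows "at t within {x (idx t)..x (Suc (idx t))} = at t within {0..}"
proof -
  define k where "k = idx t"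
  have k: "x k \<le> t" "t < x (Suc k)" unfolding k_def by (rule idx_bounds[OF t(1)])+
  have "at t within {x k..x (Suc k)} = at t within {0..}"
  proof (cases k)
    case 0
    show ?thesis
      by (rule at_within_nhd[of _ "{..<x (Suc k)}"]) (use k 0 x_0 in auto)
  next
    case (Suc m)
    then have "t \<noteq> x k" using t(2) by auto
    then show ?thesis
      by (intro at_within_nhd[of _ "{x k<..<x (Suc k)}"]) (use k x_nonneg[of k] in auto)
  qed
  then show ?thesis by (simp add: k_def)
qed

lemma same_segment:
  assumes st: "0 \<le> s" "s \<le> t" "{s..t} \<inter> X = {}"
  shows "idx t = idx s"
proof (rule idx_eq)
  show "x (idx s) \<le> t" using idx_bounds(1)[OF st(1)] st(2) by simp
  show "t < x (Suc (idx s))"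
  proof (rule ccontr)
    assume "\<not> t < x (Suc (idx s))"
    then have "x (Suc (idx s)) \<in> {s..t} \<inter> X" using idx_bounds(2)[OF st(1)] by auto
    then show False using st(3) by blast
  qed
qed

text \<open>
  \<open>lin_sol y p\<close> is the piecewise linear solution of \<open>- f'' = 0\<close> with the interface conditions and the
  initial values \<open>y\<close> and \<open>p\<close>; \<open>lin_state y p n\<close> consists of its value and its right derivative at \<open>x n\<close>.
\<close>

primrec lin_state :: "real \<Rightarrow> real \<Rightarrow> nat \<Rightarrow> real \<times> real" where
  "lin_state y p 0 = (y, p)"
| "lin_state y p (Suc n) = (let y' = fst (lin_state y p n) + (x (Suc n) - x n) * snd (lin_state y p n)
     in (y', snd (lin_state y p n) + \<alpha> (Suc n) * y'))"

definition lin_sol :: "real \<Rightarrow> real \<Rightarrow> real \<Rightarrow> real" where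
  "lin_sol y p t = fst (lin_state y p (idx t)) + snd (lin_state y p (idx t)) * (t - x (idx t))"

definition lin_der :: "real \<Rightarrow> real \<Rightarrow> real \<Rightarrow> real" where
  "lin_der y p t = snd (lin_state y p (idx t))"

lemma lin_sol_segment:
  assumes "x k \<le> t" "t \<le> x (Suc k)"
  shows "lin_sol y p t = fst (lin_state y p k) + snd (lin_state y p k) * (t - x k)"
proof (cases "t < x (Suc k)")
  case True
  then show ?thesis using assms by (simp add: lin_sol_def idx_eq)
next
  case False
  then have "t = x (Suc k)" using assms by simp
  then show ?thesis by (simp add: lin_sol_def idx_x Let_def mult.commute)
qed

lemma continuous_on_lin_sol: "continuous_on {0..} (lin_sol y p)"
proof (rule continuous_on_atLeast_0_segments)
  fix k
  have "continuous_on {x k..x (Suc k)} (\<lambda>t. fst (lin_state y p k) + snd (lin_state y p k) * (t - x k))"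
    by (intro continuous_intros)
  then show "continuous_on {x k..x (Suc k)} (lin_sol y p)"
    by (rule continuous_on_eq) (rule lin_sol_segment[symmetric]; simp)
qed

abbreviation \<theta> :: "real \<Rightarrow> complex" where "\<theta> t \<equiv> complex_of_real (lin_sol 1 0 t)"
abbreviation \<phi> :: "real \<Rightarrow> complex" where "\<phi> t \<equiv> complex_of_real (lin_sol 0 1 t)"
abbreviation \<theta>' :: "real \<Rightarrow> complex" where "\<theta>' t \<equiv> complex_of_real (lin_der 1 0 t)"
abbreviation \<phi>' :: "real \<Rightarrow> complex" where "\<phi>' t \<equiv> complex_of_real (lin_der 0 1 t)"

text \<open>Crossing a segment and applying a jump are both shears of the pair of value and
  derivative, so they have determinant 1.\<close>

lemma wronskian_state:
  "fst (lin_state 1 0 k) * snd (lin_state 0 1 k) - fst (lin_state 0 1 k) * snd (lin_state 1 0 k) = 1"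
  by (induction k) (auto simp: Let_def algebra_simps)

lemma wronskian: "\<theta> t * \<phi>' t - \<phi> t * \<theta>' t = 1"
proof -
  have "lin_sol 1 0 t * lin_der 0 1 t - lin_sol 0 1 t * lin_der 1 0 t = 1"
    using wronskian_state[of "idx t"] by (simp add: lin_sol_def lin_der_def algebra_simps)
  then show ?thesis by (metis of_real_1 of_real_diff of_real_mult)
qed

text \<open>
  Variation of constants: \<open>U c h\<close> solves \<open>- f'' = h\<close>, \<open>f 0 = c\<close>, \<open>f' 0 = 0\<close> with the interface
  conditions, and \<open>V c h\<close> is its derivative from the right.
\<close>

definition A :: "complex \<Rightarrow> (real \<Rightarrow> complex) \<Rightarrow> real \<Rightarrow> complex" where
  "A c h t = c + integral {0..t} (\<lambda>s. \<phi> s * h s)"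

definition B :: "(real \<Rightarrow> complex) \<Rightarrow> real \<Rightarrow> complex" where
  "B h t = - integral {0..t} (\<lambda>s. \<theta> s * h s)"

definition U :: "complex \<Rightarrow> (real \<Rightarrow> complex) \<Rightarrow> real \<Rightarrow> complex" where
  "U c h t = A c h t * \<theta> t + B h t * \<phi> t"

definition V :: "complex \<Rightarrow> (real \<Rightarrow> complex) \<Rightarrow> real \<Rightarrow> complex" where
  "V c h t = A c h t * \<theta>' t + B h t * \<phi>' t"

text \<open>Cramer's rule for the system that defines \<open>U\<close> and \<open>V\<close>, with
  the Wronskian 1 as determinant. Together with \<open>B_eq_UV\<close> it shows that
  \<open>A\<close> and \<open>B\<close> vanish wherever \<open>U\<close> and \<open>V\<close>
  do.\<close>

lemma A_eq_UV: "A c h t = U c h t * \<phi>' t - V c h t * \<phi> t"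
proof -
  have "A c h t = A c h t * (\<theta> t * \<phi>' t - \<phi> t * \<theta>' t)" unfolding wronskian by simp
  then show ?thesis unfolding U_def V_def by algebra
qed

lemma B_eq_UV: "B h t = V c h t * \<theta> t - U c h t * \<theta>' t"
proof -
  have "B h t = B h t * (\<theta> t * \<phi>' t - \<phi> t * \<theta>' t)" unfolding wronskian by simp
  then show ?thesis unfolding U_def V_def by algebra
qed

lemma U_0: "U c h 0 = c" and V_0: "V c h 0 = 0"
proof -
  have "idx 0 = 0" using idx_x[of 0] by (simp add: x_0)
  then show "U c h 0 = c" "V c h 0 = 0"
    by (simp_all add: U_def V_def A_def B_def lin_sol_def lin_der_def x_0)
qed

text \<open>The change from \<open>A\<close>, \<open>B\<close> to \<open>U\<close>, \<open>V\<close>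
  has determinant 1. So the Wronskian can be read off from indefinite integrals, although
  \<open>V\<close> jumps at the points of \<open>X\<close>.\<close>

lemma UV_wronskian: "U c h t * V d k t - V c h t * U d k t = A c h t * B k t - B h t * A d k t"
proof -
  have "U c h t * V d k t - V c h t * U d k t
      = (A c h t * B k t - B h t * A d k t) * (\<theta> t * \<phi>' t - \<phi> t * \<theta>' t)"
    unfolding U_def V_def by algebra
  then show ?thesis unfolding wronskian by simp
qed

lemma U_cnj: "U (cnj c) (\<lambda>t. cnj (h t)) t = cnj (U c h t)" and V_cnj: "V (cnj c) (\<lambda>t. cnj (h t)) t = cnj (V c h t)"
proof -
  have "integral {0..t} (\<lambda>s. complex_of_real (g s) * cnj (h s)) = cnj (integral {0..t} (\<lambda>s. complex_of_real (g s) * h s))" for g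
    unfolding integral_cnj by simp
  then show "U (cnj c) (\<lambda>t. cnj (h t)) t = cnj (U c h t)" "V (cnj c) (\<lambda>t. cnj (h t)) t = cnj (V c h t)"
    by (simp_all add: U_def V_def A_def B_def)
qed

lemma continuous_on_complex_lin_sol: "continuous_on {0..} (\<lambda>t. complex_of_real (lin_sol y p t))"
  using continuous_on_lin_sol by (intro continuous_on_of_real)

lemma loc_int_lin_sol: "loc_int h \<Longrightarrow> loc_int (\<lambda>t. complex_of_real (lin_sol y p t) * h t)"
  by (rule loc_int_mult_continuous[OF _ continuous_on_complex_lin_sol])

lemma continuous_on_AB:
  assumes h: "loc_int h"
  shows "continuous_on {0..T} (A c h)" "continuous_on {0..T} (B h)"
proof -
  show "continuous_on {0..T} (A c h)"
    by (rule continuous_on_indefinite_integral[where f = "\<lambda>s. \<phi> s * h s"])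
       (auto simp: A_def intro: loc_intD[OF loc_int_lin_sol[OF h]])
  have "continuous_on {0..T} (\<lambda>t. - B h t)"
    by (rule continuous_on_indefinite_integral[where f = "\<lambda>s. \<theta> s * h s"])
       (auto simp: B_def intro: loc_intD[OF loc_int_lin_sol[OF h]])
  then show "continuous_on {0..T} (B h)" using continuous_on_minus by fastforce
qed

lemma continuous_on_U:
  assumes h: "loc_int h"
  shows "continuous_on {0..T} (U c h)"
  unfolding U_def using continuous_on_AB[OF h]
  by (intro continuous_intros continuous_on_subset[OF continuous_on_complex_lin_sol]) auto

text \<open>Formally \<open>A' = \<phi> h\<close> and \<open>B' = - \<theta> h\<close>, so
  \<open>A c h * B k - B h * A d k\<close> has derivative \<open>h * U d k - k * U c h\<close>.
  Since neither \<open>A\<close> nor \<open>B\<close> jumps, one product rule covers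
  \<open>{0..T}\<close> across all interaction points; at 0 the boundary term vanishes with
  \<open>B\<close>.\<close>

lemma green:
  assumes h: "loc_int h" and k: "loc_int k" and T: "0 \<le> T"
  shows "(\<lambda>t. h t * U d k t - k t * U c h t) absolutely_integrable_on {0..T}"
    and "integral {0..T} (\<lambda>t. h t * U d k t - k t * U c h t) = A c h T * B k T - B h T * A d k T"
proof -
  have ai: "(\<lambda>s. complex_of_real (lin_sol y p s) * f s) absolutely_integrable_on {0..T}" if "loc_int f" for y p f
    by (rule loc_intD[OF loc_int_lin_sol[OF that]]) simp
  have nai: "(\<lambda>s. - (complex_of_real (lin_sol y p s) * f s)) absolutely_integrable_on {0..T}" if "loc_int f" for y p f
    using absolutely_integrable_scaleR_left[OF ai[OF that], of "-1"] by simp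
  have Ai: "A e f t = A e f 0 + integral {0..t} (\<lambda>s. \<phi> s * f s)" for e f t
    by (simp add: A_def)
  have Bi: "B f t = B f 0 + integral {0..t} (\<lambda>s. - (\<theta> s * f s))" for f t
    by (simp add: B_def)
  note 1 = integral_product_rule[OF T ai[OF h] nai[OF k], where F = "A c h" and G = "B k", OF Ai Bi]
  note 2 = integral_product_rule[OF T nai[OF h] ai[OF k], where F = "B h" and G = "A d k", OF Bi Ai]
  have eq: "\<phi> t * h t * B k t + A c h t * - (\<theta> t * k t) - (- (\<theta> t * h t) * A d k t + B h t * (\<phi> t * k t))
      = h t * U d k t - k t * U c h t" for t
    by (simp add: U_def algebra_simps)
  have "(\<lambda>t. (\<phi> t * h t * B k t + A c h t * - (\<theta> t * k t)) - (- (\<theta> t * h t) * A d k t + B h t * (\<phi> t * k t))) absolutely_integrable_on {0..T}"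
    by (rule set_integral_diff(1)[OF 1(1) 2(1)])
  then show "(\<lambda>t. h t * U d k t - k t * U c h t) absolutely_integrable_on {0..T}" unfolding eq .
  have "integral {0..T} (\<lambda>t. (\<phi> t * h t * B k t + A c h t * - (\<theta> t * k t)) - (- (\<theta> t * h t) * A d k t + B h t * (\<phi> t * k t)))
    = (A c h T * B k T - A c h 0 * B k 0) - (B h T * A d k T - B h 0 * A d k 0)"
    using 1 2 by (subst Henstock_Kurzweil_Integration.integral_diff) (auto simp: absolutely_integrable_on_def)
  then show "integral {0..T} (\<lambda>t. h t * U d k t - k t * U c h t) = A c h T * B k T - B h T * A d k T"
    unfolding eq by (simp add: B_def)
qed

text \<open>\<open>Vl c h k\<close> is \<open>V c h\<close> on the \<open>k\<close>-th segment, continued to the right end point by its left limit.\<close>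

definition Vl :: "complex \<Rightarrow> (real \<Rightarrow> complex) \<Rightarrow> nat \<Rightarrow> real \<Rightarrow> complex" where
  "Vl c h k t = V c h (x k) - integral {x k..t} h"

text \<open>On one segment \<open>\<theta>\<close> and \<open>\<phi>\<close> are affine, so only the
  zeroth and first moments \<open>I0\<close> and \<open>I1\<close> of \<open>h\<close>
  enter.\<close>

lemma AB_segment:
  fixes I0 I1 :: complex
  assumes h: "loc_int h" and t: "x k \<le> t" "t \<le> x (Suc k)"
    and I0_def: "I0 = integral {x k..t} h" and I1_def: "I1 = integral {x k..t} (\<lambda>s. complex_of_real (s - x k) * h s)"
  shows "A c h t = A c h (x k) + fst (lin_state 0 1 k) * I0 + snd (lin_state 0 1 k) * I1"
    and "B h t = B h (x k) - fst (lin_state 1 0 k) * I0 - snd (lin_state 1 0 k) * I1"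
proof -
  have hi: "h integrable_on {x k..t}"
    using loc_intD[OF h x_nonneg] by (simp add: absolutely_integrable_on_def)
  have "(\<lambda>s. complex_of_real (s - x k) * h s) absolutely_integrable_on {x k..t}"
    by (rule absolutely_integrable_mult_continuous(2)[OF loc_intD[OF h x_nonneg]]) (intro continuous_intros)
  then have h1: "(\<lambda>s. complex_of_real (s - x k) * h s) integrable_on {x k..t}"
    by (simp add: absolutely_integrable_on_def)
  have step: "integral {0..t} (\<lambda>s. complex_of_real (lin_sol y p s) * h s) = integral {0..x k} (\<lambda>s. complex_of_real (lin_sol y p s) * h s)
    + (fst (lin_state y p k) * I0 + snd (lin_state y p k) * I1)" for y p
  proof -
    have "integral {x k..t} (\<lambda>s. complex_of_real (lin_sol y p s) * h s)
        = integral {x k..t} (\<lambda>s. fst (lin_state y p k) * h s + snd (lin_state y p k) * (complex_of_real (s - x k) * h s))"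
      by (rule integral_cong) (use t in \<open>simp add: lin_sol_segment[of k] algebra_simps\<close>)
    also have "\<dots> = fst (lin_state y p k) * I0 + snd (lin_state y p k) * I1"
      unfolding I0_def I1_def
      by (rule integral_unique[OF has_integral_add[OF
        has_integral_mult_right[OF integrable_integral[OF hi]]
        has_integral_mult_right[OF integrable_integral[OF h1]]]])
    finally show ?thesis
      using integral_combine_abs[OF loc_intD[OF loc_int_lin_sol[OF h] order_refl] x_nonneg t(1)] by simp
  qed
  show "A c h t = A c h (x k) + fst (lin_state 0 1 k) * I0 + snd (lin_state 0 1 k) * I1"
    unfolding A_def step by simp
  show "B h t = B h (x k) - fst (lin_state 1 0 k) * I0 - snd (lin_state 1 0 k) * I1"
    unfolding B_def step by simp
qed

lemma wronskian_state_complex: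
  "complex_of_real (fst (lin_state 1 0 k)) * complex_of_real (snd (lin_state 0 1 k))
    = 1 + complex_of_real (fst (lin_state 0 1 k)) * complex_of_real (snd (lin_state 1 0 k))"
proof -
  have "fst (lin_state 1 0 k) * snd (lin_state 0 1 k) = 1 + fst (lin_state 0 1 k) * snd (lin_state 1 0 k)"
    using wronskian_state[of k] by simp
  then show ?thesis by (metis of_real_1 of_real_add of_real_mult)
qed

lemma V_eq_Vl_aux:
  assumes h: "loc_int h" and t: "x k \<le> t" "t \<le> x (Suc k)"
  shows "Vl c h k t = A c h t * snd (lin_state 1 0 k) + B h t * snd (lin_state 0 1 k)"
  unfolding Vl_def V_def AB_segment[OF h t refl refl] lin_der_def idx_x
  using wronskian_state_complex[of k] by algebra

lemma V_eq_Vl: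
  assumes h: "loc_int h" and t: "x k \<le> t" "t < x (Suc k)"
  shows "V c h t = Vl c h k t"
  unfolding V_eq_Vl_aux[OF h t(1) less_imp_le[OF t(2)]]
  by (simp add: V_def lin_der_def idx_eq[OF t])

lemma V_jump:
  assumes h: "loc_int h"
  shows "V c h (x (Suc k)) = Vl c h k (x (Suc k)) + \<alpha> (Suc k) * U c h (x (Suc k))"
  unfolding V_eq_Vl_aux[OF h less_imp_le[OF x_less_Suc] order_refl]
  by (simp add: V_def U_def lin_der_def lin_sol_def idx_x Let_def algebra_simps)

text \<open>Taylor's formula with integral remainder. It follows from \<open>AB_segment\<close>,
  where the determinant identity \<open>wronskian_state_complex\<close> removes the coefficients of
  the fundamental system.\<close>

lemma U_segment:
  assumes h: "loc_int h" and t: "x k \<le> t" "t \<le> x (Suc k)"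
  shows "U c h t = U c h (x k) + V c h (x k) * complex_of_real (t - x k) - integral {x k..t} (\<lambda>s. complex_of_real (t - s) * h s)"
proof -
  have hi: "h integrable_on {x k..t}"
    using loc_intD[OF h x_nonneg] by (simp add: absolutely_integrable_on_def)
  have "(\<lambda>s. complex_of_real (s - x k) * h s) absolutely_integrable_on {x k..t}"
    by (rule absolutely_integrable_mult_continuous(2)[OF loc_intD[OF h x_nonneg]]) (intro continuous_intros)
  then have h1: "(\<lambda>s. complex_of_real (s - x k) * h s) integrable_on {x k..t}"
    by (simp add: absolutely_integrable_on_def)
  have e: "integral {x k..t} (\<lambda>s. complex_of_real (t - s) * h s)
    = complex_of_real (t - x k) * integral {x k..t} h - integral {x k..t} (\<lambda>s. complex_of_real (s - x k) * h s)"
  proof -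
    have "(\<lambda>s. complex_of_real (t - s) * h s)
       = (\<lambda>s. complex_of_real (t - x k) * h s - complex_of_real (s - x k) * h s)"
      by (auto simp: algebra_simps)
    then show ?thesis
      using integral_unique[OF has_integral_diff[OF has_integral_mult_right[OF integrable_integral[OF hi],
        of "complex_of_real (t - x k)"] integrable_integral[OF h1]]] by simp
  qed
  have s: "complex_of_real (lin_sol y p t) = fst (lin_state y p k) + snd (lin_state y p k) * complex_of_real (t - x k)" for y p
    using lin_sol_segment[OF t] by simp
  have s0: "complex_of_real (lin_sol y p (x k)) = fst (lin_state y p k)" for y p
    using lin_sol_segment[of k "x k"] x_less_Suc[of k] by simp
  show ?thesis
    unfolding e U_def V_def AB_segment[OF h t refl refl] lin_der_def idx_x s s0
    using wronskian_state_complex[of k] by algebra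
qed

end

section \<open>Differentiability of \<open>U\<close>, integration by parts, and uniqueness of
  solutions\<close>

context point_interactions begin

lemma continuous_on_Vl:
  assumes h: "loc_int h"
  shows "continuous_on {x k..T} (Vl c h k)"
  unfolding Vl_def using loc_intD[OF h x_nonneg]
  by (intro continuous_intros indefinite_integral_continuous_1) (simp add: absolutely_integrable_on_def)

text \<open>Integrating by parts against \<open>s - x k\<close> turns the Taylor remainder into an
  iterated integral. As \<open>Vl\<close> is continuous on the closed segment, \<open>U\<close> is
  continuously differentiable there up to both ends.\<close>

lemma U_eq_integral_Vl:
  assumes h: "loc_int h" and t: "x k \<le> t" "t \<le> x (Suc k)"
  shows "U c h t = U c h (x k) + integral {x k..t} (Vl c h k)"
proof -
  define J where "J s = integral {x k..s} h" for s
  define g where "g s = complex_of_real (s - x k)" for s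
  have hi: "h absolutely_integrable_on {x k..t}" by (rule loc_intD[OF h x_nonneg])
  have one: "(\<lambda>s. 1::complex) absolutely_integrable_on {x k..t}"
    by (rule absolutely_integrable_continuous_real) (rule continuous_on_const)
  have g: "g s = g (x k) + integral {x k..s} (\<lambda>s. 1)" if "x k \<le> s" for s
    using that by (simp add: g_def scaleR_conv_of_real)
  have J: "J s = J (x k) + integral {x k..s} h" for s by (simp add: J_def)
  have pr: "integral {x k..t} (\<lambda>s. 1 * J s + g s * h s) = g t * J t - g (x k) * J (x k)"
    by (rule integral_product_rule(2)[OF t(1) one hi g J])
  have gh: "(\<lambda>s. g s * h s) absolutely_integrable_on {x k..t}"
    unfolding g_def by (rule absolutely_integrable_mult_continuous(2)[OF hi]) (intro continuous_intros)
  have Jc: "continuous_on {x k..t} J"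
    unfolding J_def using hi by (intro indefinite_integral_continuous_1) (simp add: absolutely_integrable_on_def)
  have Ji: "J integrable_on {x k..t}" by (rule integrable_continuous_real[OF Jc])
  have ghi: "(\<lambda>s. g s * h s) integrable_on {x k..t}" and hii: "h integrable_on {x k..t}"
    using gh hi by (auto simp: absolutely_integrable_on_def)
  have 1: "integral {x k..t} J + integral {x k..t} (\<lambda>s. g s * h s) = g t * J t"
    using pr integral_unique[OF has_integral_add[OF integrable_integral[OF Ji] integrable_integral[OF ghi]]]
    by (simp add: g_def)
  have 2: "integral {x k..t} (\<lambda>s. complex_of_real (t - s) * h s) = g t * J t - integral {x k..t} (\<lambda>s. g s * h s)"
  proof -
    have eq: "(\<lambda>s. complex_of_real (t - s) * h s) = (\<lambda>s. g t * h s - g s * h s)"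
      by (auto simp: g_def algebra_simps)
    show ?thesis
      unfolding eq J_def
      by (rule integral_unique[OF has_integral_diff[OF has_integral_mult_right[OF integrable_integral[OF hii]]
        integrable_integral[OF ghi]]])
  qed
  have 3: "integral {x k..t} (Vl c h k) = V c h (x k) * g t - integral {x k..t} J"
  proof -
    have "((\<lambda>s. V c h (x k)) has_integral V c h (x k) * g t) {x k..t}"
      using has_integral_const_real[of "V c h (x k)" "x k" t] t(1)
      by (simp add: g_def scaleR_conv_of_real mult.commute)
    from integral_unique[OF has_integral_diff[OF this integrable_integral[OF Ji]]]
    show ?thesis by (simp add: Vl_def[abs_def] J_def)
  qed
  show ?thesis
    unfolding U_segment[OF h t] 2 3 using 1 by (simp add: g_def algebra_simps)
qed

lemma U_deriv_segment:
  assumes h: "loc_int h" and t: "t \<in> {x k..x (Suc k)}"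
  shows "(U c h has_vector_derivative Vl c h k t) (at t within {x k..x (Suc k)})"
proof -
  have "((\<lambda>t. U c h (x k) + integral {x k..t} (Vl c h k)) has_vector_derivative 0 + Vl c h k t) (at t within {x k..x (Suc k)})"
    by (intro has_vector_derivative_add has_vector_derivative_const
        integral_has_vector_derivative[OF continuous_on_Vl[OF h]] t)
  then have "((\<lambda>t. U c h (x k) + integral {x k..t} (Vl c h k)) has_vector_derivative Vl c h k t) (at t within {x k..x (Suc k)})"
    by simp
  then show ?thesis
    by (rule has_vector_derivative_transform[rotated -1]) (use U_eq_integral_Vl[OF h] t in auto)
qed

lemma U_deriv:
  assumes h: "loc_int h" and t: "0 \<le> t" "t \<notin> X"
  shows "(U c h has_vector_derivative V c h t) (at t within {0..})"
proof -
  define k where "k = idx t"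
  have k: "x k \<le> t" "t < x (Suc k)" unfolding k_def by (rule idx_bounds[OF t(1)])+
  have "(U c h has_vector_derivative Vl c h k t) (at t within {x k..x (Suc k)})"
    by (rule U_deriv_segment[OF h]) (use k in auto)
  then show ?thesis using V_eq_Vl[OF h k] at_within_segment[OF t] by (simp add: k_def)
qed

lemma V_increment:
  assumes h: "loc_int h" and st: "0 \<le> s" "s \<le> t" "{s..t} \<inter> X = {}"
  shows "V c h t - V c h s = - integral {s..t} h"
proof -
  define k where "k = idx s"
  have k: "x k \<le> s" "s < x (Suc k)" unfolding k_def by (rule idx_bounds[OF st(1)])+
  have t: "t < x (Suc k)"
    using idx_bounds(2)[OF order_trans[OF st(1,2)]] same_segment[OF st] by (simp add: k_def)
  have "integral {x k..t} h = integral {x k..s} h + integral {s..t} h"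
    by (rule integral_combine_abs[OF loc_intD[OF h x_nonneg] k(1) st(2)])
  then show ?thesis
    using V_eq_Vl[OF h k] V_eq_Vl[OF h order_trans[OF k(1) st(2)] t] by (simp add: Vl_def)
qed

text \<open>Two product rules, for \<open>Vl * p\<close> and for \<open>U * p'\<close>, whose mixed
  terms \<open>Vl * p'\<close> cancel. Suitable \<open>p\<close> will isolate a value or a one-sided
  derivative of \<open>U\<close> at an end point.\<close>

lemma integration_by_parts_segment:
  fixes p p' p'' :: "real \<Rightarrow> complex"
  assumes h: "loc_int h"
    and p: "\<And>t. t \<in> {x k..x (Suc k)} \<Longrightarrow> (p has_vector_derivative p' t) (at t within {x k..x (Suc k)})"
    and p': "\<And>t. t \<in> {x k..x (Suc k)} \<Longrightarrow> (p' has_vector_derivative p'' t) (at t within {x k..x (Suc k)})"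
    and p'': "continuous_on {x k..x (Suc k)} p''"
  defines "a \<equiv> x k" and "b \<equiv> x (Suc k)"
  shows "Vl c h k b * p b - U c h b * p' b - (V c h a * p a - U c h a * p' a)
    = - integral {a..b} (\<lambda>t. h t * p t + U c h t * p'' t)"
proof -
  have ab: "a \<le> b" unfolding a_def b_def using x_less_Suc[of k] by simp
  have cp: "continuous_on {a..b} p" "continuous_on {a..b} p'"
    unfolding a_def b_def continuous_on_eq_continuous_within
    using p p' has_vector_derivative_continuous by blast+
  have hi: "h absolutely_integrable_on {a..b}" unfolding a_def by (rule loc_intD[OF h x_nonneg])
  have mhi: "(\<lambda>t. - h t) absolutely_integrable_on {a..b}"
    using absolutely_integrable_scaleR_left[OF hi, of "-1"] by simp
  have Vi: "Vl c h k absolutely_integrable_on {a..b}"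
    unfolding a_def by (rule absolutely_integrable_continuous_real[OF continuous_on_Vl[OF h]])
  have pi: "p' absolutely_integrable_on {a..b}" "p'' absolutely_integrable_on {a..b}"
    using cp p'' by (auto simp: a_def b_def intro: absolutely_integrable_continuous_real)
  have ftc: "f t = f a + integral {a..t} f'" if "a \<le> t" "t \<le> b"
    and "\<And>t. t \<in> {a..b} \<Longrightarrow> (f has_vector_derivative f' t) (at t within {a..b})" for f f' :: "real \<Rightarrow> complex" and t
  proof -
    have "(f' has_integral f t - f a) {a..t}"
      by (rule fundamental_theorem_of_calculus[OF that(1)], rule has_vector_derivative_within_subset[OF that(3)])
         (use that(2) in auto)
    then show ?thesis by (simp add: integral_unique)
  qed
  have Fp: "p t = p a + integral {a..t} p'" if "a \<le> t" "t \<le> b" for t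
    by (rule ftc[OF that]) (use p in \<open>auto simp: a_def b_def\<close>)
  have Fp': "p' t = p' a + integral {a..t} p''" if "a \<le> t" "t \<le> b" for t
    by (rule ftc[OF that]) (use p' in \<open>auto simp: a_def b_def\<close>)
  have FV: "Vl c h k t = Vl c h k a + integral {a..t} (\<lambda>t. - h t)" for t
    by (simp add: Vl_def a_def)
  have FU: "U c h t = U c h a + integral {a..t} (Vl c h k)" if "a \<le> t" "t \<le> b" for t
    unfolding a_def by (rule U_eq_integral_Vl[OF h]) (use that in \<open>auto simp: a_def b_def\<close>)
  note 1 = integral_product_rule[OF ab mhi pi(1) FV Fp]
  note 2 = integral_product_rule[OF ab Vi pi(2) FU Fp']
  have "- integral {a..b} (\<lambda>t. h t * p t + U c h t * p'' t)
      = integral {a..b} (\<lambda>t. (- h t * p t + Vl c h k t * p' t) - (Vl c h k t * p' t + U c h t * p'' t))"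
    by (simp flip: Henstock_Kurzweil_Integration.integral_neg)
  also have "\<dots> = (Vl c h k b * p b - Vl c h k a * p a) - (U c h b * p' b - U c h a * p' a)"
    using 1 2 by (subst Henstock_Kurzweil_Integration.integral_diff) (auto simp: absolutely_integrable_on_def)
  finally show ?thesis by (simp add: Vl_def a_def)
qed

definition interface_condition :: "(real \<Rightarrow> complex) \<Rightarrow> (real \<Rightarrow> complex) \<Rightarrow> bool" where
  "interface_condition f f1 \<longleftrightarrow> (\<forall>n\<ge>1. \<exists>v p m.
        (f \<longlongrightarrow> v) (at_right (x n)) \<and> (f \<longlongrightarrow> v) (at_left (x n)) \<and>
        (f1 \<longlongrightarrow> p) (at_right (x n)) \<and> (f1 \<longlongrightarrow> m) (at_left (x n)) \<and>
        p - m = complex_of_real (\<alpha> n) * v)"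

lemma eventually_at_left_segment: "\<forall>\<^sub>F t in at_left (x (Suc k)). x k < t \<and> t < x (Suc k)"
  using eventually_at_left_real[OF x_less_Suc[of k]] by eventually_elim auto

lemma eventually_at_right_segment: "\<forall>\<^sub>F t in at_right (x k). x k < t \<and> t < x (Suc k)"
  using eventually_at_right_real[OF x_less_Suc[of k]] by eventually_elim auto

lemma at_left_segment: "at (x (Suc k)) within {x k..x (Suc k)} = at_left (x (Suc k))"
  by (rule at_within_Icc_at_left[OF x_less_Suc])

lemma at_right_segment: "at (x k) within {x k..x (Suc k)} = at_right (x k)"
  by (rule at_within_Icc_at_right[OF x_less_Suc])

lemma UV_limits:
  assumes h: "loc_int h"
  shows "(U c h \<longlongrightarrow> U c h (x (Suc k))) (at_left (x (Suc k)))"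
    "(V c h \<longlongrightarrow> Vl c h k (x (Suc k))) (at_left (x (Suc k)))"
    "(U c h \<longlongrightarrow> U c h (x k)) (at_right (x k))"
    "(V c h \<longlongrightarrow> V c h (x k)) (at_right (x k))"
proof -
  have "continuous_on {x k..x (Suc k)} (U c h)"
    by (rule continuous_on_subset[OF continuous_on_U[OF h, of "x (Suc k)"]]) (use x_nonneg[of k] in auto)
  then show "(U c h \<longlongrightarrow> U c h (x (Suc k))) (at_left (x (Suc k)))"
    "(U c h \<longlongrightarrow> U c h (x k)) (at_right (x k))"
    using x_less_Suc[of k] unfolding continuous_on_def at_left_segment[symmetric] at_right_segment[symmetric] by auto
  have cV: "continuous_on {x k..x (Suc k)} (Vl c h k)" by (rule continuous_on_Vl[OF h])
  have "(Vl c h k \<longlongrightarrow> Vl c h k (x (Suc k))) (at_left (x (Suc k)))"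
    using cV x_less_Suc[of k] unfolding continuous_on_def at_left_segment[symmetric] by auto
  then show "(V c h \<longlongrightarrow> Vl c h k (x (Suc k))) (at_left (x (Suc k)))"
  proof (rule Lim_transform_eventually)
    show "\<forall>\<^sub>F t in at_left (x (Suc k)). Vl c h k t = V c h t"
      using eventually_at_left_segment[of k] by eventually_elim (rule V_eq_Vl[OF h, symmetric]; simp)
  qed
  have "(Vl c h k \<longlongrightarrow> Vl c h k (x k)) (at_right (x k))"
    using cV x_less_Suc[of k] unfolding continuous_on_def at_right_segment[symmetric] by auto
  then have "(Vl c h k \<longlongrightarrow> V c h (x k)) (at_right (x k))" by (simp add: Vl_def)
  then show "(V c h \<longlongrightarrow> V c h (x k)) (at_right (x k))"
  proof (rule Lim_transform_eventually)
    show "\<forall>\<^sub>F t in at_right (x k). Vl c h k t = V c h t"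
      using eventually_at_right_segment[of k] by eventually_elim (rule V_eq_Vl[OF h, symmetric]; simp)
  qed
qed

lemma interface_condition_UV:
  assumes h: "loc_int h"
  shows "interface_condition (U c h) (V c h)"
  unfolding interface_condition_def
proof (intro allI impI)
  fix n :: nat assume "1 \<le> n"
  then obtain k where n: "n = Suc k" using Suc_le_D by auto
  show "\<exists>v p m. (U c h \<longlongrightarrow> v) (at_right (x n)) \<and> (U c h \<longlongrightarrow> v) (at_left (x n)) \<and>
      (V c h \<longlongrightarrow> p) (at_right (x n)) \<and> (V c h \<longlongrightarrow> m) (at_left (x n)) \<and> p - m = complex_of_real (\<alpha> n) * v"
    unfolding n
    by (rule exI[of _ "U c h (x (Suc k))"], rule exI[of _ "V c h (x (Suc k))"],
        rule exI[of _ "Vl c h k (x (Suc k))"]) (intro conjI UV_limits[OF h]; simp add: V_jump[OF h])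
qed

lemma affine_of_constant_derivative:
  fixes e e1 :: "real \<Rightarrow> complex"
  assumes S: "convex S" and t0: "t0 \<in> S"
    and der: "\<And>t. t \<in> S \<Longrightarrow> (e has_vector_derivative e1 t) (at t within S)"
    and const: "\<And>t. t \<in> S \<Longrightarrow> e1 t = c" and t: "t \<in> S"
  shows "e t = e t0 + c * complex_of_real (t - t0)"
proof -
  have "((\<lambda>t. e t - c * complex_of_real (t - t0)) has_vector_derivative 0) (at t within S)" if "t \<in> S" for t
  proof -
    have "((\<lambda>t. e t - c * complex_of_real (t - t0)) has_vector_derivative c - c * 1) (at t within S)"
      using der[OF that] const[OF that]
      by (auto intro!: derivative_eq_intros simp: has_vector_derivative_def scaleR_conv_of_real mult.commute)
    then show ?thesis by simp
  qed
  then obtain d where d: "\<And>t. t \<in> S \<Longrightarrow> e t - c * complex_of_real (t - t0) = d"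
    using has_vector_derivative_zero_constant[OF S] by blast
  from d[OF t] d[OF t0] show ?thesis by (simp add: algebra_simps)
qed

text \<open>The difference to \<open>U\<close> has constant derivative on each segment, hence is
  affine, and the interface condition carries zero data over to the next segment. On
  \<open>f1\<close> only increments are prescribed, because in \<open>W22\<close> it is
  differentiable just almost everywhere.\<close>

lemma solution_eq_UV:
  assumes h: "loc_int h" and f1_0: "f1 0 = 0"
    and der: "\<And>t. 0 \<le> t \<Longrightarrow> t \<notin> X \<Longrightarrow> (f has_vector_derivative f1 t) (at t within {0..})"
    and inc: "\<And>s t. 0 \<le> s \<Longrightarrow> s \<le> t \<Longrightarrow> {s..t} \<inter> X = {} \<Longrightarrow> f1 t - f1 s = - integral {s..t} h"
    and ic: "interface_condition f f1"
    and t: "0 \<le> t" "t \<notin> X"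
  shows "f t = U (f 0) h t" "f1 t = V (f 0) h t"
proof -
  define e where "e t = f t - U (f 0) h t" for t
  define e1 where "e1 t = f1 t - V (f 0) h t" for t
  \<comment> \<open>Grid points are left out, since \<open>f\<close> and \<open>f1\<close> are
    unrestricted on \<open>X\<close>; only the first segment keeps its left end 0, where the initial
    data sit.\<close>
  define S where "S k = (if k = 0 then {x k..<x (Suc k)} else {x k<..<x (Suc k)})" for k
  have S: "t \<in> S k \<longleftrightarrow> (x k < t \<or> k = 0 \<and> t = x k) \<and> t < x (Suc k)" for k t by (auto simp: S_def)
  have S0: "0 \<le> t" "t \<notin> X" if "t \<in> S k" for t k
  proof -
    show "0 \<le> t" using that x_nonneg[of k] by (auto simp: S)
    show "t \<notin> X" using that not_in_X[of k t] zero_not_in_X by (auto simp: S x_0)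
  qed
  have cS: "convex (S k)" for k by (simp add: S_def)
  have dere: "(e has_vector_derivative e1 t) (at t within S k)" if "t \<in> S k" for t k
  proof -
    have "(e has_vector_derivative e1 t) (at t within {0..})"
      unfolding e_def e1_def
      by (intro has_vector_derivative_diff der U_deriv h S0[OF that])
    then show ?thesis by (rule has_vector_derivative_within_subset) (use S0 in auto)
  qed
  have conste: "e1 t = e1 s" if "s \<in> S k" "t \<in> S k" "s \<le> t" for s t k
  proof -
    have "r \<in> S k" if "r \<in> {s..t}" for r
      using that \<open>s \<in> S k\<close> \<open>t \<in> S k\<close> by (auto simp: S)
    then have "{s..t} \<inter> X = {}" using S0(2) by blast
    then have "f1 t - f1 s = V (f 0) h t - V (f 0) h s"
      using inc[OF S0(1)[OF that(1)] that(3)] V_increment[OF h S0(1)[OF that(1)] that(3), of "f 0"] by metis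
    then show ?thesis unfolding e1_def by algebra
  qed
  have zero: "\<forall>t\<in>S k. e t = 0 \<and> e1 t = 0" for k
  proof (induction k)
    case 0
    have z: "0 \<in> S 0" using x_less_Suc[of 0] by (simp add: S x_0)
    have e10: "e1 t = 0" if "t \<in> S 0" for t
      using conste[OF z that S0(1)[OF that]] by (simp add: e1_def f1_0 V_0)
    then show ?case
      using affine_of_constant_derivative[OF cS z dere e10] by (simp add: e_def U_0)
  next
    case (Suc k)
    obtain v p m where lim: "(f \<longlongrightarrow> v) (at_right (x (Suc k)))" "(f \<longlongrightarrow> v) (at_left (x (Suc k)))"
        "(f1 \<longlongrightarrow> p) (at_right (x (Suc k)))" "(f1 \<longlongrightarrow> m) (at_left (x (Suc k)))"
        "p - m = complex_of_real (\<alpha> (Suc k)) * v"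
      using ic unfolding interface_condition_def by (metis le_add1 plus_1_eq_Suc)
    have ev: "\<forall>\<^sub>F t in at_left (x (Suc k)). t \<in> S k"
      using eventually_at_left_segment[of k] by eventually_elim (simp add: S)
    have "(f \<longlongrightarrow> U (f 0) h (x (Suc k))) (at_left (x (Suc k)))"
      by (rule Lim_transform_eventually[OF UV_limits(1)[OF h]])
         (use ev in eventually_elim, use Suc in \<open>auto simp: e_def\<close>)
    then have v: "v = U (f 0) h (x (Suc k))"
      using tendsto_unique[OF _ lim(2)] by (simp add: trivial_limit_at_left_real)
    have "(f1 \<longlongrightarrow> Vl (f 0) h k (x (Suc k))) (at_left (x (Suc k)))"
      by (rule Lim_transform_eventually[OF UV_limits(2)[OF h]])
         (use ev in eventually_elim, use Suc in \<open>auto simp: e1_def\<close>)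
    then have m: "m = Vl (f 0) h k (x (Suc k))"
      using tendsto_unique[OF _ lim(4)] by (simp add: trivial_limit_at_left_real)
    have p: "p = V (f 0) h (x (Suc k))"
      using lim(5) unfolding v m V_jump[OF h] by (simp add: algebra_simps)
    have e_lim: "(e \<longlongrightarrow> 0) (at_right (x (Suc k)))"
      using tendsto_diff[OF lim(1) UV_limits(3)[OF h, of "f 0" "Suc k"]] by (simp add: e_def[abs_def] v)
    have e1_lim: "(e1 \<longlongrightarrow> 0) (at_right (x (Suc k)))"
      using tendsto_diff[OF lim(3) UV_limits(4)[OF h, of "f 0" "Suc k"]] by (simp add: e1_def[abs_def] p)
    have evr: "\<forall>\<^sub>F t in at_right (x (Suc k)). t \<in> S (Suc k)"
      using eventually_at_right_segment[of "Suc k"] by eventually_elim (simp add: S)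
    \<comment> \<open>On the next segment only limits at its left end are known to be 0. They are
      compared with the constant values of \<open>e1\<close> and then of \<open>e\<close>, read off
      at an interior point.\<close>
    define t0 where "t0 = (x (Suc k) + x (Suc (Suc k))) / 2"
    have t0: "t0 \<in> S (Suc k)" using x_less_Suc[of "Suc k"] by (simp add: S t0_def)
    have cc: "e1 t = e1 t0" if "t \<in> S (Suc k)" for t
      using conste[OF that t0] conste[OF t0 that] by (cases "t \<le> t0") auto
    have "(e1 \<longlongrightarrow> e1 t0) (at_right (x (Suc k)))"
      by (rule Lim_transform_eventually[OF tendsto_const]) (use evr in eventually_elim, use cc in auto)
    then have e1t0: "e1 t0 = 0"
      using tendsto_unique[OF _ e1_lim] by (simp add: trivial_limit_at_right_real)
    have e1z: "e1 t = 0" if "t \<in> S (Suc k)" for t using cc[OF that] e1t0 by simp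
    have ec: "e t = e t0" if "t \<in> S (Suc k)" for t
      using affine_of_constant_derivative[OF cS t0 dere e1z that] by simp
    have "(e \<longlongrightarrow> e t0) (at_right (x (Suc k)))"
      by (rule Lim_transform_eventually[OF tendsto_const]) (use evr in eventually_elim, use ec in auto)
    then have "e t0 = 0"
      using tendsto_unique[OF _ e_lim] by (simp add: trivial_limit_at_right_real)
    then show ?case using ec e1z by auto
  qed
  have "t \<in> S (idx t)"
    using idx_bounds[OF t(1)] t(2) by (cases "idx t") (auto simp: S less_le)
  then have "e t = 0 \<and> e1 t = 0" using zero by blast
  then show "f t = U (f 0) h t" "f1 t = V (f 0) h t" by (simp_all add: e_def e1_def)
qed

end

section \<open>The minimal operator and its adjoint\<close>

lemma abs_continuous_on_add:
  assumes "abs_continuous_on a b f" "abs_continuous_on a b g"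
  shows "abs_continuous_on a b (\<lambda>t. f t + g t)"
  unfolding abs_continuous_on_def
proof (intro allI impI)
  fix e :: real assume e: "e > 0"
  obtain d1 where d1: "d1 > 0" "\<And>D. D division_of \<Union>D \<Longrightarrow> \<Union>D \<subseteq> {a..b} \<Longrightarrow>
      (\<Sum>K\<in>D. Sup K - Inf K) < d1 \<Longrightarrow> (\<Sum>K\<in>D. cmod (f (Sup K) - f (Inf K))) < e / 2"
    using assms(1)[unfolded abs_continuous_on_def, rule_format, OF half_gt_zero[OF e]] by auto
  obtain d2 where d2: "d2 > 0" "\<And>D. D division_of \<Union>D \<Longrightarrow> \<Union>D \<subseteq> {a..b} \<Longrightarrow>
      (\<Sum>K\<in>D. Sup K - Inf K) < d2 \<Longrightarrow> (\<Sum>K\<in>D. cmod (g (Sup K) - g (Inf K))) < e / 2"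
    using assms(2)[unfolded abs_continuous_on_def, rule_format, OF half_gt_zero[OF e]] by auto
  show "\<exists>\<delta>>0. \<forall>D. D division_of \<Union>D \<longrightarrow> \<Union>D \<subseteq> {a..b} \<longrightarrow> (\<Sum>K\<in>D. Sup K - Inf K) < \<delta> \<longrightarrow>
    (\<Sum>K\<in>D. cmod (f (Sup K) + g (Sup K) - (f (Inf K) + g (Inf K)))) < e"
  proof (intro exI[of _ "min d1 d2"] conjI allI impI)
    fix D assume D: "D division_of \<Union>D" "\<Union>D \<subseteq> {a..b}" "(\<Sum>K\<in>D. Sup K - Inf K) < min d1 d2"
    have "(\<Sum>K\<in>D. cmod (f (Sup K) + g (Sup K) - (f (Inf K) + g (Inf K))))
        \<le> (\<Sum>K\<in>D. cmod (f (Sup K) - f (Inf K)) + cmod (g (Sup K) - g (Inf K)))"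
      by (rule sum_mono) (unfold add_diff_add, rule norm_triangle_ineq)
    also have "\<dots> < e" using d1(2)[OF D(1,2)] d2(2)[OF D(1,2)] D(3) by (simp add: sum.distrib)
    finally show "(\<Sum>K\<in>D. cmod (f (Sup K) + g (Sup K) - (f (Inf K) + g (Inf K)))) < e" .
  qed (use d1(1) d2(1) in auto)
qed

lemma abs_continuous_on_cmult:
  assumes f: "abs_continuous_on a b f"
  shows "abs_continuous_on a b (\<lambda>t. c * f t)"
  unfolding abs_continuous_on_def
proof (intro allI impI)
  fix e :: real assume e: "e > 0"
  then have e': "e / (cmod c + 1) > 0" by (simp add: add_nonneg_pos)
  obtain d where d: "d > 0" "\<And>D. D division_of \<Union>D \<Longrightarrow> \<Union>D \<subseteq> {a..b} \<Longrightarrow> (\<Sum>K\<in>D. Sup K - Inf K) < d \<Longrightarrow>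
      (\<Sum>K\<in>D. cmod (f (Sup K) - f (Inf K))) < e / (cmod c + 1)"
    using f[unfolded abs_continuous_on_def, rule_format, OF e'] by auto
  show "\<exists>\<delta>>0. \<forall>D. D division_of \<Union>D \<longrightarrow> \<Union>D \<subseteq> {a..b} \<longrightarrow> (\<Sum>K\<in>D. Sup K - Inf K) < \<delta> \<longrightarrow>
    (\<Sum>K\<in>D. cmod (c * f (Sup K) - c * f (Inf K))) < e"
  proof (intro exI[of _ d] conjI allI impI)
    fix D assume D: "D division_of \<Union>D" "\<Union>D \<subseteq> {a..b}" "(\<Sum>K\<in>D. Sup K - Inf K) < d"
    have "(\<Sum>K\<in>D. cmod (c * f (Sup K) - c * f (Inf K))) = cmod c * (\<Sum>K\<in>D. cmod (f (Sup K) - f (Inf K)))"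
      by (simp add: sum_distrib_left norm_mult flip: right_diff_distrib)
    also have "\<dots> \<le> (cmod c + 1) * (\<Sum>K\<in>D. cmod (f (Sup K) - f (Inf K)))"
      by (intro mult_right_mono sum_nonneg) auto
    also have "\<dots> < (cmod c + 1) * (e / (cmod c + 1))"
      by (rule mult_strict_left_mono[OF d(2)[OF D]]) (simp add: add_nonneg_pos)
    also have "\<dots> = e"
    proof -
      have "cmod c + 1 \<noteq> 0" using norm_ge_zero[of c] by linarith
      then show ?thesis by simp
    qed
    finally show "(\<Sum>K\<in>D. cmod (c * f (Sup K) - c * f (Inf K))) < e" .
  qed (rule d)
qed

text \<open>Test functions enter \<open>W22\<close> through this criterion: within a segment
  \<open>U\<close> and \<open>V\<close> are integrals of bounded functions.\<close>

lemma abs_continuous_on_Lipschitz: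
  assumes L: "\<And>s t. a \<le> s \<Longrightarrow> s \<le> t \<Longrightarrow> t \<le> b \<Longrightarrow> cmod (f t - f s) \<le> L * (t - s)"
  shows "abs_continuous_on a b f"
  unfolding abs_continuous_on_def
proof (intro allI impI)
  fix e :: real assume e: "e > 0"
  show "\<exists>\<delta>>0. \<forall>D. D division_of \<Union>D \<longrightarrow> \<Union>D \<subseteq> {a..b} \<longrightarrow> (\<Sum>K\<in>D. Sup K - Inf K) < \<delta> \<longrightarrow>
    (\<Sum>K\<in>D. cmod (f (Sup K) - f (Inf K))) < e"
  proof (intro exI[of _ "e / (\<bar>L\<bar> + 1)"] conjI allI impI)
    fix D assume D: "D division_of \<Union>D" "\<Union>D \<subseteq> {a..b}" "(\<Sum>K\<in>D. Sup K - Inf K) < e / (\<bar>L\<bar> + 1)"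
    have K: "Sup K - Inf K \<ge> 0 \<and> cmod (f (Sup K) - f (Inf K)) \<le> (\<bar>L\<bar> + 1) * (Sup K - Inf K)" if KD: "K \<in> D" for K
    proof -
      obtain u v where K: "K = {u..v}" using division_ofD(4)[OF D(1) KD] by auto
      moreover have "K \<noteq> {}" using division_ofD(3)[OF D(1) KD] .
      moreover have "K \<subseteq> {a..b}" using D(2) KD by blast
      ultimately have uv: "u \<le> v" "a \<le> u" "v \<le> b" by auto
      have "cmod (f v - f u) \<le> L * (v - u)" using L uv by simp
      also have "\<dots> \<le> (\<bar>L\<bar> + 1) * (v - u)" using uv by (intro mult_right_mono) auto
      finally show ?thesis using uv K by simp
    qed
    have "(\<Sum>K\<in>D. cmod (f (Sup K) - f (Inf K))) \<le> (\<Sum>K\<in>D. (\<bar>L\<bar> + 1) * (Sup K - Inf K))"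
      by (rule sum_mono) (use K in blast)
    also have "\<dots> = (\<bar>L\<bar> + 1) * (\<Sum>K\<in>D. Sup K - Inf K)" by (simp add: sum_distrib_left)
    also have "\<dots> < (\<bar>L\<bar> + 1) * (e / (\<bar>L\<bar> + 1))"
      by (rule mult_strict_left_mono[OF D(3)]) simp
    also have "\<dots> = e" by simp
    finally show "(\<Sum>K\<in>D. cmod (f (Sup K) - f (Inf K))) < e" .
  qed (use e in \<open>simp add: add_nonneg_pos\<close>)
qed

lemma AE_leb_I_iff_negligible:
  "(AE t in leb_I. P t) \<longleftrightarrow> (\<exists>N. negligible N \<and> (\<forall>t\<ge>0. t \<notin> N \<longrightarrow> P t))"
proof -
  have "(AE t in leb_I. P t) \<longleftrightarrow> (AE t in lebesgue. t \<in> {0..} \<longrightarrow> P t)"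
    by (rule AE_restrict_space_iff) simp
  also have "\<dots> \<longleftrightarrow> (\<exists>N. negligible N \<and> {t. \<not> (t \<in> {0..} \<longrightarrow> P t)} \<subseteq> N)"
    by (simp add: eventually_ae_filter_negligible)
  also have "\<dots> \<longleftrightarrow> (\<exists>N. negligible N \<and> (\<forall>t\<ge>0. t \<notin> N \<longrightarrow> P t))" by auto
  finally show ?thesis .
qed

lemma integral_cong_AE_leb_I:
  assumes "AE t in leb_I. f t = g t" "0 \<le> a"
  shows "integral {a..b} f = integral {a..b} g"
proof -
  obtain N where "negligible N" "\<And>t. t \<ge> 0 \<Longrightarrow> t \<notin> N \<Longrightarrow> f t = g t"
    using assms(1) unfolding AE_leb_I_iff_negligible by blast
  then show ?thesis using assms(2) by (intro integral_spike[of N]) auto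
qed

lemma measurable_leb_I_subset: "f \<in> borel_measurable leb_I \<Longrightarrow> f \<in> borel_measurable (lebesgue_on {0..T})"
  by (rule measurable_restrict_mono[of f lebesgue "{0..}"]) auto

lemma sq_int_imp_loc_int:
  assumes f: "sq_int f"
  shows "loc_int f"
  unfolding loc_int_def
proof
  fix T
  have "(\<lambda>t. (cmod (f t))\<^sup>2) absolutely_integrable_on {0..}"
    using f by (simp add: sq_int_def absolutely_integrable_iff_integrable_lebesgue_on)
  then have "(\<lambda>t. (cmod (f t))\<^sup>2) absolutely_integrable_on {0..T}"
    by (rule absolutely_integrable_on_subinterval) auto
  then have i: "(\<lambda>t. 1 + (cmod (f t))\<^sup>2) integrable_on {0..T}"
    by (intro integrable_add) (auto simp: absolutely_integrable_on_def)
  show "f absolutely_integrable_on {0..T}"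
  proof (rule measurable_bounded_by_integrable_imp_absolutely_integrable[OF _ _ i])
    show "f \<in> borel_measurable (lebesgue_on {0..T})"
      using f by (intro measurable_leb_I_subset) (simp add: sq_int_def)
    have "cmod z \<le> 1 + (cmod z)\<^sup>2" for z
    proof -
      have "2 * cmod z \<le> (cmod z)\<^sup>2 + 1" using sum_squares_bound[of "cmod z" 1] by simp
      then show ?thesis using norm_ge_zero[of z] by linarith
    qed
    then show "norm (f t) \<le> 1 + (cmod (f t))\<^sup>2" for t .
  qed simp
qed

lemma loc_int_diff: "loc_int f \<Longrightarrow> loc_int g \<Longrightarrow> loc_int (\<lambda>t. f t - g t)"
  unfolding loc_int_def using set_integral_diff(1) by blast

lemma loc_int_cnj: "loc_int f \<Longrightarrow> loc_int (\<lambda>t. cnj (f t))"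
  unfolding loc_int_def
  using absolutely_integrable_linear[OF _ bounded_linear_cnj, where f = f] by (simp add: o_def)

text \<open>Both potentials satisfy this. It makes \<open>q f\<close> locally integrable for every
  locally integrable \<open>f\<close>, and square integrable for every \<open>f\<close> in L^2 with
  bounded support, before any continuity of \<open>f\<close> is known.\<close>

definition locally_bounded_potential :: "(real \<Rightarrow> real) \<Rightarrow> bool" where
  "locally_bounded_potential q \<longleftrightarrow> q \<in> borel_measurable leb_I \<and> (\<forall>T. \<exists>M. \<forall>t\<in>{0..T}. \<bar>q t\<bar> \<le> M)"

lemma loc_int_potential_mult:
  assumes q: "locally_bounded_potential q" and f: "loc_int f"
  shows "loc_int (\<lambda>t. complex_of_real (q t) * f t)"
  unfolding loc_int_def
proof
  fix T
  obtain M where M: "\<And>t. t \<in> {0..T} \<Longrightarrow> \<bar>q t\<bar> \<le> M" using q unfolding locally_bounded_potential_def by meson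
  have m: "(\<lambda>t. complex_of_real (q t)) \<in> borel_measurable (lebesgue_on {0..T})"
    using q unfolding locally_bounded_potential_def
    by (intro borel_measurable_of_real measurable_leb_I_subset) auto
  show "(\<lambda>t. complex_of_real (q t) * f t) absolutely_integrable_on {0..T}"
  proof (rule absolutely_integrable_bounded_measurable_product[OF bilinear_times m])
    show "bounded ((\<lambda>t. complex_of_real (q t)) ` {0..T})"
      unfolding bounded_iff using M by (intro exI[of _ M]) auto
  qed (use f in \<open>auto simp: loc_int_def\<close>)
qed

lemma sq_int_potential_mult:
  assumes q: "locally_bounded_potential q" and f: "sq_int f" and T: "AE t in leb_I. t > T \<longrightarrow> f t = 0"
  shows "sq_int (\<lambda>t. complex_of_real (q t) * f t)"
proof -
  obtain M where M: "\<And>t. t \<in> {0..T} \<Longrightarrow> \<bar>q t\<bar> \<le> M" using q unfolding locally_bounded_potential_def by meson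
  have qm[measurable]: "q \<in> borel_measurable leb_I" and [measurable]: "f \<in> borel_measurable leb_I"
    using q f by (auto simp: locally_bounded_potential_def sq_int_def)
  have i: "integrable leb_I (\<lambda>t. M\<^sup>2 * (cmod (f t))\<^sup>2)" using f by (auto simp: sq_int_def)
  have m: "(\<lambda>t. complex_of_real (q t) * f t) \<in> borel_measurable leb_I" by measurable
  have b: "AE t in leb_I. norm ((cmod (complex_of_real (q t) * f t))\<^sup>2) \<le> norm (M\<^sup>2 * (cmod (f t))\<^sup>2)"
    using T AE_space
  proof eventually_elim
    case (elim t)
    show ?case
    proof (cases "t > T")
      case True
      then show ?thesis using elim(1) by simp
    next
      case False
      then have "\<bar>q t\<bar> \<le> M" using M elim(2) by simp
      then have "\<bar>q t\<bar>\<^sup>2 \<le> M\<^sup>2" by (intro power_mono) auto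
      then show ?thesis by (simp add: norm_mult power_mult_distrib mult_right_mono)
    qed
  qed
  show ?thesis
    unfolding sq_int_def using m Bochner_Integration.integrable_bound[OF i _ b] by auto
qed

text \<open>Dominated convergence. It links the Lebesgue integrals in \<open>cinner\<close> to
  integrals over \<open>{0..T n}\<close>, to which \<open>green\<close> applies.\<close>

lemma tendsto_integral_leb_I:
  fixes F :: "real \<Rightarrow> complex"
  assumes F: "integrable leb_I F" and T: "filterlim T at_top sequentially"
  shows "(\<lambda>n. integral {0..T n} F) \<longlonglongrightarrow> integral\<^sup>L leb_I F"
proof -
  have ai: "F absolutely_integrable_on {0..}"
    using F by (simp add: absolutely_integrable_iff_integrable_lebesgue_on)
  have sub: "F integrable_on {0..r}" for r
    using absolutely_integrable_on_subinterval[OF ai, of 0 r] by (auto simp: absolutely_integrable_on_def)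
  have ri: "(\<lambda>t. if t \<in> {0..T n} then F t else 0) integrable_on {0..}" for n
  proof -
    have "{0..T n} \<inter> {0..} = {0..T n}" by auto
    then show ?thesis
      using sub[of "T n"] Henstock_Kurzweil_Integration.integrable_restrict_Int[of "{0..T n}" F "{0..}"] by metis
  qed
  have "(\<lambda>n. integral {0..} (\<lambda>t. if t \<in> {0..T n} then F t else 0)) \<longlonglongrightarrow> integral {0..} F"
  proof (rule dominated_convergence(2)[OF ri])
    show "(\<lambda>t. norm (F t)) integrable_on {0..}" using ai by (simp add: absolutely_integrable_on_def)
    show "(\<lambda>n. if t \<in> {0..T n} then F t else 0) \<longlonglongrightarrow> F t" if "t \<in> {0..}" for t
    proof (rule tendsto_eventually)
      have "\<forall>\<^sub>F n in sequentially. t \<le> T n" using T by (simp add: filterlim_at_top)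
      then show "\<forall>\<^sub>F n in sequentially. (if t \<in> {0..T n} then F t else 0) = F t"
        by eventually_elim (use that in auto)
    qed
  qed auto
  moreover have "integral {0..} (\<lambda>t. if t \<in> {0..T n} then F t else 0) = integral {0..T n} F" for n
  proof -
    have "{0..T n} \<inter> {0..} = {0..T n}" by auto
    then show ?thesis
      using Henstock_Kurzweil_Integration.integral_restrict_Int[of "{0..}" "{0..T n}" F] by metis
  qed
  ultimately show ?thesis using lebesgue_integral_eq_integral[OF F] by simp
qed

lemma continuous_AE_zero:
  fixes f :: "real \<Rightarrow> complex"
  assumes c: "continuous_on {0..} f" and z: "AE t in leb_I. f t = 0" and t: "0 \<le> t"
  shows "f t = 0"
proof (rule ccontr)
  assume nz: "f t \<noteq> 0"
  obtain N where N: "negligible N" "\<And>t. t \<ge> 0 \<Longrightarrow> t \<notin> N \<Longrightarrow> f t = 0"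
    using z unfolding AE_leb_I_iff_negligible by blast
  have "\<exists>d>0. \<forall>s\<in>{0..}. dist s t < d \<longrightarrow> dist (f s) (f t) < cmod (f t)"
    using c t nz unfolding continuous_on_iff by (metis atLeast_iff zero_less_norm_iff)
  then obtain d where d: "d > 0" "\<And>s. 0 \<le> s \<Longrightarrow> dist s t < d \<Longrightarrow> dist (f s) (f t) < cmod (f t)" by auto
  have "{t<..<t + d} \<subseteq> N"
  proof
    fix s assume s: "s \<in> {t<..<t + d}"
    then have "f s \<noteq> 0" using d(2)[of s] t by (auto simp: dist_real_def)
    then show "s \<in> N" using N(2)[of s] s t by auto
  qed
  then have "negligible {t<..<t + d}" using N(1) negligible_subset by blast
  then show False using d(1) open_not_negligible[of "{t<..<t + d}"] by auto
qed

lemma W22_add: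
  assumes f: "W22 S f f1 f2" and g: "W22 S g g1 g2"
  shows "W22 S (\<lambda>t. f t + g t) (\<lambda>t. f1 t + g1 t) (\<lambda>t. f2 t + g2 t)"
  unfolding W22_def
proof (intro conjI)
  show "AE t in leb_I. ((\<lambda>t. f1 t + g1 t) has_vector_derivative f2 t + g2 t) (at t within {0..})"
  proof -
    have "AE t in leb_I. (f1 has_vector_derivative f2 t) (at t within {0..})"
      "AE t in leb_I. (g1 has_vector_derivative g2 t) (at t within {0..})" using f g by (auto simp: W22_def)
    then show ?thesis by eventually_elim (rule has_vector_derivative_add)
  qed
qed (use f g in \<open>auto simp: W22_def AC_loc_def intro!: sq_int_add abs_continuous_on_add has_vector_derivative_add\<close>)

lemma W22_cmult:
  assumes f: "W22 S f f1 f2"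
  shows "W22 S (\<lambda>t. c * f t) (\<lambda>t. c * f1 t) (\<lambda>t. c * f2 t)"
  unfolding W22_def
proof (intro conjI)
  show "AE t in leb_I. ((\<lambda>t. c * f1 t) has_vector_derivative c * f2 t) (at t within {0..})"
  proof -
    have "AE t in leb_I. (f1 has_vector_derivative f2 t) (at t within {0..})" using f by (auto simp: W22_def)
    then show ?thesis by eventually_elim (rule has_vector_derivative_mult_right)
  qed
qed (use f in \<open>auto simp: W22_def AC_loc_def intro!: sq_int_scale abs_continuous_on_cmult has_vector_derivative_mult_right\<close>)

lemma W22_comp_iff_bounded:
  "W22_comp S f f1 f2 \<longleftrightarrow> W22 S f f1 f2 \<and> (\<exists>T. \<forall>t\<in>{0..} - S. t > T \<longrightarrow> f t = 0)"
proof -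
  have "compact (closure {t \<in> {0..} - S. f t \<noteq> 0}) \<longleftrightarrow> bounded {t \<in> {0..} - S. f t \<noteq> 0}"
    by (simp add: compact_closure)
  also have "\<dots> \<longleftrightarrow> (\<exists>T. \<forall>t\<in>{0..} - S. t > T \<longrightarrow> f t = 0)"
  proof
    assume "bounded {t \<in> {0..} - S. f t \<noteq> 0}"
    then obtain a where a: "\<And>t. t \<in> {t \<in> {0..} - S. f t \<noteq> 0} \<Longrightarrow> \<bar>t\<bar> \<le> a"
      unfolding bounded_real by blast
    have "f t = 0" if "t \<in> {0..} - S" "t > a" for t
      using a[of t] that by (rule_tac ccontr) auto
    then show "\<exists>T. \<forall>t\<in>{0..} - S. t > T \<longrightarrow> f t = 0" by blast
  next
    assume "\<exists>T. \<forall>t\<in>{0..} - S. t > T \<longrightarrow> f t = 0"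
    then obtain T where T: "\<And>t. t \<in> {0..} - S \<Longrightarrow> t > T \<Longrightarrow> f t = 0" by blast
    have "{t \<in> {0..} - S. f t \<noteq> 0} \<subseteq> {0..T}"
    proof
      fix t assume "t \<in> {t \<in> {0..} - S. f t \<noteq> 0}"
      then show "t \<in> {0..T}" using T[of t] by (cases "t > T") auto
    qed
    then show "bounded {t \<in> {0..} - S. f t \<noteq> 0}" using bounded_closed_interval bounded_subset by blast
  qed
  finally show ?thesis by (simp add: W22_comp_def)
qed

lemma W22_comp_add:
  assumes f: "W22_comp S f f1 f2" and g: "W22_comp S g g1 g2"
  shows "W22_comp S (\<lambda>t. f t + g t) (\<lambda>t. f1 t + g1 t) (\<lambda>t. f2 t + g2 t)"
proof -
  obtain T1 T2 where T: "\<forall>t\<in>{0..} - S. t > T1 \<longrightarrow> f t = 0" "\<forall>t\<in>{0..} - S. t > T2 \<longrightarrow> g t = 0"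
    using f g unfolding W22_comp_iff_bounded by blast
  then have "\<forall>t\<in>{0..} - S. t > max T1 T2 \<longrightarrow> f t + g t = 0" by simp
  then show ?thesis using f g W22_add unfolding W22_comp_iff_bounded by blast
qed

lemma W22_comp_cmult:
  assumes f: "W22_comp S f f1 f2"
  shows "W22_comp S (\<lambda>t. c * f t) (\<lambda>t. c * f1 t) (\<lambda>t. c * f2 t)"
proof -
  obtain T1 where T: "\<forall>t\<in>{0..} - S. t > T1 \<longrightarrow> f t = 0"
    using f unfolding W22_comp_iff_bounded by blast
  then have "\<forall>t\<in>{0..} - S. t > T1 \<longrightarrow> c * f t = 0" by simp
  then show ?thesis using f W22_cmult unfolding W22_comp_iff_bounded by blast
qed

text \<open>Absolute continuity of \<open>f1\<close> enters here. Up to the sign in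
  \<open>h = - f2\<close>, the result is the increment hypothesis of
  \<open>solution_eq_UV\<close>.\<close>

lemma W22_derivative_has_integral:
  assumes f: "W22 S f f1 f2" and st: "0 \<le> s" "s \<le> t" "{s..t} \<inter> S = {}"
  shows "(f2 has_integral f1 t - f1 s) {s..t}"
proof -
  obtain N where N: "negligible N" "\<And>r. r \<ge> 0 \<Longrightarrow> r \<notin> N \<Longrightarrow> (f1 has_vector_derivative f2 r) (at r within {0..})"
    using f unfolding W22_def AE_leb_I_iff_negligible by blast
  show ?thesis
  proof (rule abs_continuous_on_imp_has_integral[OF st(2) _ N(1)])
    have "{s..t} \<subseteq> {0..} - S" using st by auto
    then show "abs_continuous_on s t f1" using f st(2) by (auto simp: W22_def AC_loc_def)
    show "(f1 has_vector_derivative f2 r) (at r within {s..t})" if "r \<in> {s..t} - N" for r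
      by (rule has_vector_derivative_within_subset[OF N(2)]) (use that st in auto)
  qed
qed

section \<open>The minimal operator: linearity, and the form of its elements\<close>

context point_interactions begin

lemma negligible_X: "negligible X"
  unfolding negligible_iff_null_sets by (intro null_sets_completionI countable_imp_null_set_lborel) simp

lemma H_min_iff:
  "(F, G) \<in> H_min x \<alpha> q \<longleftrightarrow> (\<exists>f f1 f2. F = l2_of f \<and> G = l2_of (\<lambda>t. - f2 t + complex_of_real (q t) * f t)
    \<and> W22_comp X f f1 f2 \<and> f1 0 = 0 \<and> interface_condition f f1)"
  unfolding H_min_def interface_condition_def by blast

lemma interface_condition_add:
  assumes "interface_condition f f1" "interface_condition g g1"
  shows "interface_condition (\<lambda>t. f t + g t) (\<lambda>t. f1 t + g1 t)"
  unfolding interface_condition_def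
proof (intro allI impI)
  fix n :: nat assume n: "n \<ge> 1"
  obtain v p m where 1: "(f \<longlongrightarrow> v) (at_right (x n))" "(f \<longlongrightarrow> v) (at_left (x n))"
        "(f1 \<longlongrightarrow> p) (at_right (x n))" "(f1 \<longlongrightarrow> m) (at_left (x n))" "p - m = complex_of_real (\<alpha> n) * v"
    using assms(1) n unfolding interface_condition_def by blast
  obtain v' p' m' where 2: "(g \<longlongrightarrow> v') (at_right (x n))" "(g \<longlongrightarrow> v') (at_left (x n))"
        "(g1 \<longlongrightarrow> p') (at_right (x n))" "(g1 \<longlongrightarrow> m') (at_left (x n))" "p' - m' = complex_of_real (\<alpha> n) * v'"
    using assms(2) n unfolding interface_condition_def by blast
  have "(p + p') - (m + m') = complex_of_real (\<alpha> n) * (v + v')"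
    using 1(5) 2(5) by (simp add: algebra_simps)
  then show "\<exists>v p m. ((\<lambda>t. f t + g t) \<longlongrightarrow> v) (at_right (x n)) \<and> ((\<lambda>t. f t + g t) \<longlongrightarrow> v) (at_left (x n)) \<and>
      ((\<lambda>t. f1 t + g1 t) \<longlongrightarrow> p) (at_right (x n)) \<and> ((\<lambda>t. f1 t + g1 t) \<longlongrightarrow> m) (at_left (x n)) \<and>
      p - m = complex_of_real (\<alpha> n) * v"
    using tendsto_add[OF 1(1) 2(1)] tendsto_add[OF 1(2) 2(2)] tendsto_add[OF 1(3) 2(3)] tendsto_add[OF 1(4) 2(4)]
    by blast
qed

lemma interface_condition_cmult:
  assumes "interface_condition f f1"
  shows "interface_condition (\<lambda>t. c * f t) (\<lambda>t. c * f1 t)"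
  unfolding interface_condition_def
proof (intro allI impI)
  fix n :: nat assume n: "n \<ge> 1"
  obtain v p m where 1: "(f \<longlongrightarrow> v) (at_right (x n))" "(f \<longlongrightarrow> v) (at_left (x n))"
        "(f1 \<longlongrightarrow> p) (at_right (x n))" "(f1 \<longlongrightarrow> m) (at_left (x n))" "p - m = complex_of_real (\<alpha> n) * v"
    using assms(1) n unfolding interface_condition_def by blast
  have "c * p - c * m = c * (p - m)" by (simp add: algebra_simps)
  then have "c * p - c * m = complex_of_real (\<alpha> n) * (c * v)" unfolding 1(5) by simp
  then show "\<exists>v p m. ((\<lambda>t. c * f t) \<longlongrightarrow> v) (at_right (x n)) \<and> ((\<lambda>t. c * f t) \<longlongrightarrow> v) (at_left (x n)) \<and>
      ((\<lambda>t. c * f1 t) \<longlongrightarrow> p) (at_right (x n)) \<and> ((\<lambda>t. c * f1 t) \<longlongrightarrow> m) (at_left (x n)) \<and>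
      p - m = complex_of_real (\<alpha> n) * v"
    using tendsto_mult_left[OF 1(1)] tendsto_mult_left[OF 1(2)] tendsto_mult_left[OF 1(3)] tendsto_mult_left[OF 1(4)]
    by blast
qed

lemma sq_int_W22_comp:
  assumes q: "locally_bounded_potential q" and f: "W22_comp X f f1 f2"
  shows "sq_int f" "sq_int f2" "sq_int (\<lambda>t. - f2 t + complex_of_real (q t) * f t)"
    "\<exists>T. AE t in leb_I. t > T \<longrightarrow> f t = 0"
proof -
  show f': "sq_int f" "sq_int f2" using f by (auto simp: W22_comp_def W22_def)
  obtain T where "\<forall>t\<in>{0..} - X. t > T \<longrightarrow> f t = 0" using f unfolding W22_comp_iff_bounded by blast
  then have T: "AE t in leb_I. t > T \<longrightarrow> f t = 0"
    unfolding AE_leb_I_iff_negligible using negligible_X by auto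
  then show "\<exists>T. AE t in leb_I. t > T \<longrightarrow> f t = 0" by blast
  show "sq_int (\<lambda>t. - f2 t + complex_of_real (q t) * f t)"
    by (rule sq_int_add[OF sq_int_uminus[OF f'(2)] sq_int_potential_mult[OF q f'(1) T]])
qed

lemma linear_relation_H_min:
  assumes q: "locally_bounded_potential q"
  shows "complex_linear_relation (H_min x \<alpha> q)"
proof (rule complex_linear_relationI)
  have "W22 X (\<lambda>t. 0) (\<lambda>t. 0) (\<lambda>t. 0)"
    by (auto simp: W22_def sq_int_zero AC_loc_def intro!: abs_continuous_on_Lipschitz[of _ _ _ 0])
  then show "(0, 0) \<in> H_min x \<alpha> q"
    unfolding H_min_iff interface_condition_def W22_comp_iff_bounded zero_l2_of
    by (intro exI[of _ "\<lambda>t. 0"] conjI allI impI exI[of _ "0::complex"]) auto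
next
  fix u v u' v' assume "(u, v) \<in> H_min x \<alpha> q" "(u', v') \<in> H_min x \<alpha> q"
  then obtain f f1 f2 g g1 g2 where
    f: "u = l2_of f" "v = l2_of (\<lambda>t. - f2 t + complex_of_real (q t) * f t)" "W22_comp X f f1 f2" "f1 0 = 0" "interface_condition f f1"
    and g: "u' = l2_of g" "v' = l2_of (\<lambda>t. - g2 t + complex_of_real (q t) * g t)" "W22_comp X g g1 g2" "g1 0 = 0" "interface_condition g g1"
    unfolding H_min_iff by blast
  have "u + u' = l2_of (\<lambda>t. f t + g t)"
    unfolding f g using sq_int_W22_comp[OF q] f g by (intro l2_of_add) blast+
  moreover have "v + v' = l2_of (\<lambda>t. - (f2 t + g2 t) + complex_of_real (q t) * (f t + g t))"
  proof -
    have "v + v' = l2_of (\<lambda>t. (- f2 t + complex_of_real (q t) * f t) + (- g2 t + complex_of_real (q t) * g t))"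
      unfolding f g using sq_int_W22_comp(3)[OF q] f g by (intro l2_of_add) blast+
    then show ?thesis by (simp add: algebra_simps)
  qed
  ultimately show "(u + u', v + v') \<in> H_min x \<alpha> q"
    unfolding H_min_iff using W22_comp_add[OF f(3) g(3)] interface_condition_add[OF f(5) g(5)] f(4) g(4)
    by (intro exI[of _ "\<lambda>t. f t + g t"] exI[of _ "\<lambda>t. f1 t + g1 t"] exI[of _ "\<lambda>t. f2 t + g2 t"]) simp
next
  fix c u v assume "(u, v) \<in> H_min x \<alpha> q"
  then obtain f f1 f2 where
    f: "u = l2_of f" "v = l2_of (\<lambda>t. - f2 t + complex_of_real (q t) * f t)" "W22_comp X f f1 f2" "f1 0 = 0" "interface_condition f f1"
    unfolding H_min_iff by blast
  have "cscale c u = l2_of (\<lambda>t. c * f t)"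
    unfolding f using sq_int_W22_comp[OF q] f by (intro cscale_l2_of) blast+
  moreover have "cscale c v = l2_of (\<lambda>t. - (c * f2 t) + complex_of_real (q t) * (c * f t))"
  proof -
    have "cscale c v = l2_of (\<lambda>t. c * (- f2 t + complex_of_real (q t) * f t))"
      unfolding f using sq_int_W22_comp(3)[OF q] f by (intro cscale_l2_of) blast+
    then show ?thesis by (simp add: algebra_simps)
  qed
  ultimately show "(cscale c u, cscale c v) \<in> H_min x \<alpha> q"
    unfolding H_min_iff using W22_comp_cmult[OF f(3)] interface_condition_cmult[OF f(5)] f(4)
    by (intro exI[of _ "\<lambda>t. c * f t"] exI[of _ "\<lambda>t. c * f1 t"] exI[of _ "\<lambda>t. c * f2 t"]) simp
qed

lemma zero_UV_imp_zero_AB: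
  "U c h t = 0 \<Longrightarrow> V c h t = 0 \<Longrightarrow> A c h t = 0 \<and> B h t = 0"
  by (simp add: A_eq_UV B_eq_UV[of h t c])

text \<open>With \<open>h = - f2\<close>, uniqueness identifies \<open>f\<close> with
  \<open>U (f 0) h\<close> off \<open>X\<close>. Beyond the support both \<open>A\<close> and
  \<open>B\<close> vanish, which is what removes the boundary term in \<open>green\<close>.\<close>

lemma H_min_representation:
  assumes q: "locally_bounded_potential q" and FG: "(F, G) \<in> H_min x \<alpha> q"
  obtains c h T where "sq_int h" "sq_int (U c h)" "F = l2_of (U c h)"
    "sq_int (\<lambda>t. h t + complex_of_real (q t) * U c h t)"
    "G = l2_of (\<lambda>t. h t + complex_of_real (q t) * U c h t)"
    "\<And>t. t > T \<Longrightarrow> t \<notin> X \<Longrightarrow> A c h t = 0 \<and> B h t = 0" "T \<ge> 0"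
proof -
  obtain f f1 f2 where
    f: "F = l2_of f" "G = l2_of (\<lambda>t. - f2 t + complex_of_real (q t) * f t)" "W22_comp X f f1 f2" "f1 0 = 0" "interface_condition f f1"
    using FG unfolding H_min_iff by blast
  note sq = sq_int_W22_comp[OF q f(3)]
  define h where "h t = - f2 t" for t
  have hs: "sq_int h" unfolding h_def by (rule sq_int_uminus[OF sq(2)])
  have hl: "loc_int h" by (rule sq_int_imp_loc_int[OF hs])
  have W: "W22 X f f1 f2" using f(3) by (simp add: W22_comp_def)
  have eq: "f t = U (f 0) h t" "f1 t = V (f 0) h t" if "0 \<le> t" "t \<notin> X" for t
  proof -
    have der: "(f has_vector_derivative f1 r) (at r within {0..})" if "0 \<le> r" "r \<notin> X" for r
      using W that by (auto simp: W22_def)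
    have inc: "f1 r - f1 s = - integral {s..r} h" if "0 \<le> s" "s \<le> r" "{s..r} \<inter> X = {}" for s r
    proof -
      have "(h has_integral - (f1 r - f1 s)) {s..r}"
        unfolding h_def[abs_def] by (rule has_integral_neg[OF W22_derivative_has_integral[OF W that]])
      then show ?thesis by (simp add: integral_unique)
    qed
    show "f t = U (f 0) h t" "f1 t = V (f 0) h t"
      by (rule solution_eq_UV[OF hl f(4) der inc f(5) that]; assumption)+
  qed
  define u where "u = U (f 0) h"
  have ae: "AE t in leb_I. f t = u t"
    unfolding AE_leb_I_iff_negligible u_def using negligible_X eq(1) by blast
  have um: "u \<in> borel_measurable leb_I"
    unfolding u_def by (rule continuous_imp_measurable_on_sets_lebesgue[OF continuous_on_atLeast_0[OF continuous_on_U[OF hl]]]) simp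
  have us: "sq_int u"
    unfolding sq_int_def
  proof
    have "AE t in leb_I. (cmod (f t))\<^sup>2 = (cmod (u t))\<^sup>2" using ae by eventually_elim simp
    moreover have "(\<lambda>t. (cmod (f t))\<^sup>2) \<in> borel_measurable leb_I" "(\<lambda>t. (cmod (u t))\<^sup>2) \<in> borel_measurable leb_I"
    proof -
      have [measurable]: "f \<in> borel_measurable leb_I" "u \<in> borel_measurable leb_I"
        using um sq(1) by (auto simp: sq_int_def)
      show "(\<lambda>t. (cmod (f t))\<^sup>2) \<in> borel_measurable leb_I" "(\<lambda>t. (cmod (u t))\<^sup>2) \<in> borel_measurable leb_I"
        by measurable
    qed
    ultimately have "integrable leb_I (\<lambda>t. (cmod (f t))\<^sup>2) \<longleftrightarrow> integrable leb_I (\<lambda>t. (cmod (u t))\<^sup>2)"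
      by (intro integrable_cong_AE)
    then show "integrable leb_I (\<lambda>t. (cmod (u t))\<^sup>2)" using sq(1) by (simp add: sq_int_def)
  qed (rule um)
  obtain T where T: "\<And>t. t \<in> {0..} - X \<Longrightarrow> t > T \<Longrightarrow> f t = 0" using f(3) unfolding W22_comp_iff_bounded by blast
  have AB: "A (f 0) h t = 0 \<and> B h t = 0" if t: "t > max T 0" "t \<notin> X" for t
  proof (rule zero_UV_imp_zero_AB)
    have t0: "0 \<le> t" using t by simp
    show "U (f 0) h t = 0" using eq(1)[OF t0 t(2)] T[of t] t by simp
    define k where "k = idx t"
    have k: "x k \<le> t" "t < x (Suc k)" unfolding k_def by (rule idx_bounds[OF t0])+
    define b where "b = (t + x (Suc k)) / 2"
    have b: "t < b" "b < x (Suc k)" using k by (auto simp: b_def)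
    \<comment> \<open>From \<open>t\<close> up to \<open>b\<close>, before the next grid point,
      \<open>f\<close> vanishes; uniqueness of the one-sided derivative then gives
      \<open>f1 t = 0\<close>.\<close>
    have z: "f r = 0" if "r \<in> {t..b}" for r
    proof (cases "r = t")
      case True then show ?thesis using T[of t] t t0 by simp
    next
      case False
      then have "r \<notin> X" using that k b by (intro not_in_X[of k]) auto
      then show ?thesis using T[of r] that t by auto
    qed
    have "(f has_vector_derivative f1 t) (at t within {t..b})"
      using W t0 t(2) by (auto simp: W22_def intro: has_vector_derivative_within_subset)
    moreover have "(f has_vector_derivative 0) (at t within {t..b})"
      by (rule has_vector_derivative_transform[of _ _ _ "\<lambda>_. 0"]) (use b z in auto)
    ultimately have "f1 t = 0"
      using vector_derivative_unique_within_closed_interval[of t b t f] b by auto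
    then show "V (f 0) h t = 0" using eq(2)[OF t0 t(2)] by simp
  qed
  have ae2: "AE t in leb_I. - f2 t + complex_of_real (q t) * f t = h t + complex_of_real (q t) * u t"
    using ae by eventually_elim (simp add: h_def)
  have "AE t in leb_I. t > T \<longrightarrow> u t = 0"
    unfolding AE_leb_I_iff_negligible
  proof (intro exI[of _ X] conjI allI impI)
    fix t assume "0 \<le> t" "t \<notin> X" "T < t"
    then show "u t = 0" using eq(1)[of t] T[of t] by (simp add: u_def)
  qed (rule negligible_X)
  then have gs: "sq_int (\<lambda>t. h t + complex_of_real (q t) * u t)"
    by (intro sq_int_add hs sq_int_potential_mult[OF q us])
  show thesis
  proof (rule that[of h "f 0" "max T 0"])
    show "F = l2_of (U (f 0) h)"
      using ae l2_of_eq_iff[OF sq(1) us] f(1) by (simp add: u_def)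
    show "G = l2_of (\<lambda>t. h t + complex_of_real (q t) * U (f 0) h t)"
      using ae2 l2_of_eq_iff[OF sq(3) gs] f(2) by (simp add: u_def)
  qed (use hs us gs AB in \<open>auto simp: u_def\<close>)
qed

end

lemma sq_int_cong_AE:
  assumes f: "sq_int f" and g: "g \<in> borel_measurable leb_I" and ae: "AE t in leb_I. f t = g t"
  shows "sq_int g"
proof -
  have [measurable]: "f \<in> borel_measurable leb_I" "g \<in> borel_measurable leb_I"
    using f g by (auto simp: sq_int_def)
  have "AE t in leb_I. (cmod (f t))\<^sup>2 = (cmod (g t))\<^sup>2" using ae by eventually_elim simp
  then have "integrable leb_I (\<lambda>t. (cmod (f t))\<^sup>2) \<longleftrightarrow> integrable leb_I (\<lambda>t. (cmod (g t))\<^sup>2)"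
    by (intro integrable_cong_AE) measurable
  then show ?thesis using f g by (simp add: sq_int_def)
qed

lemma sq_int_bounded_support:
  assumes f: "f \<in> borel_measurable leb_I" and b: "\<And>t. 0 \<le> t \<Longrightarrow> t \<le> T \<Longrightarrow> cmod (f t) \<le> M"
    and z: "\<And>t. 0 \<le> t \<Longrightarrow> t > T \<Longrightarrow> f t = 0"
  shows "sq_int f"
  unfolding sq_int_def
proof
  have "(\<lambda>t. M\<^sup>2) absolutely_integrable_on {0..T}"
    by (rule absolutely_integrable_continuous_real) (rule continuous_on_const)
  then have "(\<lambda>t. indicator {0..T} t *\<^sub>R M\<^sup>2) absolutely_integrable_on UNIV"
    by (simp add: set_integrable_def)
  then have "(\<lambda>t. indicator {0..T} t *\<^sub>R M\<^sup>2) absolutely_integrable_on {0..}"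
    by (rule set_integrable_subset) auto
  then have i: "integrable leb_I (\<lambda>t. indicator {0..T} t *\<^sub>R M\<^sup>2)"
    by (simp add: absolutely_integrable_iff_integrable_lebesgue_on)
  note [measurable] = f
  show "integrable leb_I (\<lambda>t. (cmod (f t))\<^sup>2)"
  proof (rule Bochner_Integration.integrable_bound[OF i])
    show "AE t in leb_I. norm ((cmod (f t))\<^sup>2) \<le> norm (indicator {0..T} t *\<^sub>R M\<^sup>2)"
      using AE_space
    proof eventually_elim
      case (elim t)
      then have "0 \<le> t" by simp
      then show ?case using b[of t] z[of t] by (cases "t \<le> T") (auto intro: power_mono)
    qed
  qed measurable
qed (rule f)

context point_interactions begin

lemma measurable_U: "loc_int h \<Longrightarrow> U c h \<in> borel_measurable leb_I"
  by (rule continuous_imp_measurable_on_sets_lebesgue[OF continuous_on_atLeast_0[OF continuous_on_U]]) auto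

lemma U_cong_AE:
  assumes "AE t in leb_I. h t = k t"
  shows "U c h = U c k"
proof
  fix t
  have "AE t in leb_I. complex_of_real (lin_sol y p t) * h t = complex_of_real (lin_sol y p t) * k t" for y p
    using assms by eventually_elim simp
  then have "integral {0..t} (\<lambda>s. complex_of_real (lin_sol y p s) * h s) = integral {0..t} (\<lambda>s. complex_of_real (lin_sol y p s) * k s)" for y p
    by (rule integral_cong_AE_leb_I) simp
  then show "U c h t = U c k t" by (simp add: U_def A_def B_def)
qed

text \<open>Midpoints provide cut-off points that tend to infinity and avoid \<open>X\<close>, where
  the vanishing of \<open>A\<close> and \<open>B\<close> in \<open>H_min_representation\<close> is
  not asserted.\<close>

definition mid :: "nat \<Rightarrow> real" where "mid n = (x n + x (Suc n)) / 2"

lemma mid_bounds: "x n < mid n" "mid n < x (Suc n)"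
  using x_less_Suc[of n] by (auto simp: mid_def)

lemma mid_not_in_X: "mid n \<notin> X"
  by (rule not_in_X[OF mid_bounds])

lemma mid_nonneg: "0 \<le> mid n"
  using mid_bounds(1)[of n] x_nonneg[of n] by simp

lemma mid_at_top: "filterlim mid at_top sequentially"
  by (rule filterlim_at_top_mono[OF x_at_top]) (simp add: mid_bounds less_imp_le)

text \<open>Green's formula has no boundary term at infinity when one function has compact support.\<close>

lemma adjoint_op_H_minI:
  assumes q: "locally_bounded_potential q" and w: "sq_int w" and v: "sq_int v"
    and wv: "AE t in leb_I. w t = U c (\<lambda>t. v t - complex_of_real (q t) * w t) t"
  shows "(l2_of w, l2_of v) \<in> adjoint_op (H_min x \<alpha> q)"
proof -
  \<comment> \<open>\<open>green\<close> is bilinear, whereas \<open>cinner\<close> conjugates its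
    second argument. As \<open>\<theta>\<close> and \<open>\<phi>\<close> are real, \<open>U\<close>
    commutes with \<open>cnj\<close>, so the conjugated source serves as second function.\<close>
  define k where "k t = cnj (v t - complex_of_real (q t) * w t)" for t
  have k: "loc_int k"
    unfolding k_def[abs_def]
    by (intro loc_int_cnj loc_int_diff loc_int_potential_mult[OF q] sq_int_imp_loc_int w v)
  have wk: "AE t in leb_I. cnj (w t) = U (cnj c) k t"
    using wv by eventually_elim (simp add: k_def[abs_def] U_cnj flip: complex_cnj_diff)
  have "cinner G (l2_of w) = cinner F (l2_of v)" if FG: "(F, G) \<in> H_min x \<alpha> q" for F G
  proof -
    obtain d h T where hs: "sq_int h" and us: "sq_int (U d h)" and F: "F = l2_of (U d h)"
      and gs: "sq_int (\<lambda>t. h t + complex_of_real (q t) * U d h t)"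
      and G: "G = l2_of (\<lambda>t. h t + complex_of_real (q t) * U d h t)"
      and AB: "\<And>t. t > T \<Longrightarrow> t \<notin> X \<Longrightarrow> A d h t = 0 \<and> B h t = 0"
      by (rule H_min_representation[OF q FG]) blast
    have h: "loc_int h" by (rule sq_int_imp_loc_int[OF hs])
    define K where "K t = (h t + complex_of_real (q t) * U d h t) * cnj (w t) - U d h t * cnj (v t)" for t
    have i1: "integrable leb_I (\<lambda>t. (h t + complex_of_real (q t) * U d h t) * cnj (w t))"
      and i2: "integrable leb_I (\<lambda>t. U d h t * cnj (v t))"
      by (intro sq_int_mult_cnj gs us w v)+
    have Ki: "integrable leb_I K" unfolding K_def[abs_def] by (rule Bochner_Integration.integrable_diff[OF i1 i2])
    have KK: "AE t in leb_I. K t = h t * U (cnj c) k t - k t * U d h t"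
      using wk by eventually_elim (simp add: K_def k_def algebra_simps)
    have "\<forall>\<^sub>F n in sequentially. integral {0..mid n} K = 0"
    proof -
      have "\<forall>\<^sub>F n in sequentially. T < mid n" using mid_at_top by (simp add: filterlim_at_top_dense)
      then show ?thesis
      proof eventually_elim
        case (elim n)
        have "integral {0..mid n} K = integral {0..mid n} (\<lambda>t. h t * U (cnj c) k t - k t * U d h t)"
          by (rule integral_cong_AE_leb_I[OF KK order_refl])
        also have "\<dots> = 0"
          unfolding green(2)[OF h k mid_nonneg] using AB[OF elim mid_not_in_X] by simp
        finally show ?case .
      qed
    qed
    then have "(\<lambda>n. integral {0..mid n} K) \<longlonglongrightarrow> 0" by (rule tendsto_eventually)
    then have "integral\<^sup>L leb_I K = 0"
      using LIMSEQ_unique tendsto_integral_leb_I[OF Ki mid_at_top] by blast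
    then have "(\<integral>t. (h t + complex_of_real (q t) * U d h t) * cnj (w t) \<partial>leb_I) - (\<integral>t. U d h t * cnj (v t) \<partial>leb_I) = 0"
      unfolding K_def[abs_def] using i1 i2 by simp
    then show ?thesis unfolding F G cinner_l2_of[OF gs w] cinner_l2_of[OF us v] by simp
  qed
  then show ?thesis by (auto simp: adjoint_op_def)
qed

text \<open>A source \<open>g\<close> supported in \<open>{0..b}\<close> gives \<open>U c g\<close>
  of compact support once \<open>A c g\<close> and \<open>B g\<close> vanish beyond
  \<open>b\<close>: the first condition fixes \<open>c\<close>, the second is orthogonality of
  \<open>g\<close> to \<open>\<theta>\<close>. The finitely many discontinuities of \<open>g\<close>
  form a null set, so \<open>- g\<close> is a second derivative almost everywhere.\<close>

lemma H_min_test_function: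
  fixes g :: "real \<Rightarrow> complex"
  assumes g: "g \<in> borel_measurable leb_I" and M: "\<And>t. cmod (g t) \<le> M"
    and E: "finite E" and cont: "\<And>t. t \<notin> E \<Longrightarrow> isCont g t"
    and supp: "\<And>t. t > b \<Longrightarrow> g t = 0" and b: "0 \<le> b"
    and A0: "\<And>t. t \<ge> b \<Longrightarrow> A c g t = 0" and B0: "\<And>t. t \<ge> b \<Longrightarrow> B g t = 0"
  shows "sq_int g" "sq_int (U c g)"
    "(l2_of (U c g), l2_of (\<lambda>t. g t + complex_of_real (q t) * U c g t)) \<in> H_min x \<alpha> q"
proof -
  show gs: "sq_int g" by (rule sq_int_bounded_support[OF g, of b M]) (use M supp in auto)
  have gl: "loc_int g" by (rule sq_int_imp_loc_int[OF gs])
  have Uz: "U c g t = 0" if "t \<ge> b" for t using A0[OF that] B0[OF that] by (simp add: U_def)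
  have "bounded (U c g ` {0..b})"
    by (intro compact_imp_bounded compact_continuous_image continuous_on_U[OF gl]) simp
  then obtain C where C: "\<And>t. t \<in> {0..b} \<Longrightarrow> cmod (U c g t) \<le> C" unfolding bounded_iff by blast
  show us: "sq_int (U c g)"
    by (rule sq_int_bounded_support[OF measurable_U[OF gl], where T = b and M = C]) (use C Uz in auto)
  have acU: "AC_loc ({0..} - X) (U c g)"
    unfolding AC_loc_def
  proof (intro allI impI)
    fix a a' assume a: "a \<le> a'" "{a..a'} \<subseteq> {0..} - X"
    have a0: "0 \<le> a" "{a..a'} \<inter> X = {}" using a by auto
    define k where "k = idx a"
    have k: "{a..a'} \<subseteq> {x k..<x (Suc k)}"
      using idx_bounds(1)[OF a0(1)] idx_bounds(2)[OF order_trans[OF a0(1) a(1)]] same_segment[OF a0(1) a(1) a0(2)]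
      by (auto simp: k_def)
    have cV: "continuous_on {x k..x (Suc k)} (Vl c g k)" by (rule continuous_on_Vl[OF gl])
    then have "bounded (Vl c g k ` {x k..x (Suc k)})" by (intro compact_imp_bounded compact_continuous_image compact_Icc)
    then obtain L where L: "\<And>t. t \<in> {x k..x (Suc k)} \<Longrightarrow> cmod (Vl c g k t) \<le> L" unfolding bounded_iff by blast
    show "abs_continuous_on a a' (U c g)"
    proof (rule abs_continuous_on_Lipschitz[of _ _ _ L])
      fix s t assume st: "a \<le> s" "s \<le> t" "t \<le> a'"
      then have in_k: "s \<in> {x k..<x (Suc k)}" "t \<in> {x k..<x (Suc k)}" using k by (meson atLeastAtMost_iff order_trans subsetD)+
      then have s: "x k \<le> s" "s \<le> x (Suc k)" and t: "x k \<le> t" "t \<le> x (Suc k)" by auto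
      have Vi: "Vl c g k absolutely_integrable_on {x k..t}"
        by (rule absolutely_integrable_continuous_real[OF continuous_on_Vl[OF gl]])
      have "U c g t - U c g s = integral {s..t} (Vl c g k)"
        using U_eq_integral_Vl[OF gl s, of c] U_eq_integral_Vl[OF gl t, of c] integral_combine_abs[OF Vi s(1) st(2)]
        by simp
      also have "cmod \<dots> \<le> L * (t - s)"
      proof (rule integral_bound[OF st(2)])
        show "continuous_on {s..t} (Vl c g k)" using cV by (rule continuous_on_subset) (use s t in auto)
        show "norm (Vl c g k r) \<le> L" if "r \<in> {s..t}" for r using L[of r] that s t by auto
      qed
      finally show "cmod (U c g t - U c g s) \<le> L * (t - s)" .
    qed
  qed
  have acV: "AC_loc ({0..} - X) (V c g)"
    unfolding AC_loc_def
  proof (intro allI impI)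
    fix a a' assume a: "a \<le> a'" "{a..a'} \<subseteq> {0..} - X"
    show "abs_continuous_on a a' (V c g)"
    proof (rule abs_continuous_on_Lipschitz[of _ _ _ M])
      fix s t assume st: "a \<le> s" "s \<le> t" "t \<le> a'"
      have "s \<in> {a..a'}" "{s..t} \<subseteq> {a..a'}" using st by auto
      then have "s \<in> {0..} - X" and disj: "{s..t} \<inter> X = {}" using a(2) by blast+
      then have s0: "0 \<le> s" by simp
      have gi: "g integrable_on {s..t}" using loc_intD[OF gl s0] by (simp add: absolutely_integrable_on_def)
      have "cmod (V c g t - V c g s) = cmod (integral {s..t} g)"
        unfolding V_increment[OF gl s0 st(2) disj] by simp
      also have "\<dots> \<le> integral {s..t} (\<lambda>_. M)"
        by (rule integral_norm_bound_integral[OF gi]) (use M in auto)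
      also have "\<dots> = M * (t - s)" using st by simp
      finally show "cmod (V c g t - V c g s) \<le> M * (t - s)" .
    qed
  qed
  have dV: "AE t in leb_I. (V c g has_vector_derivative - g t) (at t within {0..})"
    unfolding AE_leb_I_iff_negligible
  proof (intro exI[of _ "X \<union> E \<union> {0}"] conjI allI impI)
    show "negligible (X \<union> E \<union> {0})" using negligible_X E by (intro negligible_Un) auto
    fix t :: real assume t: "0 \<le> t" "t \<notin> X \<union> E \<union> {0}"
    define k where "k = idx t"
    have k: "x k \<le> t" "t < x (Suc k)" unfolding k_def by (rule idx_bounds[OF t(1)])+
    have "x k \<noteq> t" using t x_0 by (cases k) auto
    then have k': "x k < t" using k by simp
    have gi: "g integrable_on {x k..x (Suc k)}"
      using loc_intD[OF gl x_nonneg] by (simp add: absolutely_integrable_on_def)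
    have "((\<lambda>u. integral {x k..u} g) has_vector_derivative g t) (at t within {x k..x (Suc k)})"
      using integral_has_vector_derivative_continuous_at[OF gi, of t "{}"] k cont[of t] t
      by (simp add: continuous_at_imp_continuous_at_within)
    then have "(Vl c g k has_vector_derivative 0 - g t) (at t within {x k..x (Suc k)})"
      unfolding Vl_def[abs_def] by (intro has_vector_derivative_diff has_vector_derivative_const)
    then have "(Vl c g k has_vector_derivative - g t) (at t)"
      using at_within_Icc_at[OF k' k(2)] by simp
    then have "(V c g has_vector_derivative - g t) (at t)"
    proof (rule has_vector_derivative_transform_within_open[of _ _ _ "{x k<..<x (Suc k)}"])
      show "Vl c g k r = V c g r" if "r \<in> {x k<..<x (Suc k)}" for r
        using V_eq_Vl[OF gl, of k r c] that by simp
    qed (use k k' in auto)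
    then show "(V c g has_vector_derivative - g t) (at t within {0..})"
      by (rule has_vector_derivative_at_within)
  qed
  have W: "W22 X (U c g) (V c g) (\<lambda>t. - g t)"
    unfolding W22_def using us acU acV dV sq_int_uminus[OF gs] U_deriv[OF gl] by auto
  have "W22_comp X (U c g) (V c g) (\<lambda>t. - g t)"
    unfolding W22_comp_iff_bounded using W Uz by (auto intro!: exI[of _ b])
  then show "(l2_of (U c g), l2_of (\<lambda>t. g t + complex_of_real (q t) * U c g t)) \<in> H_min x \<alpha> q"
    unfolding H_min_iff using V_0 interface_condition_UV[OF gl]
    by (intro exI[of _ "U c g"] exI[of _ "V c g"] exI[of _ "\<lambda>t. - g t"]) simp
qed

end

section \<open>The adjoint of the minimal operator\<close>

context point_interactions begin

lemma U_add_const: "U c h t = c * \<theta> t + U 0 h t"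
  by (simp add: U_def A_def algebra_simps)

lemma lin_sol_first_segment: "0 \<le> t \<Longrightarrow> t \<le> x 1 \<Longrightarrow> lin_sol 1 0 t = 1"
  using lin_sol_segment[of 0 t 1 0] by (simp add: x_0)

lemma integral_two_steps:
  fixes f :: "real \<Rightarrow> complex"
  assumes f: "loc_int f" and st: "0 \<le> s" "s \<le> t" "t \<le> T" and d: "0 \<le> d" "d \<le> T"
  shows "integral {0..T} (\<lambda>r. (indicator {s..t} r - \<kappa> * indicator {0..d} r) * f r)
    = integral {s..t} f - \<kappa> * integral {0..d} f"
proof -
  have i: "((\<lambda>r. if r \<in> {a..b} then f r else 0) has_integral integral {a..b} f) {0..T}" if "0 \<le> a" "b \<le> T" for a b
  proof -
    have "f integrable_on {a..b}" using loc_intD[OF f that(1)] by (simp add: absolutely_integrable_on_def)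
    moreover have "{a..b} \<subseteq> {0..T}" using that by auto
    ultimately show ?thesis by (subst has_integral_restrict) (auto intro: integrable_integral)
  qed
  have eq: "(indicator {s..t} r - \<kappa> * indicator {0..d} r) * f r
     = (if r \<in> {s..t} then f r else 0) - \<kappa> * (if r \<in> {0..d} then f r else 0)" for r
    by (auto simp: indicator_def algebra_simps)
  show ?thesis
    unfolding eq
    by (rule integral_unique[OF has_integral_diff[OF i[OF st(1,3)] has_integral_mult_right[OF i[OF order_refl d(2)]]]])
qed

text \<open>
  Testing with functions whose second derivative is a combination of two indicator functions shows
  that \<open>u - U 0 (v - q u)\<close> has the same means over all intervals as a multiple of \<open>\<theta>\<close>.
\<close>

lemma adjoint_op_H_min_representation:
  assumes q: "locally_bounded_potential q" and u: "sq_int u" and v: "sq_int v"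
    and uv: "(l2_of u, l2_of v) \<in> adjoint_op (H_min x \<alpha> q)"
  obtains c where "AE t in leb_I. u t = U c (\<lambda>t. v t - complex_of_real (q t) * u t) t"
proof -
  define k where "k t = v t - complex_of_real (q t) * u t" for t
  have k: "loc_int k"
    unfolding k_def[abs_def] by (intro loc_int_diff loc_int_potential_mult[OF q] sq_int_imp_loc_int u v)
  define k' where "k' t = cnj (k t)" for t
  have k': "loc_int k'" unfolding k'_def[abs_def] by (rule loc_int_cnj[OF k])
  define w where "w = U 0 k'"
  have wl: "loc_int w"
    unfolding loc_int_def w_def by (intro allI absolutely_integrable_continuous_real continuous_on_U[OF k'])
  define e where "e t = cnj (u t) - w t" for t
  have el: "loc_int e"
    unfolding e_def[abs_def] by (intro loc_int_diff loc_int_cnj sq_int_imp_loc_int[OF u] wl)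
  \<comment> \<open>\<open>\<theta>\<close> is 1 on the first segment, so its integral over
    \<open>{0..d}\<close> is \<open>d\<close>, which is not 0 and can be divided by.\<close>
  define d where "d = x 1"
  have d: "0 < d" using x_less[of 0 1] by (simp add: d_def x_0)
  have one: "loc_int (\<lambda>t. 1)"
    unfolding loc_int_def by (intro allI absolutely_integrable_continuous_real continuous_on_const)
  have \<theta>l: "loc_int \<theta>" and \<phi>l: "loc_int \<phi>" 
    using loc_int_lin_sol[OF one] by simp_all
  have \<theta>d: "integral {0..d} \<theta> = d"
  proof -
    have "integral {0..d} \<theta> = integral {0..d} (\<lambda>t. 1)"
      by (rule integral_cong) (simp add: lin_sol_first_segment d_def)
    then show ?thesis using d by (simp add: scaleR_conv_of_real)
  qed
  define C where "C = integral {0..d} e / d"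
  have means: "integral {s..t} e = C * integral {s..t} \<theta>" if st: "0 \<le> s" "s \<le> t" for s t
  proof -
    \<comment> \<open>This choice makes \<open>g\<close> orthogonal to \<open>\<theta>\<close>, so
      that \<open>B g\<close> vanishes beyond \<open>b\<close>; \<open>c\<close> below achieves the
      same for \<open>A c g\<close>.\<close>
    define \<kappa> where "\<kappa> = integral {s..t} \<theta> / d"
    define g :: "real \<Rightarrow> complex" where "g r = indicator {s..t} r - \<kappa> * indicator {0..d} r" for r
    define b where "b = max t d"
    have b: "0 \<le> b" "t \<le> b" "d \<le> b" using st by (auto simp: b_def)
    have gz: "g r = 0" if "r > b" for r using that b by (auto simp: g_def)
    have gm: "g \<in> borel_measurable leb_I"
    proof -
      have "g \<in> borel_measurable borel" unfolding g_def[abs_def] by measurable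
      then show ?thesis by (intro measurable_restrict_space1 measurable_completion) simp
    qed
    have int_g: "integral {0..T} (\<lambda>r. g r * f r) = integral {s..t} f - \<kappa> * integral {0..d} f"
      if "b \<le> T" "loc_int f" for T f
      unfolding g_def by (rule integral_two_steps[OF that(2) st]) (use that b d in auto)
    have swap: "(\<lambda>r. f r * g r) = (\<lambda>r. g r * f r)" for f by (simp add: mult.commute)
    define c where "c = - (integral {s..t} \<phi> - \<kappa> * integral {0..d} \<phi>)"
    have A0: "A c g T = 0" if "b \<le> T" for T
      unfolding A_def swap int_g[OF that \<phi>l] by (simp add: c_def)
    have B0: "B g T = 0" if "b \<le> T" for T
      unfolding B_def swap int_g[OF that \<theta>l] \<theta>d using d by (simp add: \<kappa>_def)
    have M: "cmod (g r) \<le> 1 + cmod \<kappa>" for r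
      unfolding g_def by (rule order_trans[OF norm_triangle_ineq4]) (auto simp: norm_mult indicator_def)
    have cont: "isCont g r" if "r \<notin> {s, t, 0, d}" for r
    proof -
      have "isCont (\<lambda>r. indicator {a..b} r :: complex) r" if "r \<noteq> a" "r \<noteq> b" for a b
      proof -
        have "r \<notin> frontier {a..b}" using that by (cases "a \<le> b") (auto simp: frontier_def)
        then have "isCont (indicat_real {a..b}) r" by (simp add: isCont_indicator)
        then have "isCont (\<lambda>r. complex_of_real (indicat_real {a..b} r)) r" by (rule isCont_of_real)
        then show ?thesis by (simp add: of_real_indicator)
      qed
      then show ?thesis unfolding g_def[abs_def] using that by (intro continuous_intros) auto
    qed
    have "finite {s, t, 0, d}" by simp
    note tf = H_min_test_function[OF gm M this cont gz b(1) A0 B0]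
    have gs: "sq_int g" by (rule tf(1))
    have us: "sq_int (U c g)" by (rule tf(2))
    have mem: "(l2_of (U c g), l2_of (\<lambda>t. g t + complex_of_real (q t) * U c g t)) \<in> H_min x \<alpha> q"
      by (rule tf(3))
    have gl: "loc_int g" by (rule sq_int_imp_loc_int[OF gs])
    have Uz: "U c g r = 0" if "r \<ge> b" for r using A0[OF that] B0[OF that] by (simp add: U_def)
    have hs: "sq_int (\<lambda>t. g t + complex_of_real (q t) * U c g t)"
      by (intro sq_int_add gs sq_int_potential_mult[OF q us, of b]) (auto simp: Uz)
    have "cinner (l2_of (\<lambda>t. g t + complex_of_real (q t) * U c g t)) (l2_of u) = cinner (l2_of (U c g)) (l2_of v)"
      using uv mem by (auto simp: adjoint_op_def)
    then have "(\<integral>r. (g r + complex_of_real (q r) * U c g r) * cnj (u r) \<partial>leb_I) - (\<integral>r. U c g r * cnj (v r) \<partial>leb_I) = 0"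
      unfolding cinner_l2_of[OF hs u] cinner_l2_of[OF us v] by simp
    moreover define K where "K r = (g r + complex_of_real (q r) * U c g r) * cnj (u r) - U c g r * cnj (v r)" for r
    ultimately have K0: "integral\<^sup>L leb_I K = 0"
      unfolding K_def[abs_def] using sq_int_mult_cnj[OF hs u] sq_int_mult_cnj[OF us v] by simp
    have Ki: "integrable leb_I K"
      unfolding K_def[abs_def] using sq_int_mult_cnj[OF hs u] sq_int_mult_cnj[OF us v] by simp
    have K: "K r = g r * cnj (u r) - k' r * U c g r" for r
      by (simp add: K_def k'_def k_def algebra_simps)
    have Ka: "K absolutely_integrable_on {0..T}" for T
    proof (rule absolutely_integrable_on_subinterval)
      show "K absolutely_integrable_on {0..}"
        using Ki by (simp add: absolutely_integrable_iff_integrable_lebesgue_on)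
    qed auto
    have KT: "integral {0..T} K = integral {0..b} K" if "b \<le> T" for T
    proof -
      have "integral {0..T} K = integral {0..b} K + integral {b..T} K"
        by (rule integral_combine_abs[OF Ka b(1) that])
      moreover have "integral {b..T} K = integral {b..T} (\<lambda>r. 0)"
        by (rule integral_spike[of "{b}"]) (auto simp: K gz Uz)
      ultimately show ?thesis by simp
    qed
    have "(\<lambda>n. integral {0..mid n} K) \<longlonglongrightarrow> integral {0..b} K"
    proof (rule tendsto_eventually)
      have "\<forall>\<^sub>F n in sequentially. b \<le> mid n" using mid_at_top by (simp add: filterlim_at_top)
      then show "\<forall>\<^sub>F n in sequentially. integral {0..mid n} K = integral {0..b} K"
        by eventually_elim (rule KT)
    qed
    then have Kb: "integral {0..b} K = 0"
      using LIMSEQ_unique[OF tendsto_integral_leb_I[OF Ki mid_at_top]] K0 by simp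
    \<comment> \<open>Green's formula for \<open>g\<close> and the reference function
      \<open>w\<close>, without boundary terms. Subtracted from the adjoint relation, it leaves
      \<open>g\<close> integrated against the unknown difference \<open>e\<close>.\<close>
    have gr: "integral {0..b} (\<lambda>r. g r * w r - k' r * U c g r) = 0"
      unfolding w_def green(2)[OF gl k' b(1)] using A0[of b] B0[of b] by simp
    have "integral {0..b} (\<lambda>r. g r * e r) = integral {0..b} (\<lambda>r. K r - (g r * w r - k' r * U c g r))"
      by (rule integral_cong) (simp add: K e_def algebra_simps)
    also have "\<dots> = 0"
    proof -
      have "K integrable_on {0..b}" using Ka by (simp add: absolutely_integrable_on_def)
      moreover have "(\<lambda>r. g r * w r - k' r * U c g r) integrable_on {0..b}"
        using green(1)[OF gl k' b(1), of 0 c] unfolding w_def by (simp add: absolutely_integrable_on_def)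
      ultimately show ?thesis
        using integral_unique[OF has_integral_diff[OF integrable_integral integrable_integral]] Kb gr by fastforce
    qed
    finally have "integral {s..t} e - \<kappa> * integral {0..d} e = 0" unfolding int_g[OF order_refl el] .
    then show ?thesis using d by (simp add: C_def \<kappa>_def)
  qed
  have "AE t in leb_I. e t - C * \<theta> t = 0"
  proof -
    have l: "loc_int (\<lambda>t. e t - C * \<theta> t)"
      by (intro loc_int_diff el loc_int_mult_continuous[OF \<theta>l]) (rule continuous_on_const)
    have "AE t in lebesgue_on {0..real n}. e t - C * \<theta> t = 0" for n
    proof (rule AE_zero_if_interval_integrals_zero)
      show "(\<lambda>t. e t - C * \<theta> t) absolutely_integrable_on {0..real n}" using l by (simp add: loc_int_def)
      fix s t assume st: "0 \<le> s" "s \<le> t" "t \<le> real n"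
      have "e integrable_on {s..t}" "\<theta> integrable_on {s..t}"
        using loc_intD[OF el st(1)] loc_intD[OF \<theta>l st(1)] by (auto simp: absolutely_integrable_on_def)
      then have "integral {s..t} (\<lambda>t. e t - C * \<theta> t) = integral {s..t} e - C * integral {s..t} \<theta>"
        by (intro integral_unique has_integral_diff has_integral_mult_right integrable_integral)
      then show "integral {s..t} (\<lambda>t. e t - C * \<theta> t) = 0" using means[OF st(1,2)] by simp
    qed
    then have "AE t in lebesgue. t \<in> {0..real n} \<longrightarrow> e t - C * \<theta> t = 0" for n
      by (subst (asm) AE_restrict_space_iff) auto
    then have "AE t in lebesgue. \<forall>n. t \<in> {0..real n} \<longrightarrow> e t - C * \<theta> t = 0"
      by (subst AE_all_countable) blast
    then have "AE t in lebesgue. t \<in> {0..} \<longrightarrow> e t - C * \<theta> t = 0"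
    proof eventually_elim
      case (elim t)
      obtain n where "t \<le> real n" using real_arch_simple by blast
      then show ?case using elim by auto
    qed
    then show ?thesis by (subst AE_restrict_space_iff) auto
  qed
  then have "AE t in leb_I. u t = U (cnj C) k t"
  proof eventually_elim
    case (elim t)
    have "cnj (u t) = C * \<theta> t + w t" using elim by (simp add: e_def algebra_simps)
    also have "w t = cnj (U 0 k t)" using U_cnj[of 0 k t] by (simp add: w_def k'_def[abs_def])
    finally have "u t = cnj (C * \<theta> t + cnj (U 0 k t))" by (metis complex_cnj_cnj)
    then show ?case using U_add_const[of "cnj C" k t] by simp
  qed
  then show thesis using that unfolding k_def[abs_def] by blast
qed

text \<open>Passing to the continuous representative makes the integral equation hold at every
  point; a change of the source on a null set does not affect \<open>U\<close>.\<close>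

lemma adjoint_op_H_minE:
  assumes q: "locally_bounded_potential q" and uv: "(u, v) \<in> adjoint_op (H_min x \<alpha> q)"
  obtains c w v0 where "sq_int w" "sq_int v0" "u = l2_of w" "v = l2_of v0"
    "w = U c (\<lambda>t. v0 t - complex_of_real (q t) * w t)"
proof -
  obtain u0 where u0: "sq_int u0" "u = l2_of u0" by (rule ex_l2_of)
  obtain v0 where v0: "sq_int v0" "v = l2_of v0" by (rule ex_l2_of)
  obtain c where c: "AE t in leb_I. u0 t = U c (\<lambda>t. v0 t - complex_of_real (q t) * u0 t) t"
    by (rule adjoint_op_H_min_representation[OF q u0(1) v0(1)]) (use uv u0 v0 in blast)
  define k where "k t = v0 t - complex_of_real (q t) * u0 t" for t
  have k: "loc_int k"
    unfolding k_def[abs_def] by (intro loc_int_diff loc_int_potential_mult[OF q] sq_int_imp_loc_int u0 v0)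
  define w where "w = U c k"
  have ae: "AE t in leb_I. u0 t = w t" using c by (simp add: w_def k_def[abs_def])
  have ws: "sq_int w" unfolding w_def by (rule sq_int_cong_AE[OF u0(1) measurable_U[OF k]]) (use ae in \<open>simp add: w_def\<close>)
  have "AE t in leb_I. k t = v0 t - complex_of_real (q t) * w t"
    using ae by eventually_elim (simp add: k_def)
  then have "w = U c (\<lambda>t. v0 t - complex_of_real (q t) * w t)" unfolding w_def by (rule U_cong_AE)
  moreover have "u = l2_of w" using ae l2_of_eq_iff[OF u0(1) ws] u0(2) by simp
  ultimately show thesis using that ws v0 by blast
qed

lemma H_min_subset_adjoint:
  assumes q: "locally_bounded_potential q"
  shows "H_min x \<alpha> q \<subseteq> adjoint_op (H_min x \<alpha> q)"
proof (rule subrelI)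
  fix F G assume FG: "(F, G) \<in> H_min x \<alpha> q"
  obtain c h T where h: "sq_int h" "sq_int (U c h)" "F = l2_of (U c h)"
    "sq_int (\<lambda>t. h t + complex_of_real (q t) * U c h t)"
    "G = l2_of (\<lambda>t. h t + complex_of_real (q t) * U c h t)"
    by (rule H_min_representation[OF q FG]) blast
  show "(F, G) \<in> adjoint_op (H_min x \<alpha> q)"
    unfolding h(3,5) by (rule adjoint_op_H_minI[OF q h(2,4), of c]) simp
qed

text \<open>If the first component is 0, then \<open>U c v\<close> vanishes everywhere, and with it
  its right derivative, \<open>A\<close> and \<open>B\<close>. So \<open>\<theta> * v\<close> and
  \<open>\<phi> * v\<close> have zero integral over every interval, and the Wronskian gives
  \<open>v = 0\<close> almost everywhere.\<close>

lemma adjoint_op_H_min_single_valued: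
  assumes q: "locally_bounded_potential q" and z: "(0, z) \<in> adjoint_op (H_min x \<alpha> q)"
  shows "z = 0"
proof -
  obtain v where v: "sq_int v" "z = l2_of v" by (rule ex_l2_of)
  obtain c where "AE t in leb_I. (\<lambda>t. 0) t = U c (\<lambda>t. v t - complex_of_real (q t) * (\<lambda>t. 0) t) t"
    by (rule adjoint_op_H_min_representation[OF q sq_int_zero v(1)]) (use z v(2) zero_l2_of in auto)
  then have c: "AE t in leb_I. U c v t = 0" by (auto elim: eventually_mono)
  have vl: "loc_int v" by (rule sq_int_imp_loc_int[OF v(1)])
  have U0: "U c v t = 0" if "0 \<le> t" for t
    by (rule continuous_AE_zero[OF continuous_on_atLeast_0[OF continuous_on_U[OF vl]] c that])
  have V0: "V c v t = 0" if "0 \<le> t" for t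
  proof -
    define k where "k = idx t"
    have k: "x k \<le> t" "t < x (Suc k)" unfolding k_def by (rule idx_bounds[OF that])+
    have "(U c v has_vector_derivative Vl c v k t) (at t within {x k..x (Suc k)})"
      by (rule U_deriv_segment[OF vl]) (use k in auto)
    moreover have "(U c v has_vector_derivative 0) (at t within {x k..x (Suc k)})"
      by (rule has_vector_derivative_transform[of _ _ _ "\<lambda>_. 0"]) (use k x_nonneg[of k] U0 in auto)
    ultimately have "Vl c v k t = 0"
      using vector_derivative_unique_within_closed_interval[of "x k" "x (Suc k)" t "U c v"] k x_less_Suc[of k] by auto
    then show ?thesis using V_eq_Vl[OF vl k] by simp
  qed
  have AB: "A c v t = 0" "B v t = 0" if "0 \<le> t" for t
    using zero_UV_imp_zero_AB[OF U0[OF that] V0[OF that]] by auto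
  have "AE t in lebesgue_on {0..T}. complex_of_real (lin_sol y p t) * v t = 0" 
    if "\<And>t. 0 \<le> t \<Longrightarrow> integral {0..t} (\<lambda>s. complex_of_real (lin_sol y p s) * v s) = m" for y p T m
  proof (rule AE_zero_if_interval_integrals_zero)
    show "(\<lambda>t. complex_of_real (lin_sol y p t) * v t) absolutely_integrable_on {0..T}"
      using loc_int_lin_sol[OF vl] by (simp add: loc_int_def)
    fix s t :: real assume st: "0 \<le> s" "s \<le> t" "t \<le> T"
    have t: "0 \<le> t" using st by simp
    show "integral {s..t} (\<lambda>s. complex_of_real (lin_sol y p s) * v s) = 0"
      using integral_combine_abs[OF loc_intD[OF loc_int_lin_sol[OF vl, of y p] order_refl] st(1,2)] that[OF st(1)] that[OF t] by simp
  qed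
  note ae = this
  have a1: "AE t in lebesgue_on {0..real n}. \<theta> t * v t = 0" for n
    by (rule ae[of _ _ 0]) (use AB(2) in \<open>simp add: B_def\<close>)
  have a2: "AE t in lebesgue_on {0..real n}. \<phi> t * v t = 0" for n
    by (rule ae[of _ _ "- c"]) (use AB(1) in \<open>simp add: A_def add_eq_0_iff2\<close>)
  have "AE t in lebesgue_on {0..real n}. v t = 0" for n
    using a1[of n] a2[of n]
  proof eventually_elim
    case (elim t)
    have "v t = (\<theta> t * \<phi>' t - \<phi> t * \<theta>' t) * v t" unfolding wronskian by simp
    also have "\<dots> = \<phi>' t * (\<theta> t * v t) - \<theta>' t * (\<phi> t * v t)" by algebra
    finally show ?case using elim by simp
  qed
  then have "AE t in lebesgue. t \<in> {0..real n} \<longrightarrow> v t = 0" for n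
    by (subst (asm) AE_restrict_space_iff) auto
  then have "AE t in lebesgue. \<forall>n. t \<in> {0..real n} \<longrightarrow> v t = 0"
    by (subst AE_all_countable) blast
  then have "AE t in lebesgue. t \<in> {0..} \<longrightarrow> v t = 0"
  proof eventually_elim
    case (elim t)
    obtain n where "t \<le> real n" using real_arch_simple by blast
    then show ?case using elim by auto
  qed
  then have "AE t in leb_I. v t = 0" by (subst AE_restrict_space_iff) auto
  then show "z = 0" unfolding v(2) zero_l2_of by (simp add: l2_of_eq_iff v(1) sq_int_zero)
qed

end

section \<open>The free Hamiltonian\<close>

lemma not_summable_harmonic_Suc: "\<not> summable (\<lambda>n. 1 / real (Suc n))"
  using not_summable_harmonic[where 'a = real] summable_Suc_iff[of "\<lambda>n. inverse (real n)"]
  by (simp add: inverse_eq_divide)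

lemma not_summable_if_ge:
  assumes c: "c > 0" and ge: "\<And>n. n \<ge> N \<Longrightarrow> f n \<ge> c / real (Suc n)"
  shows "\<not> summable f"
proof
  assume f: "summable f"
  have "summable (\<lambda>n. c * (1 / real (Suc n)))"
    by (rule summable_comparison_test'[OF f, of N]) (use c ge in auto)
  then have "summable (\<lambda>n. 1 / real (Suc n))" by (rule summable_mult_D) (use c in simp)
  then show False using not_summable_harmonic_Suc by blast
qed

lemma tendsto_zero_if_weighted_summable:
  fixes W :: "nat \<Rightarrow> complex"
  assumes W: "W \<longlonglongrightarrow> L" and s: "summable (\<lambda>n. cmod (W n) / real (Suc n))"
  shows "L = 0"
proof (rule ccontr)
  assume "L \<noteq> 0"
  then have c: "cmod L / 2 > 0" by simp
  have "(\<lambda>n. cmod (W n)) \<longlonglongrightarrow> cmod L" by (rule tendsto_norm[OF W])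
  then have "\<forall>\<^sub>F n in sequentially. cmod L / 2 < cmod (W n)"
    by (rule order_tendstoD) (use c in simp)
  then obtain N where N: "\<And>n. n \<ge> N \<Longrightarrow> cmod L / 2 < cmod (W n)"
    unfolding eventually_sequentially by blast
  have "cmod (W n) / real (Suc n) \<ge> (cmod L / 2) / real (Suc n)" if "n \<ge> N" for n
    by (intro divide_right_mono less_imp_le[OF N[OF that]]) simp
  from not_summable_if_ge[OF c this] s show False by blast
qed

text \<open>
  A discrete analogue of: if \<open>Y\<close> and \<open>Y''\<close> are square integrable on a half-line, then so is \<open>Y'\<close>.
  If the sum diverged, summation by parts would make \<open>Re (cnj D Y)\<close> large, so that \<open>|Y|\<close> would
  eventually increase.
\<close>

lemma summable_discrete_derivative:
  fixes Y D :: "nat \<Rightarrow> complex"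
  assumes D: "\<And>n. D n = of_nat (Suc n) * (Y (Suc n) - Y n)"
    and Y: "summable (\<lambda>n. (cmod (Y n))\<^sup>2 / real (Suc n))"
    and DD: "summable (\<lambda>n. real (Suc n) * (cmod (D (Suc n) - D n))\<^sup>2)"
  shows "summable (\<lambda>n. (cmod (D n))\<^sup>2 / real (Suc n))"
proof (rule ccontr)
  assume ns: "\<not> summable (\<lambda>n. (cmod (D n))\<^sup>2 / real (Suc n))"
  define S where "S N = (\<Sum>n<N. (cmod (D n))\<^sup>2 / real (Suc n))" for N
  define R where "R N = Re (cnj (D N) * Y N)" for N
  \<comment> \<open>Dominates the error term in the increment of \<open>R\<close>, by
    \<open>a * b \<le> k * a^2 + b^2 / k\<close> with \<open>k = N + 1\<close>. The factor 2
    replaces the weight \<open>1 / (N + 1)\<close> by \<open>1 / (N + 2)\<close>, which matches the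
    index of \<open>Y (Suc N)\<close>.\<close>
  define r where "r n = real (Suc n) * (cmod (D (Suc n) - D n))\<^sup>2 + 2 * ((cmod (Y (Suc n)))\<^sup>2 / real (Suc (Suc n)))" for n
  have rs: "summable r"
    unfolding r_def using DD Y summable_Suc_iff[of "\<lambda>n. (cmod (Y n))\<^sup>2 / real (Suc n)"]
    by (intro summable_add summable_mult) auto
  have r0: "r n \<ge> 0" for n by (simp add: r_def)
  have step: "R (Suc N) - R N \<ge> (cmod (D N))\<^sup>2 / real (Suc N) - r N" for N
  proof -
    have dY: "Y (Suc N) = Y N + D N / of_nat (Suc N)" unfolding D by (simp del: of_nat_Suc)
    have 1: "R (Suc N) - R N = Re (cnj (D N) * (Y (Suc N) - Y N)) + Re (cnj (D (Suc N) - D N) * Y (Suc N))"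
      by (simp add: R_def algebra_simps)
    have 2: "cnj (D N) * (Y (Suc N) - Y N) = complex_of_real ((cmod (D N))\<^sup>2 / real (Suc N))"
      unfolding dY using complex_norm_square[of "D N"] by (simp add: mult.commute del: of_nat_Suc)
    have 3: "Re (cnj (D (Suc N) - D N) * Y (Suc N)) \<ge> - r N"
    proof -
      have "- Re (cnj (D (Suc N) - D N) * Y (Suc N)) \<le> cmod (cnj (D (Suc N) - D N) * Y (Suc N))"
        using abs_Re_le_cmod[of "cnj (D (Suc N) - D N) * Y (Suc N)"] by linarith
      also have "\<dots> = cmod (D (Suc N) - D N) * cmod (Y (Suc N))"
        by (simp only: norm_mult complex_mod_cnj)
      also have "\<dots> \<le> real (Suc N) * (cmod (D (Suc N) - D N))\<^sup>2 + (cmod (Y (Suc N)))\<^sup>2 / real (Suc N)"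
      proof -
        have am: "a * b \<le> k * a\<^sup>2 + b\<^sup>2 / k" if "k > 0" "a \<ge> 0" "b \<ge> 0" for a b k :: real
        proof -
          have "0 \<le> (k * a - b)\<^sup>2 / k" using that by simp
          also have "(k * a - b)\<^sup>2 / k = k * a\<^sup>2 + b\<^sup>2 / k - 2 * (a * b)"
            using that(1) by (simp add: power2_eq_square field_simps)
          finally show ?thesis using mult_nonneg_nonneg[OF that(2,3)] by linarith
        qed
        show ?thesis by (rule am) auto
      qed
      also have "(cmod (Y (Suc N)))\<^sup>2 / real (Suc N) \<le> 2 * ((cmod (Y (Suc N)))\<^sup>2 / real (Suc (Suc N)))"
      proof -
        have "1 / real (Suc N) \<le> 2 / real (Suc (Suc N))" by (simp add: field_simps)
        then have "(cmod (Y (Suc N)))\<^sup>2 * (1 / real (Suc N)) \<le> (cmod (Y (Suc N)))\<^sup>2 * (2 / real (Suc (Suc N)))"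
          by (rule mult_left_mono) simp
        then show ?thesis by (simp add: mult.commute[of _ "2::real"])
      qed
      finally show ?thesis by (simp add: r_def)
    qed
    show ?thesis using 1 3 unfolding 2 Re_complex_of_real by linarith
  qed
  have R: "R N \<ge> R 0 + S N - suminf r" for N
  proof -
    have "R N \<ge> R 0 + S N - (\<Sum>n<N. r n)"
    proof (induction N)
      case (Suc N)
      have "S (Suc N) = S N + (cmod (D N))\<^sup>2 / real (Suc N)" by (simp add: S_def)
      moreover have "(\<Sum>n<Suc N. r n) = (\<Sum>n<N. r n) + r N" by simp
      ultimately show ?case using Suc step[of N] by linarith
    qed (simp add: S_def)
    moreover have "(\<Sum>n<N. r n) \<le> suminf r" by (rule sum_le_suminf[OF rs]) (auto simp: r0)
    ultimately show ?thesis by linarith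
  qed
  have "\<exists>N. S N > 1 - R 0 + suminf r"
  proof (rule ccontr)
    assume "\<not> (\<exists>N. S N > 1 - R 0 + suminf r)"
    then have le: "S N \<le> 1 - R 0 + suminf r" for N by (simp add: not_less)
    have "summable (\<lambda>n. (cmod (D n))\<^sup>2 / real (Suc n))"
      by (rule bounded_imp_summable[of _ "1 - R 0 + suminf r"])
         (use le[of "Suc _"] in \<open>auto simp: S_def lessThan_Suc_atMost simp del: sum.lessThan_Suc\<close>)
    with ns show False by blast
  qed
  then obtain N0 where N0: "S N0 > 1 - R 0 + suminf r" by blast
  have Smono: "S N0 \<le> S N" if "N \<ge> N0" for N
    unfolding S_def by (rule sum_mono2) (use that in auto)
  have R1: "R N > 1" if "N \<ge> N0" for N using R[of N] N0 Smono[OF that] by linarith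
  \<comment> \<open>Since \<open>R N > 0\<close>, the cross term in the square of
    \<open>cmod (Y N + d)\<close> is positive. So \<open>cmod (Y N)\<close> does not decrease from
    \<open>N0\<close> on, which the divergent harmonic weights forbid.\<close>
  have inc: "(cmod (Y N))\<^sup>2 \<le> (cmod (Y (Suc N)))\<^sup>2" if "N \<ge> N0" for N
  proof -
    define d where "d = D N / of_nat (Suc N)"
    have dY: "Y (Suc N) = Y N + d" unfolding d_def D by (simp del: of_nat_Suc)
    have "(cmod (Y N + d))\<^sup>2 = (cmod (Y N))\<^sup>2 + 2 * Re (cnj d * Y N) + (cmod d)\<^sup>2"
      unfolding cmod_power2 by (simp add: power2_eq_square algebra_simps)
    moreover have "Re (cnj d * Y N) = R N / real (Suc N)"
    proof -
      have "cnj d * Y N = (cnj (D N) * Y N) / complex_of_real (real (Suc N))"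
        by (simp add: d_def del: of_nat_Suc)
      then show ?thesis unfolding R_def by (simp only: Re_divide_of_real)
    qed
    moreover have "R N / real (Suc N) \<ge> 0" using R1[OF that] by simp
    ultimately show ?thesis unfolding dY using zero_le_power2[of "cmod d"] by linarith
  qed
  have Y0: "(cmod (Y N))\<^sup>2 \<ge> (cmod (Y N0))\<^sup>2" if "N \<ge> N0" for N
    using that by (induction N rule: dec_induct) (use inc in \<open>auto intro: order_trans\<close>)
  have "Y N0 \<noteq> 0" using R1[of N0] by (auto simp: R_def)
  then have c: "(cmod (Y N0))\<^sup>2 > 0" by simp
  have "(cmod (Y N))\<^sup>2 / real (Suc N) \<ge> (cmod (Y N0))\<^sup>2 / real (Suc N)" if "N \<ge> N0" for N
    by (rule divide_right_mono[OF Y0[OF that]]) simp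
  from not_summable_if_ge[OF c this] Y show False by blast
qed

text \<open>Cauchy-Schwarz against the constant 1, obtained by integrating
  \<open>2 * l * |h| \<le> |h|^2 + l^2\<close> with \<open>l\<close> the mean of
  \<open>|h|\<close>.\<close>

lemma integral_norm_square_le:
  fixes h :: "real \<Rightarrow> complex"
  assumes ab: "a < b" and h: "(\<lambda>t. cmod (h t)) integrable_on {a..b}" and h2: "(\<lambda>t. (cmod (h t))\<^sup>2) integrable_on {a..b}"
  shows "(integral {a..b} (\<lambda>t. cmod (h t)))\<^sup>2 \<le> (b - a) * integral {a..b} (\<lambda>t. (cmod (h t))\<^sup>2)"
proof -
  define m where "m = integral {a..b} (\<lambda>t. cmod (h t))"
  define l where "l = m / (b - a)"
  have i1: "((\<lambda>t. 2 * l * cmod (h t)) has_integral 2 * l * m) {a..b}"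
    unfolding m_def by (rule has_integral_mult_right[OF integrable_integral[OF h]])
  have i2: "((\<lambda>t. (cmod (h t))\<^sup>2 + l\<^sup>2) has_integral integral {a..b} (\<lambda>t. (cmod (h t))\<^sup>2) + (b - a) * l\<^sup>2) {a..b}"
    using has_integral_add[OF integrable_integral[OF h2] has_integral_const_real[of "l\<^sup>2" a b]] ab by simp
  have "2 * l * cmod (h t) \<le> (cmod (h t))\<^sup>2 + l\<^sup>2" for t
    using sum_squares_bound[of l "cmod (h t)"] by simp
  from has_integral_le[OF i1 i2 this]
  have "2 * l * m \<le> integral {a..b} (\<lambda>t. (cmod (h t))\<^sup>2) + (b - a) * l\<^sup>2" by blast
  then have "(b - a) * (2 * l * m) \<le> (b - a) * (integral {a..b} (\<lambda>t. (cmod (h t))\<^sup>2) + (b - a) * l\<^sup>2)"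
    using ab by (intro mult_left_mono) auto
  moreover have "(b - a) * (2 * l * m) = 2 * m\<^sup>2" "(b - a) * ((b - a) * l\<^sup>2) = m\<^sup>2"
    using ab by (simp_all add: l_def power2_eq_square)
  ultimately show ?thesis by (simp add: m_def algebra_simps)
qed

lemma sq_int_imp_square_integrable:
  assumes f: "sq_int f" and a: "0 \<le> a"
  shows "(\<lambda>t. (cmod (f t))\<^sup>2) integrable_on {a..b}"
proof -
  have "(\<lambda>t. (cmod (f t))\<^sup>2) absolutely_integrable_on {0..}"
    using f by (simp add: sq_int_def absolutely_integrable_iff_integrable_lebesgue_on)
  then have "(\<lambda>t. (cmod (f t))\<^sup>2) absolutely_integrable_on {a..b}"
    by (rule absolutely_integrable_on_subinterval) (use a in auto)
  then show ?thesis by (simp add: absolutely_integrable_on_def)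
qed

section \<open>Grid values of square integrable solutions\<close>

context point_interactions begin

lemma summable_segment_integrals:
  assumes f: "sq_int f"
  shows "summable (\<lambda>n. integral {x n..x (Suc n)} (\<lambda>t. (cmod (f t))\<^sup>2))"
proof -
  have ai: "(\<lambda>t. (cmod (f t))\<^sup>2) absolutely_integrable_on {0..}"
    using f by (simp add: sq_int_def absolutely_integrable_iff_integrable_lebesgue_on)
  note i = sq_int_imp_square_integrable[OF f]
  have s: "(\<Sum>n<N. integral {x n..x (Suc n)} (\<lambda>t. (cmod (f t))\<^sup>2)) = integral {0..x N} (\<lambda>t. (cmod (f t))\<^sup>2)" for N
  proof (induction N)
    case (Suc N)
    have "integral {0..x N} (\<lambda>t. (cmod (f t))\<^sup>2) + integral {x N..x (Suc N)} (\<lambda>t. (cmod (f t))\<^sup>2)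
        = integral {0..x (Suc N)} (\<lambda>t. (cmod (f t))\<^sup>2)"
      by (rule Henstock_Kurzweil_Integration.integral_combine[OF x_nonneg less_imp_le[OF x_less_Suc] i]) simp
    then show ?case using Suc by simp
  qed (simp add: x_0)
  show ?thesis
  proof (rule bounded_imp_summable[of _ "integral {0..} (\<lambda>t. (cmod (f t))\<^sup>2)"])
    show "0 \<le> integral {x n..x (Suc n)} (\<lambda>t. (cmod (f t))\<^sup>2)" for n
      by (rule Henstock_Kurzweil_Integration.integral_nonneg[OF i[OF x_nonneg]]) simp
    show "(\<Sum>k\<le>n. integral {x k..x (Suc k)} (\<lambda>t. (cmod (f t))\<^sup>2)) \<le> integral {0..} (\<lambda>t. (cmod (f t))\<^sup>2)" for n
      unfolding lessThan_Suc_atMost[symmetric] s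
      by (rule integral_subset_le) (use i ai in \<open>auto simp: absolutely_integrable_on_def\<close>)
  qed
qed

lemma segment_norm_integral_le:
  assumes f: "sq_int f"
  shows "(\<lambda>t. cmod (f t)) integrable_on {x n..x (Suc n)}"
    "0 \<le> integral {x n..x (Suc n)} (\<lambda>t. cmod (f t))"
    "(integral {x n..x (Suc n)} (\<lambda>t. cmod (f t)))\<^sup>2
      \<le> (x (Suc n) - x n) * integral {x n..x (Suc n)} (\<lambda>t. (cmod (f t))\<^sup>2)"
proof -
  show i: "(\<lambda>t. cmod (f t)) integrable_on {x n..x (Suc n)}"
    using loc_intD[OF sq_int_imp_loc_int[OF f] x_nonneg] by (simp add: absolutely_integrable_on_def)
  show "0 \<le> integral {x n..x (Suc n)} (\<lambda>t. cmod (f t))"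
    by (rule Henstock_Kurzweil_Integration.integral_nonneg[OF i]) simp
  show "(integral {x n..x (Suc n)} (\<lambda>t. cmod (f t)))\<^sup>2
      \<le> (x (Suc n) - x n) * integral {x n..x (Suc n)} (\<lambda>t. (cmod (f t))\<^sup>2)"
    by (rule integral_norm_square_le[OF x_less_Suc i sq_int_imp_square_integrable[OF f x_nonneg]])
qed

text \<open>Integration by parts against \<open>- (t - x k)\<^sup>2 (t - x (k + 1)) / d\<^sup>2\<close>, which vanishes at both end points.\<close>

lemma U_endpoint_bound:
  assumes h: "sq_int h" and u: "sq_int (U c h)"
  defines "d \<equiv> \<lambda>k. x (Suc k) - x k"
  shows "d k * (cmod (U c h (x (Suc k))))\<^sup>2
    \<le> 2 * d k ^ 4 * integral {x k..x (Suc k)} (\<lambda>t. (cmod (h t))\<^sup>2)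
      + 32 * integral {x k..x (Suc k)} (\<lambda>t. (cmod (U c h t))\<^sup>2)"
proof -
  define a b D where "a = x k" and "b = x (Suc k)" and "D = d k"
  have ab: "a < b" unfolding a_def b_def by (rule x_less_Suc)
  have D: "D = b - a" "D > 0" using ab by (auto simp: D_def d_def a_def b_def)
  \<comment> \<open>Besides vanishing at both ends, this cubic has \<open>p' a = 0\<close> and
    \<open>p' b = - 1\<close>, so the boundary terms of the integration by parts reduce to
    \<open>U c h b\<close>.\<close>
  define p :: "real \<Rightarrow> real" where "p t = - ((t - a)\<^sup>2 * (t - b)) / D\<^sup>2" for t
  define p' :: "real \<Rightarrow> real" where "p' t = - (2 * (t - a) * (t - b) + (t - a)\<^sup>2) / D\<^sup>2" for t
  define p'' :: "real \<Rightarrow> real" where "p'' t = - (2 * (t - b) + 4 * (t - a)) / D\<^sup>2" for t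
  have dp: "(p has_real_derivative p' t) (at t within S)" for t S
    unfolding p_def p'_def using D(2)
    by (auto intro!: derivative_eq_intros simp: field_simps power2_eq_square)
  have dp': "(p' has_real_derivative p'' t) (at t within S)" for t S
    unfolding p''_def p'_def using D(2)
    by (auto intro!: derivative_eq_intros simp: field_simps power2_eq_square)
  have hl: "loc_int h" by (rule sq_int_imp_loc_int[OF h])
  have cd: "((\<lambda>t. complex_of_real (f t)) has_vector_derivative complex_of_real f') (at t within S)"
    if "(f has_real_derivative f') (at t within S)" for f f' t S
    using that by (intro has_vector_derivative_of_real) (simp add: has_real_derivative_iff_has_vector_derivative)
  have pp: "p a = 0" "p b = 0" "p' a = 0" "p' b = -1"
    using D by (auto simp: p_def p'_def)
  have ibp: "U c h b = - integral {a..b} (\<lambda>t. h t * complex_of_real (p t) + U c h t * complex_of_real (p'' t))"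
  proof -
    have "continuous_on {a..b} (\<lambda>t. complex_of_real (p'' t))"
      unfolding p''_def using D(2) by (intro continuous_intros) auto
    then show ?thesis
      using integration_by_parts_segment[OF hl, of k "\<lambda>t. complex_of_real (p t)" "\<lambda>t. complex_of_real (p' t)"
        "\<lambda>t. complex_of_real (p'' t)" c, OF cd[OF dp] cd[OF dp']]
      unfolding a_def[symmetric] b_def[symmetric] by (simp add: pp)
  qed
  define mh where "mh = integral {a..b} (\<lambda>t. cmod (h t))"
  define mu where "mu = integral {a..b} (\<lambda>t. cmod (U c h t))"
  note bh = segment_norm_integral_le[OF h, of k, folded a_def b_def]
  note bu = segment_norm_integral_le[OF u, of k, folded a_def b_def]
  have pb: "\<bar>p t\<bar> \<le> D" "\<bar>p'' t\<bar> \<le> 4 / D" if t: "t \<in> {a..b}" for t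
  proof -
    have "(t - a)\<^sup>2 \<le> D\<^sup>2" using t D by (intro power_mono) auto
    moreover have "\<bar>t - b\<bar> \<le> D" using t D by auto
    ultimately have "(t - a)\<^sup>2 * \<bar>t - b\<bar> \<le> D\<^sup>2 * D" by (intro mult_mono) auto
    then have "(t - a)\<^sup>2 * \<bar>t - b\<bar> / D\<^sup>2 \<le> D\<^sup>2 * D / D\<^sup>2" by (rule divide_right_mono) simp
    then show "\<bar>p t\<bar> \<le> D" using D(2) by (simp add: p_def abs_mult)
    have "\<bar>2 * (t - b) + 4 * (t - a)\<bar> \<le> 4 * D" using t D by auto
    then show "\<bar>p'' t\<bar> \<le> 4 / D" using D(2) by (simp add: p''_def field_simps power2_eq_square)
  qed
  have "cmod (U c h b) \<le> integral {a..b} (\<lambda>t. D * cmod (h t) + 4 / D * cmod (U c h t))"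
    unfolding ibp norm_minus_cancel
  proof (rule integral_norm_bound_integral)
    have "(\<lambda>t. complex_of_real (p t)  * h t) absolutely_integrable_on {a..b}"
      "(\<lambda>t. complex_of_real (p'' t) * U c h t) absolutely_integrable_on {a..b}"
      unfolding p_def p''_def a_def using D(2)
      by (intro absolutely_integrable_mult_continuous(2) loc_intD[OF _ x_nonneg] hl sq_int_imp_loc_int[OF u] continuous_intros; simp)+
    then show "(\<lambda>t. h t * complex_of_real (p t) + U c h t * complex_of_real (p'' t)) integrable_on {a..b}"
      by (intro integrable_add) (auto simp: absolutely_integrable_on_def mult.commute)
    show "(\<lambda>t. D * cmod (h t) + 4 / D * cmod (U c h t)) integrable_on {a..b}"
      by (intro integrable_add integrable_on_mult_right bh bu)
    fix t assume t: "t \<in> {a..b}"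
    have "norm (h t * complex_of_real (p t) + U c h t * complex_of_real (p'' t)) \<le> \<bar>p t\<bar> * cmod (h t) + \<bar>p'' t\<bar> * cmod (U c h t)"
      by (rule order_trans[OF norm_triangle_ineq]) (simp add: norm_mult mult.commute)
    also have "\<dots> \<le> D * cmod (h t) + 4 / D * cmod (U c h t)"
      using pb[OF t] by (intro add_mono mult_right_mono) auto
    finally show "norm (h t * complex_of_real (p t) + U c h t * complex_of_real (p'' t)) \<le> D * cmod (h t) + 4 / D * cmod (U c h t)" .
  qed
  also have "\<dots> = D * mh + 4 / D * mu"
    unfolding mh_def mu_def
    by (rule integral_unique[OF has_integral_add[OF has_integral_mult_right[OF integrable_integral[OF bh(1)]]
      has_integral_mult_right[OF integrable_integral[OF bu(1)]]]])
  finally have "(cmod (U c h b))\<^sup>2 \<le> (D * mh + 4 / D * mu)\<^sup>2" by (intro power_mono) auto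
  \<comment> \<open>Source of the constants: 2, and \<open>32 = 2 * 4^2\<close>, where
    \<open>4 / D\<close> bounds the second derivative of \<open>p\<close>.\<close>
  also have "\<dots> \<le> 2 * (D * mh)\<^sup>2 + 2 * (4 / D * mu)\<^sup>2"
    using sum_squares_bound[of "D * mh" "4 / D * mu"] by (simp add: power2_sum)
  also have "\<dots> = 2 * D\<^sup>2 * mh\<^sup>2 + 32 / D\<^sup>2 * mu\<^sup>2" by (simp add: power_mult_distrib power_divide)
  also have "\<dots> \<le> 2 * D\<^sup>2 * (D * integral {a..b} (\<lambda>t. (cmod (h t))\<^sup>2)) + 32 / D\<^sup>2 * (D * integral {a..b} (\<lambda>t. (cmod (U c h t))\<^sup>2))"
    using bh(3) bu(3) D by (intro add_mono mult_left_mono) (auto simp: mh_def mu_def)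
  finally have "D * (cmod (U c h b))\<^sup>2 \<le> D * (2 * D\<^sup>2 * (D * integral {a..b} (\<lambda>t. (cmod (h t))\<^sup>2)) + 32 / D\<^sup>2 * (D * integral {a..b} (\<lambda>t. (cmod (U c h t))\<^sup>2)))"
    using D(2) by (intro mult_left_mono) auto
  also have "\<dots> = 2 * D ^ 4 * integral {a..b} (\<lambda>t. (cmod (h t))\<^sup>2) + 32 * integral {a..b} (\<lambda>t. (cmod (U c h t))\<^sup>2)"
    using D(2) by (simp add: field_simps power2_eq_square power4_eq_xxxx)
  finally show ?thesis unfolding a_def b_def D_def .
qed

end

section \<open>Harmonic spacing and the coupling \<open>- 4 n - 2\<close>\<close>

locale harmonic_interactions =
  fixes x \<alpha> :: "nat \<Rightarrow> real"
  assumes harmonic_x_0: "x 0 = 0" and x_step: "\<forall>n\<ge>1. x n - x (n - 1) = 1 / real n"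
    and \<alpha>_eq: "\<forall>n\<ge>1. \<alpha> n = - 4 * real n - 2"
begin

lemma x_Suc: "x (Suc n) = x n + 1 / real (Suc n)"
  using x_step[rule_format, of "Suc n"] by simp

lemma x_eq_harm: "x n = harm n"
proof (induction n)
  case (Suc n)
  then show ?case using x_Suc[of n] by (simp add: harm_Suc inverse_eq_divide)
qed (simp add: harmonic_x_0 harm_def)

sublocale point_interactions x \<alpha>
proof
  show "strict_mono x" by (rule strict_monoI_Suc) (simp add: x_Suc)
  \<comment> \<open>The grid points are the harmonic numbers, so they exhaust the half-line.\<close>
  have "x = harm" by (rule ext) (rule x_eq_harm)
  then show "filterlim x at_top sequentially" using harm_at_top by simp
qed (rule harmonic_x_0)

lemma d_eq: "x (Suc n) - x n = 1 / real (Suc n)"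
  by (simp add: x_Suc)

text \<open>Each grid value is charged to the segment on its left through
  \<open>U_endpoint_bound\<close>; segment integrals of square integrable functions are summable,
  and \<open>d n ^ 4\<close> is at most 1.\<close>

lemma summable_endpoint_values:
  assumes h: "sq_int h" and u: "sq_int (U c h)"
  shows "summable (\<lambda>n. (cmod (U c h (x n)))\<^sup>2 / real (Suc n))"
proof -
  have "summable (\<lambda>n. (cmod (U c h (x (Suc n))))\<^sup>2 / real (Suc (Suc n)))"
  proof (rule summable_comparison_test')
    show "summable (\<lambda>n. 2 * integral {x n..x (Suc n)} (\<lambda>t. (cmod (h t))\<^sup>2)
        + 32 * integral {x n..x (Suc n)} (\<lambda>t. (cmod (U c h t))\<^sup>2))"
      by (intro summable_add summable_mult summable_segment_integrals h u)
    fix n :: nat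
    have d: "0 \<le> (1 / real (Suc n)) ^ 4" "(1 / real (Suc n)) ^ 4 \<le> 1" by (auto intro: power_le_one)
    have i0: "0 \<le> integral {x n..x (Suc n)} (\<lambda>t. (cmod (h t))\<^sup>2)"
      by (rule Henstock_Kurzweil_Integration.integral_nonneg[OF sq_int_imp_square_integrable[OF h x_nonneg]]) simp
    have "(cmod (U c h (x (Suc n))))\<^sup>2 / real (Suc (Suc n)) \<le> (1 / real (Suc n)) * (cmod (U c h (x (Suc n))))\<^sup>2"
      by (simp add: frac_le)
    also have "\<dots> \<le> 2 * (1 / real (Suc n)) ^ 4 * integral {x n..x (Suc n)} (\<lambda>t. (cmod (h t))\<^sup>2)
        + 32 * integral {x n..x (Suc n)} (\<lambda>t. (cmod (U c h t))\<^sup>2)"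
      using U_endpoint_bound[OF h u, of n] unfolding d_eq .
    also have "\<dots> \<le> 2 * 1 * integral {x n..x (Suc n)} (\<lambda>t. (cmod (h t))\<^sup>2)
        + 32 * integral {x n..x (Suc n)} (\<lambda>t. (cmod (U c h t))\<^sup>2)"
      using d(2) i0 by (intro add_right_mono mult_right_mono mult_left_mono) auto
    finally show "norm ((cmod (U c h (x (Suc n))))\<^sup>2 / real (Suc (Suc n)))
       \<le> 2 * integral {x n..x (Suc n)} (\<lambda>t. (cmod (h t))\<^sup>2) + 32 * integral {x n..x (Suc n)} (\<lambda>t. (cmod (U c h t))\<^sup>2)"
      by simp
  qed
  then show ?thesis by (subst (asm) summable_Suc_iff[of "\<lambda>n. (cmod (U c h (x n)))\<^sup>2 / real (Suc n)"])
qed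

text \<open>
  Up to the alternating sign, \<open>V + 2 (n + 1) U\<close> at the points \<open>x n\<close> is the derivative of the sequence
  \<open>(- 1) ^ n U (x n)\<close>: since \<open>\<alpha> n = - 2 (1 / d n + 1 / d (n + 1))\<close>, the sign change turns the interface
  condition into that of the free Laplacian.
\<close>

lemma summable_endpoint_derivatives:
  assumes h: "sq_int h" and u: "sq_int (U c h)"
  shows "summable (\<lambda>n. (cmod (V c h (x n) + 2 * of_nat (Suc n) * U c h (x n)))\<^sup>2 / real (Suc n))"
proof -
  have hl: "loc_int h" by (rule sq_int_imp_loc_int[OF h])
  define y where "y n = U c h (x n)" for n
  define J where "J n = integral {x n..x (Suc n)} h" for n
  \<comment> \<open>The Taylor remainder of the segment times \<open>n + 1\<close>, so that
    \<open>V\<close> at \<open>x n\<close> is the difference quotient of \<open>y\<close> plus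
    \<open>e n\<close>.\<close>
  define e where "e n = of_nat (Suc n) * integral {x n..x (Suc n)} (\<lambda>s. complex_of_real (x (Suc n) - s) * h s)" for n
  define m where "m n = integral {x n..x (Suc n)} (\<lambda>t. cmod (h t))" for n
  define S where "S n = integral {x n..x (Suc n)} (\<lambda>t. (cmod (h t))\<^sup>2)" for n
  define G where "G n = of_nat (Suc n) * (y (Suc n) + y n)" for n
  note b = segment_norm_integral_le[OF h]
  have m0: "m n \<ge> 0" for n unfolding m_def by (rule b(2))
  \<comment> \<open>Cauchy-Schwarz on a segment of length \<open>1 / (n + 1)\<close> gains a factor
    \<open>n + 1\<close>. This is the weight that \<open>summable_discrete_derivative\<close>
    demands of the second differences.\<close>
  have mS: "real (Suc n) * (m n)\<^sup>2 \<le> S n" for n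
    using b(3)[of n] unfolding d_eq m_def S_def by (simp add: field_simps)
  have Ssum: "summable S" unfolding S_def by (rule summable_segment_integrals[OF h])
  have hi: "h integrable_on {x n..x (Suc n)}" for n
    using loc_intD[OF hl x_nonneg] by (simp add: absolutely_integrable_on_def)
  have Jm: "cmod (J n) \<le> m n" for n
    unfolding J_def m_def by (rule integral_norm_bound_integral[OF hi b(1)]) simp
  have em: "cmod (e n) \<le> m n" for n
  proof -
    have "(\<lambda>s. complex_of_real (x (Suc n) - s) * h s) absolutely_integrable_on {x n..x (Suc n)}"
      by (rule absolutely_integrable_mult_continuous(2)[OF loc_intD[OF hl x_nonneg]]) (intro continuous_intros)
    then have i: "(\<lambda>s. complex_of_real (x (Suc n) - s) * h s) integrable_on {x n..x (Suc n)}"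
      by (simp add: absolutely_integrable_on_def)
    have "cmod (integral {x n..x (Suc n)} (\<lambda>s. complex_of_real (x (Suc n) - s) * h s))
        \<le> integral {x n..x (Suc n)} (\<lambda>s. 1 / real (Suc n) * cmod (h s))"
    proof (rule integral_norm_bound_integral[OF i integrable_on_mult_right[OF b(1)]])
      fix s assume s: "s \<in> {x n..x (Suc n)}"
      then have "\<bar>x (Suc n) - s\<bar> \<le> 1 / real (Suc n)" using d_eq[of n] by auto
      then have "\<bar>x (Suc n) - s\<bar> * cmod (h s) \<le> 1 / real (Suc n) * cmod (h s)" by (rule mult_right_mono) simp
      then show "norm (complex_of_real (x (Suc n) - s) * h s) \<le> 1 / real (Suc n) * cmod (h s)"
        by (simp only: norm_mult norm_of_real)
    qed
    also have "\<dots> = 1 / real (Suc n) * m n" unfolding m_def by (rule Henstock_Kurzweil_Integration.integral_mult_right)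
    finally have "real (Suc n) * cmod (integral {x n..x (Suc n)} (\<lambda>s. complex_of_real (x (Suc n) - s) * h s))
      \<le> real (Suc n) * (1 / real (Suc n) * m n)" by (rule mult_left_mono) simp
    then show ?thesis unfolding e_def norm_mult norm_of_nat by simp
  qed
  have Vx: "V c h (x n) = of_nat (Suc n) * (y (Suc n) - y n) + e n" for n
  proof -
    have "y (Suc n) = y n + V c h (x n) * complex_of_real (1 / real (Suc n))
        - integral {x n..x (Suc n)} (\<lambda>s. complex_of_real (x (Suc n) - s) * h s)"
      using U_segment[OF hl less_imp_le[OF x_less_Suc] order_refl, of c n] unfolding y_def d_eq .
    then have "of_nat (Suc n) * y (Suc n) = of_nat (Suc n) * y n + V c h (x n) - e n"
      by (simp add: e_def field_simps del: of_nat_Suc)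
    then show ?thesis by (simp add: algebra_simps del: of_nat_Suc)
  qed
  have GV: "V c h (x n) + 2 * of_nat (Suc n) * U c h (x n) = G n + e n" for n
    unfolding Vx G_def y_def[symmetric] by (simp add: algebra_simps del: of_nat_Suc)
  \<comment> \<open>Here the value of the coupling is used: the interface condition becomes a
    relation for the sum of consecutive \<open>G\<close>, up to source terms. The alternating sign
    below turns the sum into a difference.\<close>
  have GG: "G (Suc n) + G n = e n - e (Suc n) - J n" for n
  proof -
    have "V c h (x (Suc n)) = V c h (x n) - J n + complex_of_real (- 4 * real (Suc n) - 2) * y (Suc n)"
      using V_jump[OF hl, of c n] \<alpha>_eq by (simp add: Vl_def J_def y_def del: of_nat_Suc)
    moreover have "complex_of_real (- 4 * real (Suc n) - 2) = - 4 * of_nat (Suc n) - 2" by simp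
    ultimately have "V c h (x (Suc n)) = V c h (x n) - J n + (- 4 * of_nat (Suc n) - 2) * y (Suc n)" by metis
    moreover have "of_nat (Suc (Suc n)) = of_nat (Suc n) + (1::complex)" by simp
    ultimately show ?thesis using Vx[of n] Vx[of "Suc n"] unfolding G_def by algebra
  qed
  define Y where "Y n = (- 1) ^ n * y n" for n
  define D where "D n = of_nat (Suc n) * (Y (Suc n) - Y n)" for n
  have DG: "D n = - ((- 1) ^ n) * G n" for n
    by (simp add: D_def Y_def G_def algebra_simps del: of_nat_Suc)
  have nD: "cmod (D n) = cmod (G n)" for n unfolding DG by (simp add: norm_mult norm_power)
  have DD: "cmod (D (Suc n) - D n) \<le> 2 * m n + m (Suc n)" for n
  proof -
    have "D (Suc n) - D n = (- 1) ^ n * (G (Suc n) + G n)" unfolding DG by (simp add: algebra_simps)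
    then have "cmod (D (Suc n) - D n) = cmod (e n - e (Suc n) - J n)" unfolding GG by (simp add: norm_mult norm_power)
    also have "\<dots> \<le> cmod (e n) + cmod (e (Suc n)) + cmod (J n)"
      using norm_triangle_ineq4[of "e n - e (Suc n)" "J n"] norm_triangle_ineq4[of "e n" "e (Suc n)"] by linarith
    finally show ?thesis using em[of n] em[of "Suc n"] Jm[of n] by linarith
  qed
  have "summable (\<lambda>n. (cmod (D n))\<^sup>2 / real (Suc n))"
  proof (rule summable_discrete_derivative[OF D_def])
    show "summable (\<lambda>n. (cmod (Y n))\<^sup>2 / real (Suc n))"
      using summable_endpoint_values[OF h u] by (simp add: Y_def y_def norm_mult norm_power)
    show "summable (\<lambda>n. real (Suc n) * (cmod (D (Suc n) - D n))\<^sup>2)"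
    proof (rule summable_comparison_test')
      show "summable (\<lambda>n. 8 * S n + 2 * S (Suc n))"
        using Ssum by (intro summable_add summable_mult) (simp add: summable_Suc_iff)+
      fix n :: nat
      have "(cmod (D (Suc n) - D n))\<^sup>2 \<le> (2 * m n + m (Suc n))\<^sup>2"
        by (rule power_mono[OF DD]) simp
      also have "\<dots> \<le> 8 * (m n)\<^sup>2 + 2 * (m (Suc n))\<^sup>2"
        using sum_squares_bound[of "2 * m n" "m (Suc n)"] by (simp add: power2_sum power_mult_distrib)
      finally have "real (Suc n) * (cmod (D (Suc n) - D n))\<^sup>2 \<le> real (Suc n) * (8 * (m n)\<^sup>2 + 2 * (m (Suc n))\<^sup>2)"
        by (rule mult_left_mono) simp
      also have "\<dots> = 8 * (real (Suc n) * (m n)\<^sup>2) + 2 * (real (Suc n) * (m (Suc n))\<^sup>2)"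
        by (simp add: algebra_simps del: of_nat_Suc)
      also have "real (Suc n) * (m (Suc n))\<^sup>2 \<le> real (Suc (Suc n)) * (m (Suc n))\<^sup>2"
        by (rule mult_right_mono) auto
      finally show "norm (real (Suc n) * (cmod (D (Suc n) - D n))\<^sup>2) \<le> 8 * S n + 2 * S (Suc n)"
        using mS[of n] mS[of "Suc n"] by simp
    qed
  qed
  then have Gs: "summable (\<lambda>n. (cmod (G n))\<^sup>2 / real (Suc n))" unfolding nD .
  show ?thesis
  proof (rule summable_comparison_test')
    show "summable (\<lambda>n. 2 * ((cmod (G n))\<^sup>2 / real (Suc n)) + 2 * S n)"
      using Gs Ssum by (intro summable_add summable_mult)
    fix n :: nat
    have "(cmod (G n + e n))\<^sup>2 \<le> (cmod (G n) + m n)\<^sup>2"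
      by (rule power_mono) (use norm_triangle_ineq[of "G n" "e n"] em[of n] in auto)
    also have "\<dots> \<le> 2 * (cmod (G n))\<^sup>2 + 2 * (m n)\<^sup>2"
      using sum_squares_bound[of "cmod (G n)" "m n"] by (simp add: power2_sum)
    finally have "(cmod (G n + e n))\<^sup>2 / real (Suc n) \<le> (2 * (cmod (G n))\<^sup>2 + 2 * (m n)\<^sup>2) / real (Suc n)"
      by (rule divide_right_mono) simp
    also have "\<dots> = 2 * ((cmod (G n))\<^sup>2 / real (Suc n)) + 2 * ((m n)\<^sup>2 / real (Suc n))" by (simp add: add_divide_distrib)
    also have "(m n)\<^sup>2 / real (Suc n) \<le> real (Suc n) * (m n)\<^sup>2"
    proof -
      have "(m n)\<^sup>2 / real (Suc n) \<le> (m n)\<^sup>2 / 1" by (rule divide_left_mono) auto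
      also have "\<dots> \<le> real (Suc n) * (m n)\<^sup>2" using mult_right_mono[of 1 "real (Suc n)" "(m n)\<^sup>2"] by simp
      finally show ?thesis .
    qed
    finally show "norm ((cmod (V c h (x n) + 2 * of_nat (Suc n) * U c h (x n)))\<^sup>2 / real (Suc n))
        \<le> 2 * ((cmod (G n))\<^sup>2 / real (Suc n)) + 2 * S n"
      unfolding GV using mS[of n] by simp
  qed
qed

lemma zero_potential: "locally_bounded_potential (\<lambda>t. 0)"
  by (auto simp: locally_bounded_potential_def)

lemma adjoint_free_symmetric:
  assumes uv: "(u, v) \<in> adjoint_op (H_min x \<alpha> (\<lambda>t. 0))" and uv': "(u', v') \<in> adjoint_op (H_min x \<alpha> (\<lambda>t. 0))"
  shows "cinner v u' = cinner u v'"
proof -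
  obtain c w h where w: "sq_int w" "sq_int h" "u = l2_of w" "v = l2_of h" "w = U c h"
    by (rule adjoint_op_H_minE[OF zero_potential uv]) auto
  obtain d w' k where w': "sq_int w'" "sq_int k" "u' = l2_of w'" "v' = l2_of k" "w' = U d k"
    by (rule adjoint_op_H_minE[OF zero_potential uv']) auto
  define k' where "k' t = cnj (k t)" for t
  have hl: "loc_int h" by (rule sq_int_imp_loc_int[OF w(2)])
  have kl: "loc_int k'" unfolding k'_def[abs_def] by (rule loc_int_cnj[OF sq_int_imp_loc_int[OF w'(2)]])
  have U': "U (cnj d) k' t = cnj (w' t)" and V': "V (cnj d) k' t = cnj (V d k t)" for t
    unfolding k'_def[abs_def] w'(5) by (rule U_cnj V_cnj)+
  define W where "W n = U c h (x n) * V (cnj d) k' (x n) - V c h (x n) * U (cnj d) k' (x n)" for n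
  define K where "K t = h t * cnj (w' t) - w t * cnj (k t)" for t
  have i: "integrable leb_I (\<lambda>t. h t * cnj (w' t))" "integrable leb_I (\<lambda>t. w t * cnj (k t))"
    by (intro sq_int_mult_cnj w w')+
  have Ki: "integrable leb_I K" unfolding K_def[abs_def] by (rule Bochner_Integration.integrable_diff[OF i])
  have "W n = integral {0..x n} K" for n
    unfolding W_def UV_wronskian green(2)[OF hl kl x_nonneg, symmetric]
    by (rule integral_cong) (simp add: K_def U' w(5) k'_def)
  then have "W = (\<lambda>n. integral {0..x n} K)" by (rule ext)
  then have W: "W \<longlonglongrightarrow> integral\<^sup>L leb_I K"
    using tendsto_integral_leb_I[OF Ki x_at_top] by metis
  define y where "y n = U c h (x n)" for n
  define z where "z n = U d k (x n)" for n
  define G where "G n = V c h (x n) + 2 * of_nat (Suc n) * U c h (x n)" for n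
  define G' where "G' n = V d k (x n) + 2 * of_nat (Suc n) * U d k (x n)" for n
  \<comment> \<open>Adding the real multiple \<open>2 (n + 1)\<close> of \<open>U\<close> to
    \<open>V\<close> leaves the Wronskian unchanged, so the controlled combinations \<open>G\<close>
    and \<open>G'\<close> may replace the derivatives.\<close>
  have We: "W n = y n * cnj (G' n) - G n * cnj (z n)" for n
    by (simp add: W_def U' V' w'(5) G_def G'_def y_def z_def algebra_simps)
  have sums: "summable (\<lambda>n. (cmod (y n))\<^sup>2 / real (Suc n))" "summable (\<lambda>n. (cmod (z n))\<^sup>2 / real (Suc n))"
    "summable (\<lambda>n. (cmod (G n))\<^sup>2 / real (Suc n))" "summable (\<lambda>n. (cmod (G' n))\<^sup>2 / real (Suc n))"
    unfolding y_def z_def G_def G'_def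
    using summable_endpoint_values summable_endpoint_derivatives w w' by auto
  have "summable (\<lambda>n. cmod (W n) / real (Suc n))"
  proof (rule summable_comparison_test')
    show "summable (\<lambda>n. (cmod (y n))\<^sup>2 / real (Suc n) + (cmod (z n))\<^sup>2 / real (Suc n)
       + (cmod (G n))\<^sup>2 / real (Suc n) + (cmod (G' n))\<^sup>2 / real (Suc n))"
      by (intro summable_add sums)
    fix n :: nat
    have am: "a * b \<le> a\<^sup>2 + b\<^sup>2" if "a \<ge> 0" "b \<ge> 0" for a b :: real
      using sum_squares_bound[of a b] mult_nonneg_nonneg[OF that] by linarith
    have "cmod (W n) \<le> cmod (y n) * cmod (G' n) + cmod (G n) * cmod (z n)"
      unfolding We by (rule order_trans[OF norm_triangle_ineq4]) (simp add: norm_mult)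
    also have "\<dots> \<le> ((cmod (y n))\<^sup>2 + (cmod (G' n))\<^sup>2) + ((cmod (G n))\<^sup>2 + (cmod (z n))\<^sup>2)"
      by (intro add_mono am) auto
    finally have "cmod (W n) / real (Suc n) \<le> (((cmod (y n))\<^sup>2 + (cmod (G' n))\<^sup>2) + ((cmod (G n))\<^sup>2 + (cmod (z n))\<^sup>2)) / real (Suc n)"
      by (rule divide_right_mono) simp
    then show "norm (cmod (W n) / real (Suc n)) \<le> (cmod (y n))\<^sup>2 / real (Suc n) + (cmod (z n))\<^sup>2 / real (Suc n)
       + (cmod (G n))\<^sup>2 / real (Suc n) + (cmod (G' n))\<^sup>2 / real (Suc n)"
      by (simp add: add_divide_distrib)
  qed
  then have "integral\<^sup>L leb_I K = 0" by (rule tendsto_zero_if_weighted_summable[OF W])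
  then have "(\<integral>t. h t * cnj (w' t) \<partial>leb_I) - (\<integral>t. w t * cnj (k t) \<partial>leb_I) = 0"
    unfolding K_def[abs_def] using i by simp
  then show ?thesis unfolding w(3,4) w'(3,4) cinner_l2_of[OF w(2) w'(1)] cinner_l2_of[OF w(1) w'(2)] by simp
qed

theorem self_adjoint_free: "self_adjoint_op (Hamiltonian x \<alpha> (\<lambda>t. 0))"
  unfolding Hamiltonian_def
  by (rule self_adjoint_op_closure[OF linear_relation_H_min[OF zero_potential]
    H_min_subset_adjoint[OF zero_potential] adjoint_op_H_min_single_valued[OF zero_potential] adjoint_free_symmetric])

end

section \<open>The step potential\<close>

text \<open>
  The recursion \<open>(n + 2) a (n + 2) = (n + 1) a n\<close> has solutions of order \<open>n powr (- 1 / 2)\<close>; the weaker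
  rate \<open>n powr (- 1 / 4)\<close> survives the perturbation and suffices for summability.
\<close>

lemma summable_perturbed_recursion:
  fixes a :: "nat \<Rightarrow> real" and K :: real
  assumes a: "\<And>n. a n \<ge> 0" and K: "K \<ge> 0"
    and rec: "\<And>n. real (n + 2) * a (n + 2) \<le> real (n + 1) * a n
      + K / real (n + 1) * (a n + a (n + 1)) + K / real (n + 2) * (a (n + 1) + a (n + 2))"
  shows "summable (\<lambda>n. (a n)\<^sup>2 / real (Suc n))"
proof -
  \<comment> \<open>A supersolution: \<open>(n + 2) * r (n + 2)\<close> exceeds
    \<open>(n + 1) * r n\<close> by about \<open>r n / 2\<close>, whereas the terms with
    \<open>K\<close> are of order \<open>r n / n\<close>. With the exponent \<open>- 1 / 2\<close>
    this gap would vanish to leading order.\<close>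
  define r where "r n = real (n + 1) powr (- 1 / 4)" for n
  have r: "r n > 0" for n by (simp add: r_def)
  have "\<forall>\<^sub>F n in sequentially. (real (n + 1) + K / real (n + 1)) * r n + (K / real (n + 1) + K / real (n + 2)) * r (n + 1)
      \<le> (real (n + 2) - K / real (n + 2)) * r (n + 2)"
    unfolding r_def by real_asymp
  moreover have "\<forall>\<^sub>F n in sequentially. real (n + 2) - K / real (n + 2) > 0"
    by real_asymp
  ultimately have "\<forall>\<^sub>F n in sequentially. (real (n + 1) + K / real (n + 1)) * r n + (K / real (n + 1) + K / real (n + 2)) * r (n + 1)
      \<le> (real (n + 2) - K / real (n + 2)) * r (n + 2) \<and> real (n + 2) - K / real (n + 2) > 0"
    by (rule eventually_conj)
  then obtain N where N: "\<And>n. n \<ge> N \<Longrightarrow> (real (n + 1) + K / real (n + 1)) * r n + (K / real (n + 1) + K / real (n + 2)) * r (n + 1)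
      \<le> (real (n + 2) - K / real (n + 2)) * r (n + 2)" "\<And>n. n \<ge> N \<Longrightarrow> real (n + 2) - K / real (n + 2) > 0"
    unfolding eventually_sequentially by blast
  \<comment> \<open>Two consecutive ratios are needed to start the induction, since the recursion
    has order two.\<close>
  define M where "M = max (a N / r N) (a (N + 1) / r (N + 1))"
  have M0: "M \<ge> 0" using a[of N] r[of N] by (auto simp: M_def le_max_iff_disj)
  have b: "a (N + k) \<le> M * r (N + k) \<and> a (N + k + 1) \<le> M * r (N + k + 1)" for k
  proof (induction k)
    case 0
    have "a N / r N \<le> M" "a (N + 1) / r (N + 1) \<le> M" by (auto simp: M_def)
    then show ?case using r[of N] r[of "N + 1"] by (simp add: pos_divide_le_eq)
  next
    case (Suc k)
    define n where "n = N + k"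
    have n: "n \<ge> N" by (simp add: n_def)
    have IH: "a n \<le> M * r n" "a (n + 1) \<le> M * r (n + 1)" using Suc by (simp_all add: n_def)
    have "(real (n + 2) - K / real (n + 2)) * a (n + 2)
        \<le> (real (n + 1) + K / real (n + 1)) * a n + (K / real (n + 1) + K / real (n + 2)) * a (n + 1)"
      using rec[of n] by (simp add: algebra_simps add_divide_distrib)
    also have "\<dots> \<le> (real (n + 1) + K / real (n + 1)) * (M * r n) + (K / real (n + 1) + K / real (n + 2)) * (M * r (n + 1))"
      by (intro add_mono mult_left_mono IH) (use K in auto)
    also have "\<dots> = M * ((real (n + 1) + K / real (n + 1)) * r n + (K / real (n + 1) + K / real (n + 2)) * r (n + 1))"
      by (simp only: algebra_simps)
    also have "\<dots> \<le> M * ((real (n + 2) - K / real (n + 2)) * r (n + 2))"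
      by (rule mult_left_mono[OF N(1)[OF n] M0])
    also have "\<dots> = (real (n + 2) - K / real (n + 2)) * (M * r (n + 2))" by (simp only: mult.left_commute)
    finally have "a (n + 2) \<le> M * r (n + 2)"
      using N(2)[OF n] by (simp only: mult_le_cancel_left_pos)
    then show ?case using IH by (simp add: n_def)
  qed
  have "summable (\<lambda>n. real n powr (- 3 / 2))" by (subst summable_real_powr_iff) simp
  then have "summable (\<lambda>n. real (Suc n) powr (- 3 / 2))" by (subst summable_Suc_iff)
  then have s: "summable (\<lambda>n. M\<^sup>2 * real (Suc n) powr (- 3 / 2))" by (rule summable_mult)
  show ?thesis
  proof (rule summable_comparison_test'[OF s, of N])
    fix n assume "n \<ge> N"
    then obtain k where "n = N + k" using le_Suc_ex by blast
    then have "a n \<le> M * r n" using b[of k] by simp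
    then have "(a n)\<^sup>2 \<le> (M * r n)\<^sup>2" using a by (intro power_mono) auto
    then have "(a n)\<^sup>2 / real (Suc n) \<le> (M * r n)\<^sup>2 / real (Suc n)" by (rule divide_right_mono) simp
    also have "\<dots> = M\<^sup>2 * ((r n)\<^sup>2 / real (Suc n))" by (simp add: power_mult_distrib)
    also have "(r n)\<^sup>2 / real (Suc n) = real (Suc n) powr (- 3 / 2)"
    proof -
      have "(r n)\<^sup>2 = real (Suc n) powr (- 1 / 2)"
        unfolding r_def power2_eq_square powr_add[symmetric] by simp
      then have "(r n)\<^sup>2 / real (Suc n) = real (Suc n) powr (- 1 / 2) / real (Suc n) powr 1" by simp
      then show ?thesis unfolding powr_diff[symmetric] by simp
    qed
    finally show "norm ((a n)\<^sup>2 / real (Suc n)) \<le> M\<^sup>2 * real (Suc n) powr (- 3 / 2)" by simp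
  qed
qed

section \<open>A Volterra uniqueness statement, and explicit solutions for the step
  potential\<close>

context point_interactions begin

text \<open>Gronwall's inequality, via the maximum of \<open>|e t| exp (- 2 L t)\<close>.\<close>

lemma U_volterra_unique:
  assumes k: "loc_int k" and M: "\<And>t. 0 \<le> t \<Longrightarrow> t \<le> T \<Longrightarrow> cmod (k t) \<le> M * cmod (U 0 k t)" and t: "0 \<le> t" "t \<le> T"
  shows "U 0 k t = 0"
proof -
  define e where "e = U 0 k"
  have ce: "continuous_on {0..T} e" unfolding e_def by (rule continuous_on_U[OF k])
  have cne: "continuous_on {0..T} (\<lambda>t. cmod (e t))" using ce by (intro continuous_intros)
  have T0: "0 \<le> T" using t by simp
  have bd: "\<exists>C. \<forall>t\<in>{0..T}. \<bar>lin_sol y p t\<bar> \<le> C" for y p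
  proof -
    have "continuous_on {0..T} (lin_sol y p)" by (rule continuous_on_subset[OF continuous_on_lin_sol]) auto
    then have "bounded (lin_sol y p ` {0..T})" by (intro compact_imp_bounded compact_continuous_image compact_Icc)
    then show ?thesis unfolding bounded_iff by auto
  qed
  obtain C1 C2 where C1: "\<And>t. t \<in> {0..T} \<Longrightarrow> \<bar>lin_sol 1 0 t\<bar> \<le> C1" and C2: "\<And>t. t \<in> {0..T} \<Longrightarrow> \<bar>lin_sol 0 1 t\<bar> \<le> C2"
    using bd by metis
  have C0: "0 \<le> C1" "0 \<le> C2" using C1[of 0] C2[of 0] T0 by auto
  \<comment> \<open>\<open>C1 * C2 * \<bar>M\<bar>\<close> arises once from \<open>A\<close> times
    \<open>\<theta>\<close> and once from \<open>B\<close> times \<open>\<phi>\<close>; the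
    \<open>+ 1\<close> makes \<open>L\<close> positive.\<close>
  define L where "L = 2 * C1 * C2 * \<bar>M\<bar> + 1"
  have L: "L > 0" using C0 by (simp add: L_def add_nonneg_pos)
  have key: "cmod (e s) \<le> L * integral {0..s} (\<lambda>r. cmod (e r))" if s: "s \<in> {0..T}" for s
  proof -
    have int: "cmod (integral {0..s} (\<lambda>r. complex_of_real (lin_sol y p r) * k r)) \<le> C * \<bar>M\<bar> * integral {0..s} (\<lambda>r. cmod (e r))"
      if C: "\<And>t. t \<in> {0..T} \<Longrightarrow> \<bar>lin_sol y p t\<bar> \<le> C" for y p C
    proof -
      have "C \<ge> 0" using C[of 0] T0 by auto
      have "cmod (integral {0..s} (\<lambda>r. complex_of_real (lin_sol y p r) * k r)) \<le> integral {0..s} (\<lambda>r. C * \<bar>M\<bar> * cmod (e r))"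
      proof (rule integral_norm_bound_integral)
        show "(\<lambda>r. complex_of_real (lin_sol y p r) * k r) integrable_on {0..s}"
          using loc_int_lin_sol[OF k] by (simp add: loc_int_def absolutely_integrable_on_def)
        show "(\<lambda>r. C * \<bar>M\<bar> * cmod (e r)) integrable_on {0..s}"
          using s by (intro integrable_continuous_real continuous_intros continuous_on_subset[OF ce]) auto
        fix r assume "r \<in> {0..s}"
        then have r: "r \<in> {0..T}" using s by auto
        have "cmod (k r) \<le> M * cmod (e r)" using M[of r] r by (simp add: e_def)
        also have "\<dots> \<le> \<bar>M\<bar> * cmod (e r)" by (rule mult_right_mono) auto
        finally have kr: "cmod (k r) \<le> \<bar>M\<bar> * cmod (e r)" .
        have "norm (complex_of_real (lin_sol y p r) * k r) = \<bar>lin_sol y p r\<bar> * cmod (k r)" by (simp add: norm_mult)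
        also have "\<dots> \<le> C * (\<bar>M\<bar> * cmod (e r))" by (rule mult_mono[OF C[OF r] kr]) (use \<open>C \<ge> 0\<close> in auto)
        finally show "norm (complex_of_real (lin_sol y p r) * k r) \<le> C * \<bar>M\<bar> * cmod (e r)" by (simp add: mult.assoc)
      qed
      then show ?thesis by simp
    qed
    define E where "E = integral {0..s} (\<lambda>r. cmod (e r))"
    have E0: "E \<ge> 0" unfolding E_def
      by (rule Henstock_Kurzweil_Integration.integral_nonneg[OF
        integrable_continuous_real[OF continuous_on_subset[OF cne]]]) (use s in auto)
    have "cmod (e s) \<le> cmod (A 0 k s) * \<bar>lin_sol 1 0 s\<bar> + cmod (B k s) * \<bar>lin_sol 0 1 s\<bar>"
      unfolding e_def U_def by (rule order_trans[OF norm_triangle_ineq]) (simp add: norm_mult)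
    also have "\<dots> \<le> (C2 * \<bar>M\<bar> * E) * C1 + (C1 * \<bar>M\<bar> * E) * C2"
      by (intro add_mono mult_mono C1[OF s] C2[OF s])
         (use int[OF C1] int[OF C2] C0 E0 in \<open>auto simp: A_def B_def E_def\<close>)
    also have "\<dots> = (2 * C1 * C2 * \<bar>M\<bar>) * E" by (simp add: algebra_simps)
    also have "\<dots> \<le> L * E" unfolding L_def using E0 by (simp add: algebra_simps)
    finally show ?thesis unfolding E_def .
  qed
  \<comment> \<open>In the norm with this weight the integral bound in \<open>key\<close> gains the
    factor \<open>1 / 2\<close>, so the maximum must be 0.\<close>
  define w where "w s = cmod (e s) * exp (- (2 * L * s))" for s
  have "continuous_on {0..T} w" unfolding w_def using ce by (intro continuous_intros)
  then obtain s where s: "s \<in> {0..T}" and smax: "\<And>r. r \<in> {0..T} \<Longrightarrow> w r \<le> w s"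
    using continuous_attains_sup[of "{0..T}" w] T0 by auto
  define S where "S = w s"
  have S0: "S \<ge> 0" by (simp add: S_def w_def)
  have er: "cmod (e r) \<le> S * exp (2 * L * r)" if "r \<in> {0..T}" for r
  proof -
    have "cmod (e r) = w r * exp (2 * L * r)" by (simp add: w_def exp_minus)
    also have "\<dots> \<le> S * exp (2 * L * r)" unfolding S_def by (rule mult_right_mono[OF smax[OF that]]) simp
    finally show ?thesis .
  qed
  have ex: "((\<lambda>r. S * exp (2 * L * r)) has_integral S * exp (2 * L * s) / (2 * L) - S * exp (2 * L * 0) / (2 * L)) {0..s}"
    using s L by (intro fundamental_theorem_of_calculus)
      (auto intro!: derivative_eq_intros simp flip: has_real_derivative_iff_has_vector_derivative)
  have "integral {0..s} (\<lambda>r. cmod (e r)) \<le> S * exp (2 * L * s) / (2 * L) - S * exp (2 * L * 0) / (2 * L)"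
  proof (rule has_integral_le[OF integrable_integral ex])
    show "(\<lambda>r. cmod (e r)) integrable_on {0..s}"
      by (rule integrable_continuous_real[OF continuous_on_subset[OF cne]]) (use s in auto)
  qed (use er s in auto)
  also have "\<dots> \<le> S * exp (2 * L * s) / (2 * L)" using S0 L by simp
  finally have "L * integral {0..s} (\<lambda>r. cmod (e r)) \<le> L * (S * exp (2 * L * s) / (2 * L))"
    using L by (intro mult_left_mono) auto
  then have "cmod (e s) \<le> S * exp (2 * L * s) / 2" using key[OF s] L by simp
  then have le: "w s \<le> S * exp (2 * L * s) / 2 * exp (- (2 * L * s))"
    unfolding w_def by (rule mult_right_mono) simp
  have eq: "S * exp (2 * L * s) / 2 * exp (- (2 * L * s)) = S / 2" by (simp add: exp_minus)
  have "w s \<le> S / 2" by (rule ord_le_eq_trans[OF le eq])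
  then have "S \<le> S / 2" unfolding S_def .
  then have "S = 0" using S0 by simp
  then show ?thesis using er[of t] t by (simp add: e_def)
qed

lemma U_diff_cmult:
  assumes h: "loc_int h" and k: "loc_int k"
  shows "U c h t - b * U d k t = U (c - b * d) (\<lambda>t. h t - b * k t) t"
proof -
  have i: "integral {0..t} (\<lambda>s. complex_of_real (lin_sol y p s) * (h s - b * k s))
     = integral {0..t} (\<lambda>s. complex_of_real (lin_sol y p s) * h s) - b * integral {0..t} (\<lambda>s. complex_of_real (lin_sol y p s) * k s)" for y p
  proof -
    have "(\<lambda>s. complex_of_real (lin_sol y p s) * h s) integrable_on {0..t}" "(\<lambda>s. complex_of_real (lin_sol y p s) * k s) integrable_on {0..t}"
      using loc_int_lin_sol[OF h] loc_int_lin_sol[OF k] by (simp_all add: loc_int_def absolutely_integrable_on_def)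
    then have "((\<lambda>s. complex_of_real (lin_sol y p s) * h s - b * (complex_of_real (lin_sol y p s) * k s)) has_integral
       integral {0..t} (\<lambda>s. complex_of_real (lin_sol y p s) * h s) - b * integral {0..t} (\<lambda>s. complex_of_real (lin_sol y p s) * k s)) {0..t}"
      by (intro has_integral_diff has_integral_mult_right integrable_integral)
    then have "((\<lambda>s. complex_of_real (lin_sol y p s) * (h s - b * k s)) has_integral
       integral {0..t} (\<lambda>s. complex_of_real (lin_sol y p s) * h s) - b * integral {0..t} (\<lambda>s. complex_of_real (lin_sol y p s) * k s)) {0..t}"
      by (rule has_integral_eq[rotated]) algebra
    then show ?thesis by (rule integral_unique)
  qed
  show ?thesis unfolding U_def A_def B_def i by algebra
qed

end

context point_interactions begin

lemma q_step_segment: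
  assumes t: "x n < t" "t < x (Suc n)"
  shows "q_step x a t = a\<^sup>2 * (real (Suc n))\<^sup>2"
proof -
  have s: "(\<lambda>m. (real (Suc m))\<^sup>2 * indicat_real {x m<..<x (Suc m)} t) sums (real (Suc n))\<^sup>2"
  proof -
    have "(real (Suc m))\<^sup>2 * indicat_real {x m<..<x (Suc m)} t = (if m = n then (real (Suc m))\<^sup>2 else 0)" for m
    proof (cases "m = n")
      case False
      then have "\<not> (x m < t \<and> t < x (Suc m))"
        using idx_eq[of m t] idx_eq[of n t] t by (metis less_imp_le)
      then show ?thesis using False by (simp add: indicator_def)
    qed (use t in simp)
    then show ?thesis using sums_single[of n "\<lambda>m. (real (Suc m))\<^sup>2"] by simp
  qed
  show ?thesis unfolding q_step_def sums_unique[OF s, symmetric] ..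
qed

lemma q_step_grid_point: "q_step x a (x n) = 0"
proof -
  have "indicat_real {x m<..<x (Suc m)} (x n) = 0" for m
    using strict_mono_less[OF x_strict_mono, of m n] strict_mono_less[OF x_strict_mono, of n "Suc m"] by simp
  then show ?thesis by (simp add: q_step_def)
qed

lemma q_step_bounds:
  assumes "0 \<le> t" "t < x n"
  shows "0 \<le> q_step x a t \<and> q_step x a t \<le> a\<^sup>2 * (real n)\<^sup>2"
proof -
  define k where "k = idx t"
  have k: "x k \<le> t" "t < x (Suc k)" unfolding k_def by (rule idx_bounds[OF assms(1)])+
  show ?thesis
  proof (cases "t = x k")
    case True
    then show ?thesis by (simp add: q_step_grid_point)
  next
    case False
    have "x k < x n" using k assms by simp
    then have "k < n" by (simp add: strict_mono_less[OF x_strict_mono])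
    then have "(real (Suc k))\<^sup>2 \<le> (real n)\<^sup>2" by (intro power_mono) auto
    then have "a\<^sup>2 * (real (Suc k))\<^sup>2 \<le> a\<^sup>2 * (real n)\<^sup>2" by (rule mult_left_mono) simp
    moreover have "q_step x a t = a\<^sup>2 * (real (Suc k))\<^sup>2"
      by (rule q_step_segment) (use False k in auto)
    ultimately show ?thesis by (simp del: of_nat_Suc)
  qed
qed

lemma locally_bounded_q_step: "locally_bounded_potential (q_step x a)"
  unfolding locally_bounded_potential_def
proof (intro conjI allI)
  have "q_step x a \<in> borel_measurable borel" unfolding q_step_def[abs_def] by measurable
  then show "q_step x a \<in> borel_measurable leb_I"
    by (intro measurable_restrict_space1 measurable_completion) simp
  fix T
  obtain n where "T < x n" using x_unbounded by blast
  then have "\<bar>q_step x a t\<bar> \<le> a\<^sup>2 * (real n)\<^sup>2" if "t \<in> {0..T}" for t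
    using q_step_bounds[of t n a] that by auto
  then show "\<exists>M. \<forall>t\<in>{0..T}. \<bar>q_step x a t\<bar> \<le> M" by blast
qed

text \<open>
  \<open>sol a z\<close> solves \<open>- f'' + q f = z f\<close>, \<open>f 0 = 1\<close>, \<open>f' 0 = 0\<close> with the interface conditions;
  \<open>sol_state a z n\<close> consists of its value and its right derivative at \<open>x n\<close>.
\<close>

definition kappa :: "real \<Rightarrow> complex \<Rightarrow> nat \<Rightarrow> complex" where
  "kappa a z n = csqrt (complex_of_real (a\<^sup>2 * (real (Suc n))\<^sup>2) - z)"

primrec sol_state :: "real \<Rightarrow> complex \<Rightarrow> nat \<Rightarrow> complex \<times> complex" where
  "sol_state a z 0 = (1, 0)"
| "sol_state a z (Suc n) = (let k = kappa a z n; s = k * complex_of_real (x (Suc n) - x n);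
      y = fst (sol_state a z n); p = snd (sol_state a z n); y' = y * cosh s + p * sinh s / k
    in (y', y * k * sinh s + p * cosh s + complex_of_real (\<alpha> (Suc n)) * y'))"

definition seg :: "real \<Rightarrow> complex \<Rightarrow> nat \<Rightarrow> real \<Rightarrow> complex" where
  "seg a z n t = fst (sol_state a z n) * cosh (kappa a z n * complex_of_real (t - x n))
    + snd (sol_state a z n) * sinh (kappa a z n * complex_of_real (t - x n)) / kappa a z n"

definition seg' :: "real \<Rightarrow> complex \<Rightarrow> nat \<Rightarrow> real \<Rightarrow> complex" where
  "seg' a z n t = fst (sol_state a z n) * kappa a z n * sinh (kappa a z n * complex_of_real (t - x n))
    + snd (sol_state a z n) * cosh (kappa a z n * complex_of_real (t - x n))"

definition sol :: "real \<Rightarrow> complex \<Rightarrow> real \<Rightarrow> complex" where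
  "sol a z t = seg a z (idx t) t"

definition sol' :: "real \<Rightarrow> complex \<Rightarrow> real \<Rightarrow> complex" where
  "sol' a z t = seg' a z (idx t) t"

lemma kappa_square: "(kappa a z n)\<^sup>2 = complex_of_real (a\<^sup>2 * (real (Suc n))\<^sup>2) - z"
  by (simp add: kappa_def)

lemma kappa_nonzero:
  assumes "a > 0" "Re z = 0"
  shows "kappa a z n \<noteq> 0"
proof
  assume "kappa a z n = 0"
  then have "complex_of_real (a\<^sup>2 * (real (Suc n))\<^sup>2) - z = 0" using kappa_square[of a z n] by simp
  then have "Re (complex_of_real (a\<^sup>2 * (real (Suc n))\<^sup>2)) = Re z" by (metis eq_iff_diff_eq_0)
  then show False using assms by simp
qed

lemma seg_derivs:
  assumes "a > 0" "Re z = 0"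
  shows "(seg a z n has_vector_derivative seg' a z n t) (at t within S)"
    and "(seg' a z n has_vector_derivative (kappa a z n)\<^sup>2 * seg a z n t) (at t within S)"
proof -
  let ?k = "kappa a z n"
  have k: "?k \<noteq> 0" by (rule kappa_nonzero[OF assms])
  \<comment> \<open>On each segment the solution is the restriction of an entire function, so
    complex derivatives can be taken and restricted to the real line.\<close>
  define F where "F w = fst (sol_state a z n) * cosh (?k * (w - complex_of_real (x n)))
    + snd (sol_state a z n) * sinh (?k * (w - complex_of_real (x n))) / ?k" for w
  define F' where "F' w = fst (sol_state a z n) * ?k * sinh (?k * (w - complex_of_real (x n)))
    + snd (sol_state a z n) * cosh (?k * (w - complex_of_real (x n)))" for w
  have "(F has_field_derivative F' w) (at w)" for w
    unfolding F_def F'_def using k by (auto intro!: derivative_eq_intros)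
  from has_vector_derivative_real_field[OF this]
  show "(seg a z n has_vector_derivative seg' a z n t) (at t within S)"
    by (simp add: F_def F'_def seg_def[abs_def] seg'_def)
  have "(F' has_field_derivative ?k\<^sup>2 * F w) (at w)" for w
    unfolding F_def F'_def using k by (auto intro!: derivative_eq_intros simp: power2_eq_square field_simps)
  from has_vector_derivative_real_field[OF this]
  show "(seg' a z n has_vector_derivative ?k\<^sup>2 * seg a z n t) (at t within S)"
    by (simp add: F_def F'_def seg_def seg'_def[abs_def])
qed

lemma seg_start: "seg a z n (x n) = fst (sol_state a z n)" "seg' a z n (x n) = snd (sol_state a z n)"
  by (simp_all add: seg_def seg'_def)

lemma seg_end: "seg a z n (x (Suc n)) = fst (sol_state a z (Suc n))"
  "seg' a z n (x (Suc n)) + complex_of_real (\<alpha> (Suc n)) * fst (sol_state a z (Suc n)) = snd (sol_state a z (Suc n))"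
  by (simp_all add: seg_def seg'_def Let_def)

lemma sol_segment:
  assumes t: "x n \<le> t" "t \<le> x (Suc n)"
  shows "sol a z t = seg a z n t"
proof (cases "t < x (Suc n)")
  case True
  then show ?thesis using t by (simp add: sol_def idx_eq)
next
  case False
  then have "t = x (Suc n)" using t by simp
  then show ?thesis using seg_end(1)[of a z n] seg_start(1)[of a z "Suc n"] by (simp add: sol_def idx_x)
qed

lemma continuous_on_seg:
  assumes "a > 0" "Re z = 0"
  shows "continuous_on S (seg a z n)" "continuous_on S (seg' a z n)"
  unfolding continuous_on_eq_continuous_within
  using has_vector_derivative_continuous seg_derivs[OF assms] by blast+

lemma continuous_on_sol:
  assumes "a > 0" "Re z = 0"
  shows "continuous_on {0..} (sol a z)"
proof (rule continuous_on_atLeast_0_segments)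
  fix k
  show "continuous_on {x k..x (Suc k)} (sol a z)"
    using continuous_on_seg(1)[OF assms, where n = k] by (rule continuous_on_eq) (rule sol_segment[symmetric]; simp)
qed

text \<open>Uniqueness identifies the explicit solution with variation of constants for the source
  \<open>(z - q) * sol\<close>. In this way \<open>V_jump\<close>, the integration by parts and the
  description of the adjoint apply to it.\<close>

lemma sol_eq_U:
  assumes a: "a > 0" and z: "Re z = 0"
  defines "h \<equiv> \<lambda>t. (z - complex_of_real (q_step x a t)) * sol a z t"
  shows "loc_int h" and "\<And>t. 0 \<le> t \<Longrightarrow> sol a z t = U 1 h t"
proof -
  have sl: "loc_int (sol a z)"
    unfolding loc_int_def
    by (intro allI absolutely_integrable_continuous_real continuous_on_subset[OF continuous_on_sol[OF a z]]) auto
  have "loc_int (\<lambda>t. z * sol a z t - complex_of_real (q_step x a t) * sol a z t)"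
    by (intro loc_int_diff loc_int_mult_continuous[OF sl] continuous_on_const
        loc_int_potential_mult[OF locally_bounded_q_step sl])
  then show hl: "loc_int h" by (simp add: h_def left_diff_distrib)
  have s0: "sol a z 0 = 1"
    using sol_segment[of 0 "x 0" a z] x_less_Suc[of 0] by (simp add: x_0 seg_start(1)[of a z 0, unfolded x_0])
  have s'0: "sol' a z 0 = 0"
    using idx_x[of 0] seg_start(2)[of a z 0] by (simp add: sol'_def x_0)
  have der: "(sol a z has_vector_derivative sol' a z t) (at t within {0..})" if t: "0 \<le> t" "t \<notin> X" for t
  proof -
    define k where "k = idx t"
    have k: "x k \<le> t" "t < x (Suc k)" unfolding k_def by (rule idx_bounds[OF t(1)])+
    have "(sol a z has_vector_derivative seg' a z k t) (at t within {x k..x (Suc k)})"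
      by (rule has_vector_derivative_transform[OF _ _ seg_derivs(1)[OF a z, where n = k]]) (use k sol_segment[of k] in auto)
    then show ?thesis using at_within_segment[OF t] by (simp add: k_def sol'_def)
  qed
  have inc: "sol' a z t - sol' a z s = - integral {s..t} h"
    if st: "0 \<le> s" "s \<le> t" "{s..t} \<inter> X = {}" for s t
  proof -
    define k where "k = idx s"
    have k: "x k \<le> s" unfolding k_def by (rule idx_bounds[OF st(1)])
    have kt: "idx t = k" unfolding k_def by (rule same_segment[OF st])
    have t: "t < x (Suc k)" using idx_bounds(2)[of t] st by (simp add: kt)
    have "((\<lambda>r. (kappa a z k)\<^sup>2 * seg a z k r) has_integral seg' a z k t - seg' a z k s) {s..t}"
      by (rule fundamental_theorem_of_calculus[OF st(2)]) (rule seg_derivs(2)[OF a z])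
    then have "((\<lambda>r. - h r) has_integral seg' a z k t - seg' a z k s) {s..t}"
    proof (rule has_integral_spike[of "{x k}", rotated 2])
      fix r assume r: "r \<in> {s..t} - {x k}"
      then have "x k < r" "r < x (Suc k)" using k t by auto
      then show "- h r = (kappa a z k)\<^sup>2 * seg a z k r"
        using sol_segment[of k r a z] unfolding kappa_square h_def q_step_segment[OF \<open>x k < r\<close> \<open>r < x (Suc k)\<close>]
        by (simp add: algebra_simps)
    qed simp
    then have "((\<lambda>r. h r) has_integral - (seg' a z k t - seg' a z k s)) {s..t}"
      using has_integral_neg[of "\<lambda>r. - h r" "seg' a z k t - seg' a z k s" "{s..t}"] by simp
    then have "integral {s..t} h = - (seg' a z k t - seg' a z k s)" by (rule integral_unique)
    then show ?thesis by (simp add: sol'_def kt k_def[symmetric])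
  qed
  have ic: "interface_condition (sol a z) (sol' a z)"
    unfolding interface_condition_def
  proof (intro allI impI)
    fix n :: nat assume "1 \<le> n"
    then obtain k where n: "n = Suc k" using Suc_le_D by auto
    have c: "(seg a z j \<longlongrightarrow> seg a z j (x i)) (at (x i) within S)" "(seg' a z j \<longlongrightarrow> seg' a z j (x i)) (at (x i) within S)" for i j S
      using has_vector_derivative_continuous[OF seg_derivs(1)[OF a z]] has_vector_derivative_continuous[OF seg_derivs(2)[OF a z]]
      unfolding continuous_within by blast+
    have 1: "(sol a z \<longlongrightarrow> fst (sol_state a z (Suc k))) (at_right (x (Suc k)))"
    proof (rule Lim_transform_eventually)
      show "(seg a z (Suc k) \<longlongrightarrow> fst (sol_state a z (Suc k))) (at_right (x (Suc k)))"
        using c(1)[of "Suc k" "Suc k"] unfolding seg_start .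
      show "\<forall>\<^sub>F t in at_right (x (Suc k)). seg a z (Suc k) t = sol a z t"
        using eventually_at_right_segment[of "Suc k"] by eventually_elim (rule sol_segment[symmetric]; simp)
    qed
    have 2: "(sol a z \<longlongrightarrow> fst (sol_state a z (Suc k))) (at_left (x (Suc k)))"
    proof (rule Lim_transform_eventually)
      show "(seg a z k \<longlongrightarrow> fst (sol_state a z (Suc k))) (at_left (x (Suc k)))"
        using c(1)[of k "Suc k"] unfolding seg_end .
      show "\<forall>\<^sub>F t in at_left (x (Suc k)). seg a z k t = sol a z t"
        using eventually_at_left_segment[of k] by eventually_elim (rule sol_segment[symmetric]; simp)
    qed
    have 3: "(sol' a z \<longlongrightarrow> snd (sol_state a z (Suc k))) (at_right (x (Suc k)))"
    proof (rule Lim_transform_eventually)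
      show "(seg' a z (Suc k) \<longlongrightarrow> snd (sol_state a z (Suc k))) (at_right (x (Suc k)))"
        using c(2)[of "Suc k" "Suc k"] unfolding seg_start .
      show "\<forall>\<^sub>F t in at_right (x (Suc k)). seg' a z (Suc k) t = sol' a z t"
        using eventually_at_right_segment[of "Suc k"] by eventually_elim (simp add: sol'_def idx_eq[of "Suc k"])
    qed
    have 4: "(sol' a z \<longlongrightarrow> seg' a z k (x (Suc k))) (at_left (x (Suc k)))"
    proof (rule Lim_transform_eventually)
      show "(seg' a z k \<longlongrightarrow> seg' a z k (x (Suc k))) (at_left (x (Suc k)))" by (rule c(2))
      show "\<forall>\<^sub>F t in at_left (x (Suc k)). seg' a z k t = sol' a z t"
        using eventually_at_left_segment[of k] by eventually_elim (simp add: sol'_def idx_eq[of k])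
    qed
    have "snd (sol_state a z (Suc k)) - seg' a z k (x (Suc k)) = complex_of_real (\<alpha> (Suc k)) * fst (sol_state a z (Suc k))"
      unfolding seg_end(2)[of a z k, symmetric] by simp
    with 1 2 3 4 show "\<exists>v p m. (sol a z \<longlongrightarrow> v) (at_right (x n)) \<and> (sol a z \<longlongrightarrow> v) (at_left (x n)) \<and>
      (sol' a z \<longlongrightarrow> p) (at_right (x n)) \<and> (sol' a z \<longlongrightarrow> m) (at_left (x n)) \<and> p - m = complex_of_real (\<alpha> n) * v"
      unfolding n by blast
  qed
  \<comment> \<open>Uniqueness speaks about points off \<open>X\<close> only; continuity extends the
    equality to the grid points.\<close>
  have off: "sol a z t = U 1 h t" if "0 \<le> t" "t \<notin> X" for t
    using solution_eq_UV(1)[OF hl s'0 der inc ic that] by (simp add: s0)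
  have "AE t in leb_I. sol a z t - U 1 h t = 0"
    unfolding AE_leb_I_iff_negligible using negligible_X off by auto
  moreover have "continuous_on {0..} (\<lambda>t. sol a z t - U 1 h t)"
    by (intro continuous_on_diff continuous_on_sol[OF a z] continuous_on_atLeast_0[OF continuous_on_U[OF hl]])
  ultimately show "sol a z t = U 1 h t" if "0 \<le> t" for t
    using continuous_AE_zero[of "\<lambda>t. sol a z t - U 1 h t" t] that by simp
qed

lemma sol_0: "a > 0 \<Longrightarrow> Re z = 0 \<Longrightarrow> sol a z 0 = 1"
  using sol_eq_U(2)[of a z 0] by (simp add: U_0)

text \<open>Since \<open>Re (q - z) \<ge> 0\<close>, the function \<open>|sol|\<^sup>2\<close> is convex between two grid points.\<close>

lemma sol_bound:
  assumes a: "a > 0" and z: "Re z = 0" and t: "x n \<le> t" "t \<le> x (Suc n)"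
  shows "(cmod (sol a z t))\<^sup>2 \<le> (cmod (sol a z (x n)))\<^sup>2 + (cmod (sol a z (x (Suc n))))\<^sup>2"
    and "cmod (sol a z t) \<le> cmod (sol a z (x n)) + cmod (sol a z (x (Suc n)))"
proof -
  let ?f = "seg a z n" and ?f' = "seg' a z n" and ?k = "(kappa a z n)\<^sup>2"
  define g where "g t = (cmod (?f t))\<^sup>2" for t
  have gRe: "g t = Re (cnj (?f t) * ?f t)" for t
    unfolding g_def cmod_power2 by (simp add: power2_eq_square)
  note d1 = seg_derivs(1)[OF a z] and d2 = seg_derivs(2)[OF a z]
  have der1: "(g has_real_derivative Re (cnj (?f t) * ?f' t + cnj (?f' t) * ?f t)) (at t)" for t
    unfolding gRe[abs_def]
    by (intro has_field_derivative_Re has_vector_derivative_mult has_vector_derivative_cnj d1)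
  have der2: "((\<lambda>t. Re (cnj (?f t) * ?f' t + cnj (?f' t) * ?f t)) has_real_derivative
     Re ((cnj (?f t) * (?k * ?f t) + cnj (?f' t) * ?f' t) + (cnj (?f' t) * ?f' t + cnj (?k * ?f t) * ?f t))) (at t)" for t
    by (intro has_field_derivative_Re has_vector_derivative_add has_vector_derivative_mult has_vector_derivative_cnj d1 d2)
  have nonneg: "0 \<le> Re ((cnj (?f t) * (?k * ?f t) + cnj (?f' t) * ?f' t) + (cnj (?f' t) * ?f' t + cnj (?k * ?f t) * ?f t))" for t
  proof -
    have k: "Re ?k \<ge> 0" unfolding kappa_square using z by simp
    have "Re ((cnj u * (c * u) + cnj v * v) + (cnj v * v + cnj (c * u) * u))
        = 2 * (Re c * ((Re u)\<^sup>2 + (Im u)\<^sup>2)) + 2 * ((Re v)\<^sup>2 + (Im v)\<^sup>2)" for u v c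
      by (simp add: algebra_simps power2_eq_square)
    then have "Re ((cnj (?f t) * (?k * ?f t) + cnj (?f' t) * ?f' t) + (cnj (?f' t) * ?f' t + cnj (?k * ?f t) * ?f t))
        = 2 * (Re ?k * ((Re (?f t))\<^sup>2 + (Im (?f t))\<^sup>2)) + 2 * ((Re (?f' t))\<^sup>2 + (Im (?f' t))\<^sup>2)" .
    moreover have "0 \<le> 2 * (Re ?k * ((Re (?f t))\<^sup>2 + (Im (?f t))\<^sup>2)) + 2 * ((Re (?f' t))\<^sup>2 + (Im (?f' t))\<^sup>2)"
      by (intro add_nonneg_nonneg mult_nonneg_nonneg k) auto
    ultimately show ?thesis by metis
  qed
  have "convex_on {x n..x (Suc n)} g"
    by (rule f''_ge0_imp_convex[OF _ der1 der2 nonneg]) simp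
  then have "g t \<le> max (g (x n)) (g (x (Suc n)))" by (rule convex_on_le_max) (use t in simp)
  moreover have "g r = (cmod (sol a z r))\<^sup>2" if "r \<in> {x n..x (Suc n)}" for r
    using sol_segment[of n r a z] that by (simp add: g_def)
  ultimately have m: "(cmod (sol a z t))\<^sup>2 \<le> max ((cmod (sol a z (x n)))\<^sup>2) ((cmod (sol a z (x (Suc n))))\<^sup>2)"
    using t x_less_Suc[of n] by simp
  then show le: "(cmod (sol a z t))\<^sup>2 \<le> (cmod (sol a z (x n)))\<^sup>2 + (cmod (sol a z (x (Suc n))))\<^sup>2"
    by (rule order_trans) (simp add: max_def)
  have "(cmod (sol a z (x n)))\<^sup>2 + (cmod (sol a z (x (Suc n))))\<^sup>2 \<le> (cmod (sol a z (x n)) + cmod (sol a z (x (Suc n))))\<^sup>2"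
    by (simp add: power2_sum)
  from power2_le_imp_le[OF order_trans[OF le this]]
  show "cmod (sol a z t) \<le> cmod (sol a z (x n)) + cmod (sol a z (x (Suc n)))" by simp
qed

end

section \<open>Square integrability of the solution and the deficiency indices\<close>

context harmonic_interactions begin

text \<open>
  Integration by parts against the two normalised solutions \<open>sinh (s (t - x n))\<close> and
  \<open>sinh (s (x (n + 1) - t))\<close>, \<open>s = a (n + 1)\<close>, of \<open>p'' = q p\<close> expresses the one-sided derivatives of
  \<open>sol\<close> through its values at the grid points.
\<close>

lemma sol_segment_derivatives:
  assumes a: "a > 0" and coth: "a * (cosh a / sinh a) = 2" and z: "Re z = 0"
  defines "h \<equiv> \<lambda>t. (z - complex_of_real (q_step x a t)) * sol a z t"
    and "c \<equiv> complex_of_real (a / sinh a)" and "y \<equiv> \<lambda>n. sol a z (x n)"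
  obtains P Q where
    "Vl 1 h n (x (Suc n)) = 2 * of_nat (Suc n) * y (Suc n) - of_nat (Suc n) * c * y n - z * P"
    "V 1 h (x n) = of_nat (Suc n) * c * y (Suc n) - 2 * of_nat (Suc n) * y n + z * Q"
    "cmod P \<le> (cmod (y n) + cmod (y (Suc n))) / real (Suc n)"
    "cmod Q \<le> (cmod (y n) + cmod (y (Suc n))) / real (Suc n)"
proof -
  \<comment> \<open>\<open>s^2\<close> is the value of the potential inside the segment, and
    \<open>s * (r - l) = a\<close>, so the hyperbolic functions at the end points do not depend on
    \<open>n\<close>.\<close>
  define l r s where "l = x n" and "r = x (Suc n)" and "s = a * real (Suc n)"
  have lr: "l < r" "r - l = 1 / real (Suc n)" using x_less_Suc[of n] d_eq[of n] by (auto simp: l_def r_def)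
  have s: "s > 0" "s * (r - l) = a" using a lr by (simp_all add: s_def)
  have sa: "sinh a > 0" using a by simp
  have hl: "loc_int h" unfolding h_def by (rule sol_eq_U(1)[OF a z])
  have uU: "sol a z t = U 1 h t" if "0 \<le> t" for t unfolding h_def by (rule sol_eq_U(2)[OF a z that])
  have Uy: "U 1 h l = y n" "U 1 h r = y (Suc n)"
    using uU x_nonneg by (simp_all add: y_def l_def r_def)
  have ibp: "Vl 1 h n r * complex_of_real (p r) - y (Suc n) * complex_of_real (p' r)
       - (V 1 h l * complex_of_real (p l) - y n * complex_of_real (p' l))
      = - (z * integral {l..r} (\<lambda>t. sol a z t * complex_of_real (p t)))"
    and bnd: "cmod (integral {l..r} (\<lambda>t. sol a z t * complex_of_real (p t))) \<le> (cmod (y n) + cmod (y (Suc n))) / real (Suc n)"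
    if dp: "\<And>t. (p has_real_derivative p' t) (at t)" and dp': "\<And>t. (p' has_real_derivative s\<^sup>2 * p t) (at t)"
      and p1: "\<And>t. t \<in> {l..r} \<Longrightarrow> \<bar>p t\<bar> \<le> 1" for p p'
  proof -
    have cd: "((\<lambda>t. complex_of_real (f t)) has_vector_derivative complex_of_real f') (at t within S)"
      if "(f has_real_derivative f') (at t)" for f f' t S
      by (rule has_vector_derivative_at_within[OF has_vector_derivative_of_real[OF that]])
    have cp: "continuous_on S (\<lambda>t. complex_of_real (p t))" for S
      unfolding continuous_on_eq_continuous_within
      using has_vector_derivative_continuous[OF cd[OF dp]] by blast
    have cu: "continuous_on {l..r} (sol a z)"
      by (rule continuous_on_subset[OF continuous_on_sol[OF a z]]) (use x_nonneg[of n] in \<open>auto simp: l_def\<close>)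
    have cp'': "continuous_on {l..r} (\<lambda>t. complex_of_real (s\<^sup>2 * p t))"
      using cp[of "{l..r}"] by (simp add: continuous_on_mult_left)
    have ii: "(\<lambda>t. sol a z t * complex_of_real (p t)) integrable_on {l..r}"
      by (intro integrable_continuous_real continuous_on_mult cu cp)
    have "Vl 1 h n r * complex_of_real (p r) - U 1 h r * complex_of_real (p' r)
       - (V 1 h l * complex_of_real (p l) - U 1 h l * complex_of_real (p' l))
      = - integral {l..r} (\<lambda>t. h t * complex_of_real (p t) + U 1 h t * complex_of_real (s\<^sup>2 * p t))"
      unfolding l_def r_def
      by (rule integration_by_parts_segment[OF hl, of n "\<lambda>t. complex_of_real (p t)" "\<lambda>t. complex_of_real (p' t)"
        "\<lambda>t. complex_of_real (s\<^sup>2 * p t)" 1, OF cd[OF dp] cd[OF dp'] cp''[unfolded l_def r_def]])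
    also have "integral {l..r} (\<lambda>t. h t * complex_of_real (p t) + U 1 h t * complex_of_real (s\<^sup>2 * p t))
        = integral {l..r} (\<lambda>t. z * (sol a z t * complex_of_real (p t)))"
    proof (rule integral_spike[of "{l, r}"])
      fix t assume t: "t \<in> {l..r} - {l, r}"
      then have "x n < t" "t < x (Suc n)" by (auto simp: l_def r_def)
      then have q: "q_step x a t = s\<^sup>2" by (simp add: q_step_segment s_def power_mult_distrib del: of_nat_Suc)
      have "0 \<le> t" using \<open>x n < t\<close> x_nonneg[of n] by linarith
      then show "z * (sol a z t * complex_of_real (p t)) = h t * complex_of_real (p t) + U 1 h t * complex_of_real (s\<^sup>2 * p t)"
        using uU[of t] by (simp add: h_def q algebra_simps)
    qed simp
    also have "\<dots> = z * integral {l..r} (\<lambda>t. sol a z t * complex_of_real (p t))"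
      by (rule Henstock_Kurzweil_Integration.integral_mult_right)
    finally show "Vl 1 h n r * complex_of_real (p r) - y (Suc n) * complex_of_real (p' r)
       - (V 1 h l * complex_of_real (p l) - y n * complex_of_real (p' l))
      = - (z * integral {l..r} (\<lambda>t. sol a z t * complex_of_real (p t)))"
      unfolding Uy .
    define m where "m = cmod (y n) + cmod (y (Suc n))"
    have "cmod (integral {l..r} (\<lambda>t. sol a z t * complex_of_real (p t))) \<le> integral {l..r} (\<lambda>t. m)"
    proof (rule integral_norm_bound_integral[OF ii])
      fix t assume t: "t \<in> {l..r}"
      have "cmod (sol a z t) \<le> cmod (y n) + cmod (y (Suc n))"
        unfolding y_def by (rule sol_bound(2)[OF a z]) (use t in \<open>auto simp: l_def r_def\<close>)
      then have "cmod (sol a z t) * \<bar>p t\<bar> \<le> (cmod (y n) + cmod (y (Suc n))) * 1"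
        by (intro mult_mono p1[OF t]) auto
      then show "norm (sol a z t * complex_of_real (p t)) \<le> m" by (simp add: m_def norm_mult)
    qed (rule integrable_continuous_real[OF continuous_on_const])
    also have "\<dots> = (r - l) * m" using lr(1) by simp
    also have "\<dots> = (cmod (y n) + cmod (y (Suc n))) / real (Suc n)" unfolding lr(2) m_def by simp
    finally show "cmod (integral {l..r} (\<lambda>t. sol a z t * complex_of_real (p t))) \<le> (cmod (y n) + cmod (y (Suc n))) / real (Suc n)" .
  qed
  have sinh_le: "\<bar>sinh v / sinh a\<bar> \<le> 1" if "0 \<le> v" "v \<le> a" for v
    using that sa by simp
  have sr: "s * (t - l) \<le> a" "s * (r - t) \<le> a" "0 \<le> s * (t - l)" "0 \<le> s * (r - t)" if "t \<in> {l..r}" for t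
  proof -
    have "s * (t - l) \<le> s * (r - l)" "s * (r - t) \<le> s * (r - l)"
      using that s(1) by (auto intro!: mult_left_mono)
    then show "s * (t - l) \<le> a" "s * (r - t) \<le> a" using s(2) by auto
    show "0 \<le> s * (t - l)" "0 \<le> s * (r - t)" using that s(1) by auto
  qed
  \<comment> \<open>The condition on \<open>a\<close> enters here: the slope of a normalised
    solution at the end where it equals 1 is, up to sign, \<open>2 (n + 1)\<close>.\<close>
  have coth': "s * cosh a / sinh a = 2 * real (Suc n)"
  proof -
    have "s * cosh a / sinh a = real (Suc n) * (a * (cosh a / sinh a))" by (simp add: s_def)
    then show ?thesis unfolding coth by simp
  qed
  have cc: "complex_of_real (s / sinh a) = of_nat (Suc n) * c" by (simp add: c_def s_def del: of_nat_Suc)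
  define p1 p1' where "p1 t = sinh (s * (t - l)) / sinh a" and "p1' t = s * cosh (s * (t - l)) / sinh a" for t
  have d1: "(p1 has_real_derivative p1' t) (at t)" "(p1' has_real_derivative s\<^sup>2 * p1 t) (at t)" for t
    unfolding p1_def[abs_def] p1'_def[abs_def] using sa
    by (auto intro!: derivative_eq_intros simp: power2_eq_square)
  have b1: "\<bar>p1 t\<bar> \<le> 1" if "t \<in> {l..r}" for t unfolding p1_def using sr[OF that] by (intro sinh_le)
  have v1: "p1 l = 0" "p1 r = 1" "p1' l = s / sinh a" "p1' r = 2 * real (Suc n)"
    using sa s(2) coth' by (simp_all add: p1_def p1'_def)
  define p2 p2' where "p2 t = sinh (s * (r - t)) / sinh a" and "p2' t = - s * cosh (s * (r - t)) / sinh a" for t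
  have d2: "(p2 has_real_derivative p2' t) (at t)" "(p2' has_real_derivative s\<^sup>2 * p2 t) (at t)" for t
    unfolding p2_def[abs_def] p2'_def[abs_def] using sa
    by (auto intro!: derivative_eq_intros simp: power2_eq_square)
  have b2: "\<bar>p2 t\<bar> \<le> 1" if "t \<in> {l..r}" for t unfolding p2_def using sr[OF that] by (intro sinh_le)
  have v2: "p2 l = 1" "p2 r = 0" "p2' r = - (s / sinh a)" "p2' l = - (2 * real (Suc n))"
    using sa s(2) coth' by (simp_all add: p2_def p2'_def)
  show thesis
  proof (rule that)
    show "Vl 1 h n (x (Suc n)) = 2 * of_nat (Suc n) * y (Suc n) - of_nat (Suc n) * c * y n
        - z * integral {l..r} (\<lambda>t. sol a z t * complex_of_real (p1 t))"
      using ibp[OF d1 b1] unfolding v1 cc by (simp add: r_def algebra_simps del: of_nat_Suc)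
    show "V 1 h (x n) = of_nat (Suc n) * c * y (Suc n) - 2 * of_nat (Suc n) * y n
        + z * integral {l..r} (\<lambda>t. sol a z t * complex_of_real (p2 t))"
      using ibp[OF d2 b2] unfolding v2 of_real_minus cc by (simp add: l_def algebra_simps del: of_nat_Suc)
  qed (use bnd[OF d1 b1] bnd[OF d2 b2] in auto)
qed

text \<open>The jump at \<open>x (n + 1)\<close> joins the left derivative from segment
  \<open>n\<close> and the right derivative from segment \<open>n + 1\<close>. The coefficients
  \<open>2 (n + 1)\<close> and \<open>2 (n + 2)\<close> of the middle value add up to
  \<open>- \<alpha> (n + 1)\<close> and cancel; division by \<open>c = a / sinh a\<close> produces
  \<open>K\<close>.\<close>

lemma sol_recursion:
  assumes a: "a > 0" and coth: "a * (cosh a / sinh a) = 2" and z: "Re z = 0"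
  defines "y \<equiv> \<lambda>n. cmod (sol a z (x n))" and "K \<equiv> cmod z * sinh a / a"
  shows "real (n + 2) * y (n + 2) \<le> real (n + 1) * y n
      + K / real (n + 1) * (y n + y (n + 1)) + K / real (n + 2) * (y (n + 1) + y (n + 2))"
proof -
  define h where "h t = (z - complex_of_real (q_step x a t)) * sol a z t" for t
  have hl: "loc_int h" unfolding h_def[abs_def] by (rule sol_eq_U(1)[OF a z])
  define c where "c = a / sinh a"
  have c: "c > 0" using a by (simp add: c_def)
  define u where "u n = sol a z (x n)" for n
  have uU: "u n = U 1 h (x n)" for n
    unfolding u_def h_def[abs_def] by (rule sol_eq_U(2)[OF a z x_nonneg])
  obtain P Q0 where P: "Vl 1 h n (x (Suc n)) = 2 * of_nat (Suc n) * u (Suc n) - of_nat (Suc n) * complex_of_real c * u n - z * P"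
    "cmod P \<le> (cmod (u n) + cmod (u (Suc n))) / real (Suc n)"
    unfolding h_def[abs_def] u_def c_def by (rule sol_segment_derivatives[OF a coth z, of n]) blast
  obtain P0 Q where Q: "V 1 h (x (Suc n)) = of_nat (Suc (Suc n)) * complex_of_real c * u (Suc (Suc n)) - 2 * of_nat (Suc (Suc n)) * u (Suc n) + z * Q"
    "cmod Q \<le> (cmod (u (Suc n)) + cmod (u (Suc (Suc n)))) / real (Suc (Suc n))"
    unfolding h_def[abs_def] u_def c_def by (rule sol_segment_derivatives[OF a coth z, of "Suc n"]) blast
  have al: "complex_of_real (\<alpha> (Suc n)) = - 4 * of_nat (Suc n) - 2"
    using \<alpha>_eq[rule_format, of "Suc n"] by simp
  have "V 1 h (x (Suc n)) = Vl 1 h n (x (Suc n)) + complex_of_real (\<alpha> (Suc n)) * u (Suc n)"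
    unfolding uU by (rule V_jump[OF hl])
  then have "of_nat (Suc (Suc n)) * complex_of_real c * u (Suc (Suc n)) - 2 * of_nat (Suc (Suc n)) * u (Suc n) + z * Q
    = 2 * of_nat (Suc n) * u (Suc n) - of_nat (Suc n) * complex_of_real c * u n - z * P + (- 4 * of_nat (Suc n) - 2) * u (Suc n)"
    unfolding P(1) Q(1) al .
  moreover have "of_nat (Suc (Suc n)) = of_nat (Suc n) + (1::complex)" by simp
  ultimately have "of_nat (Suc (Suc n)) * complex_of_real c * u (Suc (Suc n)) = - (of_nat (Suc n) * complex_of_real c * u n) - z * P - z * Q"
    by algebra
  then have "cmod (of_nat (Suc (Suc n)) * complex_of_real c * u (Suc (Suc n)))
      = cmod (- (of_nat (Suc n) * complex_of_real c * u n) - z * P - z * Q)" by simp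
  also have "\<dots> \<le> cmod (of_nat (Suc n) * complex_of_real c * u n) + cmod (z * P) + cmod (z * Q)"
    using norm_triangle_ineq4[of "- (of_nat (Suc n) * complex_of_real c * u n) - z * P" "z * Q"]
      norm_triangle_ineq4[of "- (of_nat (Suc n) * complex_of_real c * u n)" "z * P"]
    unfolding norm_minus_cancel by linarith
  finally have 1: "real (Suc (Suc n)) * c * cmod (u (Suc (Suc n))) \<le> real (Suc n) * c * cmod (u n) + cmod z * cmod P + cmod z * cmod Q"
    using c unfolding norm_mult norm_of_nat norm_of_real by simp
  have "c * (real (Suc (Suc n)) * cmod (u (Suc (Suc n))))
     \<le> c * (real (Suc n) * cmod (u n) + K * ((cmod (u n) + cmod (u (Suc n))) / real (Suc n))
       + K * ((cmod (u (Suc n)) + cmod (u (Suc (Suc n)))) / real (Suc (Suc n))))"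
  proof -
    have cK: "c * K = cmod z" using a by (simp add: c_def K_def)
    have "cmod z * cmod P \<le> c * K * ((cmod (u n) + cmod (u (Suc n))) / real (Suc n))"
      unfolding cK by (rule mult_left_mono[OF P(2)]) simp
    moreover have "cmod z * cmod Q \<le> c * K * ((cmod (u (Suc n)) + cmod (u (Suc (Suc n)))) / real (Suc (Suc n)))"
      unfolding cK by (rule mult_left_mono[OF Q(2)]) simp
    ultimately show ?thesis using 1 by (simp add: distrib_left mult.assoc mult.left_commute del: of_nat_Suc)
  qed
  then have "real (Suc (Suc n)) * cmod (u (Suc (Suc n)))
     \<le> real (Suc n) * cmod (u n) + K * ((cmod (u n) + cmod (u (Suc n))) / real (Suc n))
       + K * ((cmod (u (Suc n)) + cmod (u (Suc (Suc n)))) / real (Suc (Suc n)))"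
    using c by (simp only: mult_le_cancel_left_pos)
  then show ?thesis by (simp add: y_def u_def)
qed

text \<open>By \<open>sol_bound\<close> a segment contributes at most its length times the sum of
  the two squared end values. The recursion makes this summable, and monotone convergence passes to
  the half-line.\<close>

lemma sq_int_sol:
  assumes a: "a > 0" and coth: "a * (cosh a / sinh a) = 2" and z: "Re z = 0"
  shows "sq_int (sol a z)"
proof -
  define y where "y n = cmod (sol a z (x n))" for n
  have s: "summable (\<lambda>n. (y n)\<^sup>2 / real (Suc n))"
  proof (rule summable_perturbed_recursion)
    show "y n \<ge> 0" for n by (simp add: y_def)
    show "0 \<le> cmod z * sinh a / a" using a by simp
    show "real (n + 2) * y (n + 2) \<le> real (n + 1) * y n + cmod z * sinh a / a / real (n + 1) * (y n + y (n + 1))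
      + cmod z * sinh a / a / real (n + 2) * (y (n + 1) + y (n + 2))" for n
      unfolding y_def by (rule sol_recursion[OF a coth z])
  qed
  \<comment> \<open>The factor 2 absorbs the index shift,
    \<open>1 / (n + 1) \<le> 2 / (n + 2)\<close>.\<close>
  define b where "b n = (y n)\<^sup>2 / real (Suc n) + 2 * ((y (Suc n))\<^sup>2 / real (Suc (Suc n)))" for n
  have bs: "summable b"
    unfolding b_def using s summable_Suc_iff[of "\<lambda>n. (y n)\<^sup>2 / real (Suc n)"]
    by (intro summable_add summable_mult) auto
  have cs: "continuous_on {l..r} (\<lambda>t. (cmod (sol a z t))\<^sup>2)" if "0 \<le> l" for l r
    by (intro continuous_intros continuous_on_subset[OF continuous_on_sol[OF a z]]) (use that in auto)
  have i: "(\<lambda>t. (cmod (sol a z t))\<^sup>2) integrable_on {l..r}" if "0 \<le> l" for l r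
    by (rule integrable_continuous_real[OF cs[OF that]])
  have seg: "integral {x n..x (Suc n)} (\<lambda>t. (cmod (sol a z t))\<^sup>2) \<le> b n" for n
  proof -
    have "integral {x n..x (Suc n)} (\<lambda>t. (cmod (sol a z t))\<^sup>2) \<le> integral {x n..x (Suc n)} (\<lambda>t. (y n)\<^sup>2 + (y (Suc n))\<^sup>2)"
      by (rule integral_le[OF i[OF x_nonneg]]) (use sol_bound(1)[OF a z, of n] in \<open>auto simp: y_def\<close>)
    also have "\<dots> = ((y n)\<^sup>2 + (y (Suc n))\<^sup>2) / real (Suc n)"
      using x_less_Suc[of n] d_eq[of n] by simp
    also have "\<dots> \<le> b n"
    proof -
      have "1 / real (Suc n) \<le> 2 / real (Suc (Suc n))" by (simp add: field_simps)
      then have "(y (Suc n))\<^sup>2 * (1 / real (Suc n)) \<le> (y (Suc n))\<^sup>2 * (2 / real (Suc (Suc n)))"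
        by (rule mult_left_mono) simp
      then show ?thesis by (simp add: b_def add_divide_distrib mult.commute[of _ "2::real"])
    qed
    finally show ?thesis .
  qed
  have upto: "integral {0..x N} (\<lambda>t. (cmod (sol a z t))\<^sup>2) \<le> suminf b" for N
  proof -
    have "integral {0..x N} (\<lambda>t. (cmod (sol a z t))\<^sup>2) \<le> (\<Sum>n<N. b n)"
    proof (induction N)
      case (Suc N)
      have "integral {0..x N} (\<lambda>t. (cmod (sol a z t))\<^sup>2) + integral {x N..x (Suc N)} (\<lambda>t. (cmod (sol a z t))\<^sup>2)
          = integral {0..x (Suc N)} (\<lambda>t. (cmod (sol a z t))\<^sup>2)"
        by (rule Henstock_Kurzweil_Integration.integral_combine[OF x_nonneg less_imp_le[OF x_less_Suc] i]) simp
      then show ?case using Suc seg[of N] by simp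
    qed (simp add: x_0)
    also have "\<dots> \<le> suminf b"
      by (rule sum_le_suminf[OF bs]) (auto simp: b_def)
    finally show ?thesis .
  qed
  define g where "g n t = (if t \<in> {0..x n} then (cmod (sol a z t))\<^sup>2 else 0)" for n t
  have int_g: "(g n has_integral integral {0..x n} (\<lambda>t. (cmod (sol a z t))\<^sup>2)) {0..}" for n
    unfolding g_def using integrable_integral[OF i[OF order_refl, of "x n"]]
    by (subst has_integral_restrict) auto
  have "(\<lambda>t. (cmod (sol a z t))\<^sup>2) integrable_on {0..} \<and> (\<lambda>n. integral {0..} (g n)) \<longlonglongrightarrow> integral {0..} (\<lambda>t. (cmod (sol a z t))\<^sup>2)"
  proof (rule monotone_convergence_increasing)
    show "g n integrable_on {0..}" for n using int_g by blast
    show "g n t \<le> g (Suc n) t" for n t using x_less_Suc[of n] by (auto simp: g_def)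
    show "(\<lambda>n. g n t) \<longlonglongrightarrow> (cmod (sol a z t))\<^sup>2" if "t \<in> {0..}" for t
    proof (rule tendsto_eventually)
      have "\<forall>\<^sub>F n in sequentially. t \<le> x n" using x_at_top by (simp add: filterlim_at_top)
      then show "\<forall>\<^sub>F n in sequentially. g n t = (cmod (sol a z t))\<^sup>2"
        by eventually_elim (use that in \<open>auto simp: g_def\<close>)
    qed
    have "\<bar>integral {0..} (g n)\<bar> \<le> suminf b" for n
      using upto[of n] integral_unique[OF int_g[of n]]
        Henstock_Kurzweil_Integration.integral_nonneg[OF i[OF order_refl, of "x n"]] by simp
    then show "bounded (range (\<lambda>n. integral {0..} (g n)))" unfolding bounded_iff by auto
  qed
  then have "(\<lambda>t. (cmod (sol a z t))\<^sup>2) absolutely_integrable_on {0..}"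
    by (intro nonnegative_absolutely_integrable_1) auto
  moreover have "sol a z \<in> borel_measurable leb_I"
    by (rule continuous_imp_measurable_on_sets_lebesgue[OF continuous_on_sol[OF a z]]) simp
  ultimately show ?thesis
    by (simp add: sq_int_def absolutely_integrable_iff_integrable_lebesgue_on)
qed

text \<open>An element of the kernel has a representative solving the integral equation with some
  initial value \<open>c\<close>. Its difference to \<open>c\<close> times \<open>sol\<close> has
  zero initial data and vanishes by \<open>U_volterra_unique\<close>, so \<open>sol\<close>, which
  is 1 at 0, spans the kernel. \<open>Re z = 0\<close> covers both \<open>\<i>\<close> and
  \<open>- \<i>\<close>.\<close>

lemma deficiency_index_q_step:
  assumes a: "a > 0" and coth: "a * (cosh a / sinh a) = 2" and z: "Re z = 0"
  shows "deficiency_index (Hamiltonian x \<alpha> (q_step x a)) z = 1"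
proof -
  define q where "q = q_step x a"
  have q: "locally_bounded_potential q" unfolding q_def by (rule locally_bounded_q_step)
  define u where "u = sol a z"
  have us: "sq_int u" unfolding u_def by (rule sq_int_sol[OF a coth z])
  define k where "k t = (z - complex_of_real (q t)) * u t" for t
  have kl: "loc_int k" unfolding k_def[abs_def] u_def q_def by (rule sol_eq_U(1)[OF a z])
  have uU: "u t = U 1 k t" if "0 \<le> t" for t
    unfolding k_def[abs_def] u_def q_def by (rule sol_eq_U(2)[OF a z that])
  have k': "k = (\<lambda>t. z * u t - complex_of_real (q t) * u t)"
    by (auto simp: k_def left_diff_distrib)
  have mem: "(l2_of u, cscale z (l2_of u)) \<in> adjoint_op (H_min x \<alpha> q)"
    unfolding cscale_l2_of[OF us]
  proof (rule adjoint_op_H_minI[OF q us sq_int_scale[OF us]])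
    show "AE t in leb_I. u t = U 1 (\<lambda>t. z * u t - complex_of_real (q t) * u t) t"
      unfolding AE_leb_I_iff_negligible k'[symmetric] using uU by auto
  qed
  have "{w. (w, cscale z w) \<in> adjoint_op (H_min x \<alpha> q)} = range (\<lambda>c. cscale c (l2_of u))"
  proof (intro set_eqI iffI)
    fix w assume "w \<in> range (\<lambda>c. cscale c (l2_of u))"
    then obtain c where c: "w = cscale c (l2_of u)" by blast
    have "(cscale c (l2_of u), cscale c (cscale z (l2_of u))) \<in> adjoint_op (H_min x \<alpha> q)"
      by (rule linear_relationD(4)[OF adjoint_linear_relation mem])
    then show "w \<in> {w. (w, cscale z w) \<in> adjoint_op (H_min x \<alpha> q)}" by (simp add: c mult.commute)
  next
    fix w assume "w \<in> {w. (w, cscale z w) \<in> adjoint_op (H_min x \<alpha> q)}"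
    then have "(w, cscale z w) \<in> adjoint_op (H_min x \<alpha> q)" by simp
    then obtain c w0 v0 where w0: "sq_int w0" "sq_int v0" "w = l2_of w0" "cscale z w = l2_of v0"
      "w0 = U c (\<lambda>t. v0 t - complex_of_real (q t) * w0 t)"
      by (rule adjoint_op_H_minE[OF q])
    have "l2_of v0 = l2_of (\<lambda>t. z * w0 t)" using w0(4) unfolding w0(3) cscale_l2_of[OF w0(1)] by simp
    then have v0: "AE t in leb_I. v0 t = z * w0 t" using l2_of_eq_iff[OF w0(2) sq_int_scale[OF w0(1)]] by simp
    define m where "m t = (z - complex_of_real (q t)) * w0 t" for t
    have "AE t in leb_I. v0 t - complex_of_real (q t) * w0 t = m t"
      using v0 by eventually_elim (simp add: m_def left_diff_distrib)
    then have w0U: "w0 = U c m" using w0(5) U_cong_AE by metis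
    have wl: "loc_int w0" by (rule sq_int_imp_loc_int[OF w0(1)])
    have "loc_int (\<lambda>t. z * w0 t - complex_of_real (q t) * w0 t)"
      by (intro loc_int_diff loc_int_mult_continuous[OF wl] continuous_on_const loc_int_potential_mult[OF q wl])
    then have ml: "loc_int m" by (simp add: m_def[abs_def] left_diff_distrib)
    define e where "e t = m t - c * k t" for t
    have el: "loc_int e"
      unfolding e_def[abs_def] by (intro loc_int_diff ml loc_int_mult_continuous[OF kl] continuous_on_const)
    have eU: "w0 t - c * u t = U 0 e t" if "0 \<le> t" for t
      using U_diff_cmult[OF ml kl, of c t c 1] uU[OF that] w0U by (simp add: e_def[abs_def])
    have zero: "w0 t - c * u t = 0" if t: "0 \<le> t" for t
    proof -
      obtain M where M: "\<And>r. r \<in> {0..t} \<Longrightarrow> \<bar>q r\<bar> \<le> M" using q unfolding locally_bounded_potential_def by meson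
      have "U 0 e t = 0"
      proof (rule U_volterra_unique[OF el _ t order_refl])
        fix r assume r: "0 \<le> r" "r \<le> t"
        have "e r = (z - complex_of_real (q r)) * U 0 e r"
          unfolding eU[OF r(1), symmetric] by (simp add: e_def m_def k_def algebra_simps)
        then have "cmod (e r) = cmod (z - complex_of_real (q r)) * cmod (U 0 e r)" by (metis norm_mult)
        also have "\<dots> \<le> (cmod z + M) * cmod (U 0 e r)"
          using norm_triangle_ineq4[of z "complex_of_real (q r)"] M[of r] r by (intro mult_right_mono) auto
        finally show "cmod (e r) \<le> (cmod z + M) * cmod (U 0 e r)" .
      qed
      then show ?thesis using eU[OF t] by simp
    qed
    have "AE t in leb_I. w0 t = c * u t"
      unfolding AE_leb_I_iff_negligible using zero by auto
    then have "w = cscale c (l2_of u)"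
      unfolding w0(3) cscale_l2_of[OF us] using l2_of_eq_iff[OF w0(1) sq_int_scale[OF us]] by simp
    then show "w \<in> range (\<lambda>c. cscale c (l2_of u))" by blast
  qed
  moreover have "l2_of u \<noteq> 0"
  proof
    assume "l2_of u = 0"
    then have "AE t in leb_I. u t = 0" unfolding zero_l2_of l2_of_eq_iff[OF us sq_int_zero] .
    then have "u 0 = 0" using continuous_AE_zero[OF continuous_on_sol[OF a z], of 0] by (simp add: u_def)
    then show False using sol_0[OF a z] by (simp add: u_def)
  qed
  ultimately have "cdimension {w. (w, cscale z w) \<in> adjoint_op (H_min x \<alpha> q)} = 1" by (rule cdimension_line)
  then show ?thesis
    unfolding deficiency_index_def Hamiltonian_def adjoint_op_closure[OF linear_relation_H_min[OF locally_bounded_q_step]]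
    by (simp add: q_def)
qed

lemma symmetric_q_step: "symmetric_op (Hamiltonian x \<alpha> (q_step x a))"
  unfolding Hamiltonian_def
  by (rule symmetric_op_closure[OF linear_relation_H_min[OF locally_bounded_q_step]
    H_min_subset_adjoint[OF locally_bounded_q_step] adjoint_op_H_min_single_valued[OF locally_bounded_q_step]])

end

theorem corollary7p3:
  fixes x \<alpha> :: "nat \<Rightarrow> real"
  assumes "x 0 = 0"
    and "\<forall>n\<ge>1. x n - x (n - 1) = 1 / real n"
    and "\<forall>n\<ge>1. \<alpha> n = - 4 * real n - 2"
  shows "self_adjoint_op (Hamiltonian x \<alpha> (\<lambda>t. 0)) \<and>
    (\<forall>a0::real. a0 > 0 \<longrightarrow> a0 * (cosh a0 / sinh a0) = 2 \<longrightarrow>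
       symmetric_op (Hamiltonian x \<alpha> (q_step x a0)) \<and>
       deficiency_index (Hamiltonian x \<alpha> (q_step x a0)) \<i> = 1 \<and>
       deficiency_index (Hamiltonian x \<alpha> (q_step x a0)) (- \<i>) = 1)"
proof -
  interpret harmonic_interactions x \<alpha>
    by unfold_locales (rule assms)+
  show ?thesis
    using self_adjoint_free symmetric_q_step deficiency_index_q_step[of _ \<i>] deficiency_index_q_step[of _ "- \<i>"] by simp
qed

end
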